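(* If a nice tree decomposition of width $w$ of an $n$-vertex graph $G$ is given, then $\{P_4\}$-TM-Deletion on $G$ (with any integer $k$) can be solved in time $\mathcal{O}(36^{w}\cdot w\cdot n)$.
   Context: $P_4$ is the path on $4$ vertices. $\{P_4\}$-TM-Deletion: given a graph $G$ and integer $k$, decide whether there is $S\subseteq V(G)$ with $|S|\le k$ such that $G\setminus S$ does not contain $P_4$ as a topological minor. A nice tree decomposition of $G$ is a tree decomposition $(T,\{X_t\})$ rooted at a node $r$ with $X_r=\emptyset$, in which every node has at most two children, every leaf has an empty bag, every node $t$ with exactly one child $t'$ is either an introduce node ($X_t=X_{t'}\cup\{v\}$, $v\notin X_{t'}$) or a forget node ($X_t=X_{t'}\setminus\{v\}$, $v\in X_{t'}$), and every node with two children $t',t''$ has $X_t=X_{t'}=X_{t''}$; its width is the maximum bag size minus one.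
   Formalization: The given nice tree decomposition is assumed to have at most d·w·n nodes for some constant d (any d; the hidden constant depends on d), since its size is otherwise unbounded in w and n; factors w and n equal to 0 (and w = -1) are read as 1 in the bound. *)

theory Defs
  imports "Graph_Theory.Graph_Theory"
begin

section \<open>Topological minors and the deletion problem\<close>

text \<open>
  A finite simple undirected graph is a symmetric loop-free finite digraph, \<^const>\<open>pair_graph\<close>;
  an edge is a pair of opposite arcs.
\<close>

definition path_graph :: "nat \<Rightarrow> nat pair_pre_digraph" where
  "path_graph m = \<lparr> pverts = {0..<m},
     parcs = {(i, j). i < m \<and> j < m \<and> (j = Suc i \<or> i = Suc j)} \<rparr>"

text \<open>
  Some subgraph \<open>H\<close> of \<open>G\<close> is a subdivision of a copy \<open>K\<close> of \<open>F\<close>. As in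
  \<^const>\<open>kuratowski_planar\<close>, the arc reversals \<open>rev_K\<close>, \<open>rev_H\<close> are what make \<open>K\<close> and \<open>H\<close>
  undirected; in general \<open>K\<close> is not itself a subgraph of \<open>G\<close>.
\<close>

definition topological_minor :: "('c, 'd) pre_digraph \<Rightarrow> ('a, 'a \<times> 'a) pre_digraph \<Rightarrow> bool" where
  "topological_minor F G \<longleftrightarrow>
     (\<exists>H K rev_K rev_H. subgraph H G \<and> subdivision (K, rev_K) (H, rev_H) \<and> digraph_iso F K)"

definition TM_deletion :: "'c pair_pre_digraph set \<Rightarrow> 'a pair_pre_digraph \<Rightarrow> int \<Rightarrow> bool" where
  "TM_deletion \<F> G k \<longleftrightarrow>
     (\<exists>S \<subseteq> pverts G. int (card S) \<le> k \<and>
        (\<forall>F \<in> \<F>. \<not> topological_minor (with_proj F) (with_proj G \<restriction> (pverts G - S))))"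


section \<open>Nice tree decompositions\<close>

text \<open>
  A rooted tree is given by its nodes \<open>T\<close>, its root \<open>r\<close> and a parent function \<open>p\<close> that fixes the
  root. (\<^const>\<open>tree\<close> only excludes directed cycles, so it does not characterise undirected trees.)
\<close>

definition rooted_tree :: "'t set \<Rightarrow> 't \<Rightarrow> ('t \<Rightarrow> 't) \<Rightarrow> bool" where
  "rooted_tree T r p \<longleftrightarrow>
     finite T \<and> r \<in> T \<and> p ` T \<subseteq> T \<and> p r = r \<and> (\<forall>t \<in> T. \<exists>i. (p ^^ i) t = r)"

definition tree_graph :: "'t set \<Rightarrow> ('t \<Rightarrow> 't) \<Rightarrow> 't pair_pre_digraph" where
  "tree_graph T p = \<lparr> pverts = T,
     parcs = {(s, t). s \<in> T \<and> t \<in> T \<and> s \<noteq> t \<and> (p s = t \<or> p t = s)} \<rparr>"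

definition children :: "'t set \<Rightarrow> ('t \<Rightarrow> 't) \<Rightarrow> 't \<Rightarrow> 't set" where
  "children T p t = {t' \<in> T. t' \<noteq> t \<and> p t' = t}"

definition tree_decomposition ::
  "'a pair_pre_digraph \<Rightarrow> 't set \<Rightarrow> 't \<Rightarrow> ('t \<Rightarrow> 't) \<Rightarrow> ('t \<Rightarrow> 'a set) \<Rightarrow> bool" where
  "tree_decomposition G T r p X \<longleftrightarrow>
     rooted_tree T r p \<and>
     (\<Union>t \<in> T. X t) = pverts G \<and>
     (\<forall>(u, v) \<in> parcs G. \<exists>t \<in> T. u \<in> X t \<and> v \<in> X t) \<and>
     (\<forall>v \<in> pverts G. connected (with_proj (tree_graph T p) \<restriction> {t \<in> T. v \<in> X t}))"

definition nice_tree_decomposition ::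
  "'a pair_pre_digraph \<Rightarrow> 't set \<Rightarrow> 't \<Rightarrow> ('t \<Rightarrow> 't) \<Rightarrow> ('t \<Rightarrow> 'a set) \<Rightarrow> bool" where
  "nice_tree_decomposition G T r p X \<longleftrightarrow>
     tree_decomposition G T r p X \<and>
     X r = {} \<and>
     (\<forall>t \<in> T.
        card (children T p t) \<le> 2 \<and>
        (children T p t = {} \<longrightarrow> X t = {}) \<and>
        (\<forall>t'. children T p t = {t'} \<longrightarrow>
           (\<exists>v. v \<notin> X t' \<and> X t = insert v (X t')) \<or>
           (\<exists>v. v \<in> X t' \<and> X t = X t' - {v})) \<and>
        (\<forall>t' t''. t' \<noteq> t'' \<and> children T p t = {t', t''} \<longrightarrow> X t = X t' \<and> X t = X t''))"

text \<open>The width is an integer, since it is \<open>-1\<close> for the graph without vertices.\<close>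

definition width :: "'t set \<Rightarrow> ('t \<Rightarrow> 'a set) \<Rightarrow> int" where
  "width T X = int (Max ((\<lambda>t. card (X t)) ` T)) - 1"


section \<open>Random access machines\<close>

text \<open>
  Structured programs for a random access machine under the uniform cost criterion. The memory is
  an integer array with indirect addressing, and the only arithmetic is addition and subtraction:
  with unbounded integers, a unit-cost multiplication would make the model unreasonably strong.
\<close>

datatype expr =
    Const int
  | Load expr
  | Add expr expr
  | Sub expr expr

datatype prog =
    Skip
  | Store expr expr  \<comment> \<open>address, value\<close>
  | Seq prog prog
  | IfPos expr prog prog
  | WhilePos expr prog

type_synonym memory = "int \<Rightarrow> int"

primrec eval :: "expr \<Rightarrow> memory \<Rightarrow> int" where
  "eval (Const c) s = c"
| "eval (Load e) s = s (eval e s)"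
| "eval (Add e f) s = eval e s + eval f s"
| "eval (Sub e f) s = eval e s - eval f s"

primrec cost :: "expr \<Rightarrow> nat" where
  "cost (Const c) = 1"
| "cost (Load e) = cost e + 1"
| "cost (Add e f) = cost e + cost f + 1"
| "cost (Sub e f) = cost e + cost f + 1"

text \<open>\<open>run P s \<tau> s'\<close>: started in memory \<open>s\<close>, \<open>P\<close> halts after \<open>\<tau>\<close> steps with memory \<open>s'\<close>.\<close>

inductive run :: "prog \<Rightarrow> memory \<Rightarrow> nat \<Rightarrow> memory \<Rightarrow> bool" where
  run_Skip: "run Skip s 1 s"
| run_Store: "run (Store a e) s (cost a + cost e + 1) (s(eval a s := eval e s))"
| run_Seq: "run P s \<tau> s' \<Longrightarrow> run Q s' \<tau>' s'' \<Longrightarrow> run (Seq P Q) s (\<tau> + \<tau>') s''"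
| run_If_pos: "eval e s > 0 \<Longrightarrow> run P s \<tau> s' \<Longrightarrow> run (IfPos e P Q) s (cost e + 1 + \<tau>) s'"
| run_If_nonpos: "eval e s \<le> 0 \<Longrightarrow> run Q s \<tau> s' \<Longrightarrow> run (IfPos e P Q) s (cost e + 1 + \<tau>) s'"
| run_While_pos: "eval e s > 0 \<Longrightarrow> run P s \<tau> s' \<Longrightarrow> run (WhilePos e P) s' \<tau>' s'' \<Longrightarrow>
    run (WhilePos e P) s (cost e + 1 + \<tau> + \<tau>') s''"
| run_While_nonpos: "eval e s \<le> 0 \<Longrightarrow> run (WhilePos e P) s (cost e + 1) s"

text \<open>
  The input occupies the cells from address 0 on; all other cells, in particular those with
  negative addresses, are initially zero and serve as work space.
\<close>

definition input_memory :: "int list \<Rightarrow> memory" where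
  "input_memory xs = (\<lambda>a. if 0 \<le> a \<and> a < int (length xs) then xs ! nat a else 0)"


section \<open>Encoding of the instances\<close>

text \<open>Each edge is listed exactly once, in one of its two orientations.\<close>

definition edge_list_of :: "'a pair_pre_digraph \<Rightarrow> ('a \<times> 'a) list \<Rightarrow> bool" where
  "edge_list_of G es \<longleftrightarrow>
     distinct es \<and> set es \<inter> (set es)\<inverse> = {} \<and> parcs G = set es \<union> (set es)\<inverse>"

text \<open>
  The graph has vertices \<open>0, \<dots>, n - 1\<close> and edge list \<open>es\<close>. The decomposition has nodes
  \<open>0, \<dots>, length bags - 1\<close>; node \<open>t\<close> has parent \<open>par ! t\<close> and bag \<open>set (bags ! t)\<close>. No order on
  the edges, the nodes or the vertices of a bag is presupposed.
\<close>

definition encode_instance ::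
  "nat \<Rightarrow> (nat \<times> nat) list \<Rightarrow> int \<Rightarrow> nat list \<Rightarrow> nat list list \<Rightarrow> int list" where
  "encode_instance n es k par bags =
     [int n, k, int (length es), int (length bags)]
     @ concat (map (\<lambda>(u, v). [int u, int v]) es)
     @ map int par
     @ concat (map (\<lambda>b. int (length b) # map int b) bags)"

end

theory Submission imports Defs begin

text \<open>
  A graph has no \<open>P\<^sub>4\<close> topological minor iff it has no path on four vertices iff every component is a
  star or a triangle. The latter is certified by a labelling of the vertices: deleted, center, or
  other, where two centers are never adjacent and the neighbors of every other vertex have total
  weight 0 or 2 (a center weighs 2, an other vertex 1), two neighbors of weight 1 being adjacent.
  If some vertices have been forgotten, all that matters of an other vertex in the bag is the weight
  0, 1 or 2 of its forgotten neighbors. So five labels per bag vertex suffice. A table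
  gives the minimal number of deletions for each labelling of the bag; a finished child is moved
  into its parent by eliminating the vertices that leave the bag and adding up the weights, which
  costs \<open>O(25\<^sup>w w\<^sup>2)\<close> per node when all pairs of labellings are tried. This stays within
  \<open>O(36\<^sup>w)\<close>, so there is room for \<open>O(w n)\<close> nodes.
\<close>

section \<open>Topological minors of paths\<close>

text \<open>A subdivision of \<open>P4\<close> contains \<open>P4\<close> itself, because
  subdividing an edge only lengthens a path; this reduces the topological minor to a subgraph. A
  single weight describes both admissible shapes: a star leaf sees one center, a triangle vertex
  sees two others, so 2 is at once the value to be reached and a cap on what has been forgotten. The
  delicate condition is the adjacency of two neighbors of an other vertex, since a label does not
  tell which neighbors were forgotten; the check made earlier at a forgotten neighbor turns out to
  settle it. The machine shapes the rest: without multiplication and division, base-5 digits, row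
  offsets and powers of 5 come from tables filled by repeated addition. Memory that is initially
  zero lets 0 stand for an impossible labelling and spares the initialization of a quadratic
  adjacency matrix. As the nodes come in arbitrary order, a linear scan has to find children before
  their parents.\<close>

definition has_path4 :: "('a, 'b) pre_digraph \<Rightarrow> bool" where
  "has_path4 G \<longleftrightarrow> (\<exists>a b c d. distinct [a, b, c, d] \<and>
     {(a, b), (b, a), (b, c), (c, b), (c, d), (d, c)} \<subseteq> arcs_ends G)"

lemma has_path4_mono: "has_path4 H \<Longrightarrow> arcs_ends H \<subseteq> arcs_ends G \<Longrightarrow> has_path4 G"
  unfolding has_path4_def by (meson order_trans)

text \<open>If the new vertex \<open>w\<close> splits an outer edge of the path, it replaces the end
  vertex; if it splits the middle edge, it is inserted and the end \<open>d\<close> is dropped. Four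
  vertices remain in every case.\<close>

lemma has_path4_subdivision_step:
  assumes "subdivision_step G rev_G H rev_H (u, v, w) (uv, uw, vw)" "has_path4 G"
  shows "has_path4 H"
proof -
  interpret subdiv_step G rev_G H rev_H u v w uv uw vw
    using assms(1) by unfold_locales
  obtain a b c d where d: "distinct [a, b, c, d]" and
    arcs: "{(a, b), (b, a), (b, c), (c, b), (c, d), (d, c)} \<subseteq> arcs_ends G"
    using assms(2) by (auto simp: has_path4_def)
  have in_G: "x \<in> verts G \<and> y \<in> verts G" if "(x, y) \<in> arcs_ends G" for x y
    using that G.wellformed by (auto simp: arcs_ends_def arc_to_ends_def)
  have w: "w \<notin> {a, b, c, d}"
    using arcs in_G not_in_verts_G by blast
  \<comment> \<open>Arcs other than \<open>uv\<close> and its reverse survive with unchanged ends,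
    so a pair of ends can get lost only if it is \<open>(u, v)\<close> or
    \<open>(v, u)\<close>.\<close>
  have step: "(x, y) \<in> arcs_ends H \<or> (x, y) = (u, v) \<or> (x, y) = (v, u)"
    if xy: "(x, y) \<in> arcs_ends G" for x y
  proof -
    obtain e where e: "e \<in> arcs G" "tail G e = x" "head G e = y"
      using xy by (auto simp: arcs_ends_def arc_to_ends_def)
    show ?thesis
    proof (cases "e = uv \<or> e = rev_G uv")
      case True
      then show ?thesis using e in_arcs_G by auto
    next
      case False
      then have "e \<in> arcs H" using e(1) arcs_H by auto
      then show ?thesis using e
        by (auto simp: arcs_ends_def arc_to_ends_def head_eq tail_eq intro!: rev_image_eqI)
    qed
  qed
  have new: "(u, w) \<in> arcs_ends H" "(w, u) \<in> arcs_ends H" "(v, w) \<in> arcs_ends H" "(w, v) \<in> arcs_ends H"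
  proof -
    have "arc_to_ends H ` {uw, rev_H uw, vw, rev_H vw} \<subseteq> arcs_ends H"
      using in_arcs_H unfolding arcs_ends_def by (rule image_mono)
    then show "(u, w) \<in> arcs_ends H" "(w, u) \<in> arcs_ends H" "(v, w) \<in> arcs_ends H" "(w, v) \<in> arcs_ends H"
      using in_arcs_H by (auto simp: arc_to_ends_def)
  qed
  let ?E = "arcs_ends H"
  have sub: "has_path4 H" if "distinct [x1, x2, x3, x4]"
    "{(x1, x2), (x2, x1), (x2, x3), (x3, x2), (x3, x4), (x4, x3)} \<subseteq> ?E" for x1 x2 x3 x4
    using that unfolding has_path4_def by blast
  consider "{a, b} = {u, v}" | "{b, c} = {u, v}" | "{c, d} = {u, v}"
    | "{a, b} \<noteq> {u, v}" "{b, c} \<noteq> {u, v}" "{c, d} \<noteq> {u, v}" by blast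
  then show ?thesis
  proof cases
    case 1
    then have "(b, c) \<in> ?E" "(c, b) \<in> ?E" "(c, d) \<in> ?E" "(d, c) \<in> ?E"
      using arcs step[of b c] step[of c b] step[of c d] step[of d c] d by (auto simp: doubleton_eq_iff)
    moreover have "(w, b) \<in> ?E" "(b, w) \<in> ?E" using 1 new by (auto simp: doubleton_eq_iff)
    ultimately show ?thesis using sub[of w b c d] d w by auto
  next
    case 2
    then have "(a, b) \<in> ?E" "(b, a) \<in> ?E"
      using arcs step[of a b] step[of b a] d by (auto simp: doubleton_eq_iff)
    moreover have "(w, b) \<in> ?E" "(b, w) \<in> ?E" "(w, c) \<in> ?E" "(c, w) \<in> ?E"
      using 2 new by (auto simp: doubleton_eq_iff)
    ultimately show ?thesis using sub[of a b w c] d w by auto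
  next
    case 3
    then have "(b, c) \<in> ?E" "(c, b) \<in> ?E" "(a, b) \<in> ?E" "(b, a) \<in> ?E"
      using arcs step[of b c] step[of c b] step[of a b] step[of b a] d by (auto simp: doubleton_eq_iff)
    moreover have "(w, c) \<in> ?E" "(c, w) \<in> ?E" using 3 new by (auto simp: doubleton_eq_iff)
    ultimately show ?thesis using sub[of a b c w] d w by auto
  next
    case 4
    then have "{(a, b), (b, a), (b, c), (c, b), (c, d), (d, c)} \<subseteq> ?E"
      using arcs step[of a b] step[of b a] step[of b c] step[of c b] step[of c d] step[of d c]
      by (auto simp: doubleton_eq_iff)
    then show ?thesis using sub[of a b c d] d by blast
  qed
qed

lemma has_path4_subdivision:
  assumes "subdivision (K, rev_K) (H, rev_H)" "has_path4 K"
  shows "has_path4 H"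
  using assms
proof (induction rule: subdivision_induct)
  case (divide I rev_I H rev_H u v w uv uw vw)
  then show ?case by (auto intro: has_path4_subdivision_step)
qed

text \<open>Paths on four vertices survive subdivision and the passage to a larger graph.
  Conversely, a path in \<open>G\<close> is a topological minor by the trivial subdivision, with
  \<open>H = K\<close>.\<close>

lemma topological_minor_path4_iff:
  assumes "pair_graph G"
  shows "topological_minor (with_proj (path_graph 4)) (with_proj G \<restriction> W) \<longleftrightarrow>
    (\<exists>a b c d. distinct [a, b, c, d] \<and> {a, b, c, d} \<subseteq> W \<and> {(a, b), (b, c), (c, d)} \<subseteq> parcs G)"
    (is "?L \<longleftrightarrow> ?R")
proof
  interpret pair_graph G by fact
  have ends: "arcs_ends (with_proj G \<restriction> W) = {(u, v). (u, v) \<in> parcs G \<and> u \<in> W \<and> v \<in> W}"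
    by (auto simp: arcs_ends_def arc_to_ends_def)
  {
    assume ?L
    then obtain H K rev_K rev_H where H: "subgraph H (with_proj G \<restriction> W)"
      and sd: "subdivision (K, rev_K) (H, rev_H)"
      and iso: "digraph_iso (with_proj (path_graph 4)) K"
      by (auto simp: topological_minor_def)
    obtain f where f: "pre_digraph.digraph_isomorphism (with_proj (path_graph 4)) f"
      and K: "K = app_iso f (with_proj (path_graph 4))"
      using iso by (auto simp: digraph_iso_def)
    have "pverts (path_graph 4) = {0..<4}" by (simp add: path_graph_def)
    then have inj: "inj_on (iso_verts f) {0..<4}"
      and at: "\<And>e. e \<in> parcs (path_graph 4) \<Longrightarrow> arc_to_ends K (iso_arcs f e) = map_prod (iso_verts f) (iso_verts f) e"
      using f by (auto simp: pre_digraph.digraph_isomorphism_def K arc_to_ends_def)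
    have arc: "(iso_verts f i, iso_verts f j) \<in> arcs_ends K" if "(i, j) \<in> parcs (path_graph 4)" for i j
      using that at[of "(i, j)"] by (auto simp: arcs_ends_def K intro!: rev_image_eqI)
    have "has_path4 K"
      unfolding has_path4_def
    proof (intro exI conjI)
      show "distinct [iso_verts f 0, iso_verts f 1, iso_verts f 2, iso_verts f 3]"
        using inj by (auto simp: inj_on_eq_iff)
      show "{(iso_verts f 0, iso_verts f 1), (iso_verts f 1, iso_verts f 0),
        (iso_verts f 1, iso_verts f 2), (iso_verts f 2, iso_verts f 1),
        (iso_verts f 2, iso_verts f 3), (iso_verts f 3, iso_verts f 2)} \<subseteq> arcs_ends K"
        using arc by (auto simp: path_graph_def)
    qed
    then have "has_path4 H" using sd has_path4_subdivision by blast
    then have "has_path4 (with_proj G \<restriction> W)"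
      using has_path4_mono arcs_ends_mono[OF H] by blast
    then obtain a b c d where "distinct [a, b, c, d]"
      "{(a, b), (b, a), (b, c), (c, b), (c, d), (d, c)} \<subseteq> arcs_ends (with_proj G \<restriction> W)"
      unfolding has_path4_def by (elim exE conjE)
    then show ?R unfolding ends by (intro exI[of _ a] exI[of _ b] exI[of _ c] exI[of _ d]) auto
  }
  {
    assume ?R
    then obtain a b c d where d: "distinct [a, b, c, d]" and W: "{a, b, c, d} \<subseteq> W"
      and arcs: "{(a, b), (b, c), (c, d)} \<subseteq> parcs G" by (elim exE conjE)
    define E where "E = {(a, b), (b, a), (b, c), (c, b), (c, d), (d, c)}"
    define K :: "('a, 'a \<times> 'a) pre_digraph" where
      "K = with_proj \<lparr>pverts = {a, b, c, d}, parcs = E\<rparr>"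
    \<comment> \<open>A bidirected digraph requires a reversal that moves exactly the arcs; hence
      the identity outside \<open>E\<close>, and \<open>E_loop\<close> below.\<close>
    define rev_K where "rev_K = (\<lambda>e. if e \<in> E then prod.swap e else e)"
    have K_simps: "verts K = {a, b, c, d}" "arcs K = E" "tail K = fst" "head K = snd"
      by (simp_all add: K_def)
    have E_verts: "fst e \<in> {a, b, c, d}" "snd e \<in> {a, b, c, d}" if "e \<in> E" for e
      using that by (auto simp: E_def)
    have E_swap: "prod.swap e \<in> E" if "e \<in> E" for e
      using that by (auto simp: E_def)
    have E_loop: "prod.swap e \<noteq> e" if "e \<in> E" for e
      using that d by (auto simp: E_def)
    have "wf_digraph K"
      by unfold_locales (use E_verts in \<open>simp_all add: K_simps\<close>)
    then have bi: "bidirected_digraph K rev_K"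
      by (rule wf_digraph.bidirected_digraphI)
        (use E_swap E_loop in \<open>simp_all add: K_simps rev_K_def\<close>)
    then interpret K: bidirected_digraph K rev_K .
    have arcs': "(b, a) \<in> parcs G" "(c, b) \<in> parcs G" "(d, c) \<in> parcs G"
      using arcs arcs_symmetric by auto
    have "wf_digraph (with_proj G \<restriction> W)" by (rule wellformed_induce_subgraph)
    then have sub: "subgraph K (with_proj G \<restriction> W)"
      using W arcs arcs' in_arcsD1 in_arcsD2 K.wf_digraph_axioms
      by (auto simp: subgraph_def K_simps E_def compatible_def)
    define f where "f = \<lparr>iso_verts = (\<lambda>i. [a, b, c, d] ! i), iso_arcs = (\<lambda>(i, j). ([a, b, c, d] ! i, [a, b, c, d] ! j)),
      iso_head = snd, iso_tail = fst\<rparr>"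
    have nat4: "{0..<4::nat} = {0, 1, 2, 3}" by auto
    have p4: "parcs (path_graph 4) = {(0, 1), (1, 0), (1, 2), (2, 1), (2, 3), (3, 2)}"
      by (auto simp: path_graph_def)
    have inj: "inj_on (\<lambda>i. [a, b, c, d] ! i) {0..<4}" using d by (intro inj_on_nth) auto
    have "wf_digraph (with_proj (path_graph 4))"
      by unfold_locales (auto simp: path_graph_def)
    moreover have "inj_on (\<lambda>(i, j). ([a, b, c, d] ! i, [a, b, c, d] ! j)) (parcs (path_graph 4))"
      using inj by (auto simp: inj_on_def path_graph_def)
    ultimately have "pre_digraph.digraph_isomorphism (with_proj (path_graph 4)) f"
      using inj by (auto simp: pre_digraph.digraph_isomorphism_def f_def path_graph_def)
    moreover have "K = app_iso f (with_proj (path_graph 4))"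
      by (simp add: app_iso_def f_def K_def E_def with_proj_def p4, simp add: path_graph_def nat4)
    ultimately have "digraph_iso (with_proj (path_graph 4)) K"
      unfolding digraph_iso_def by blast
    then show ?L
      unfolding topological_minor_def using sub subdivision_base[OF bi] by blast
  }
qed

section \<open>Stars and triangles\<close>

locale sgraph =
  fixes V :: "nat set" and adj :: "nat \<Rightarrow> nat \<Rightarrow> bool"
  assumes finite_V: "finite V"
    and adj_sym: "adj u v \<Longrightarrow> adj v u"
    and adj_irrefl: "\<not> adj v v"
    and adj_V: "adj u v \<Longrightarrow> u \<in> V \<and> v \<in> V"
begin

definition nbs :: "(nat \<Rightarrow> int) \<Rightarrow> nat \<Rightarrow> nat set" where
  "nbs L v = {u. adj v u \<and> L u \<noteq> 0}"

definition wt :: "int \<Rightarrow> int" where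
  "wt x = (if x = 1 then 2 else 1)"

text \<open>Weight 2 at an other vertex means one center, so the vertex is a star leaf, or two
  others, so it lies in a triangle; weight 0 means that it is isolated. Deleted vertices are always
  ok.\<close>

definition ok :: "(nat \<Rightarrow> int) \<Rightarrow> nat \<Rightarrow> bool" where
  "ok L v \<longleftrightarrow> (L v = 1 \<longrightarrow> (\<forall>u \<in> nbs L v. L u \<noteq> 1)) \<and>
     (L v = 2 \<longrightarrow> (\<Sum>u\<in>nbs L v. wt (L u)) \<in> {0, 2} \<and>
        (\<forall>a \<in> nbs L v. \<forall>b \<in> nbs L v. L a = 2 \<and> L b = 2 \<and> a \<noteq> b \<longrightarrow> adj a b))"

definition p4free :: "nat set \<Rightarrow> bool" where
  "p4free W \<longleftrightarrow> \<not> (\<exists>a b c d. distinct [a, b, c, d] \<and> {a, b, c, d} \<subseteq> W \<and> adj a b \<and> adj b c \<and> adj c d)"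

lemma adj_comm: "adj u v = adj v u"
  using adj_sym by blast

lemma nbs_subset: "nbs L v \<subseteq> V"
  using adj_V by (auto simp: nbs_def)

lemma finite_nbs [simp]: "finite (nbs L v)"
  using finite_subset[OF nbs_subset finite_V] .

lemma wt_ge: "wt x \<ge> 1" "wt x \<le> 2"
  by (auto simp: wt_def)

lemma sum_wt_le: "A \<subseteq> nbs L v \<Longrightarrow> (\<Sum>u\<in>A. wt (L u)) \<le> (\<Sum>u\<in>nbs L v. wt (L u))"
  by (intro sum_mono2) (auto simp: wt_def)

text \<open>An inner vertex of a path \<open>a b c d\<close> cannot be a center: the other inner
  vertex would have weight at least 2 + 1. With \<open>b\<close> and \<open>c\<close> both other,
  the weight at \<open>b\<close> makes \<open>a\<close> an other vertex, which is then adjacent to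
  \<open>c\<close>; this overloads \<open>c\<close> with three neighbors.\<close>

lemma ok_imp_p4free:
  assumes L: "\<And>v. L v \<in> {0, 1, 2}" and all_ok: "\<And>v. v \<in> V \<Longrightarrow> ok L v"
  shows "p4free {v \<in> V. L v \<noteq> 0}"
  unfolding p4free_def
proof (intro notI, elim exE conjE)
  fix a b c d
  assume d: "distinct [a, b, c, d]" and sub: "{a, b, c, d} \<subseteq> {v \<in> V. L v \<noteq> 0}"
    and ab: "adj a b" and bc: "adj b c" and cd: "adj c d"
  \<comment> \<open>Stated for arbitrary paths, so that reversing the path excludes a center at
    \<open>c\<close> as well.\<close>
  have *: False if d: "distinct [a, b, c, d]" and sub: "{a, b, c, d} \<subseteq> {v \<in> V. L v \<noteq> 0}"
    and ab: "adj a b" and bc: "adj b c" and cd: "adj c d" and b1: "L b = 1" for a b c d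
  proof -
    have "c \<in> nbs L b" using bc sub by (auto simp: nbs_def)
    then have c2: "L c = 2" using all_ok[of b] L[of c] b1 sub by (auto simp: ok_def)
    have "{b, d} \<subseteq> nbs L c" using bc cd sub by (auto simp: adj_comm nbs_def)
    then have "(\<Sum>u\<in>{b, d}. wt (L u)) \<le> (\<Sum>u\<in>nbs L c. wt (L u))" by (rule sum_wt_le)
    moreover have "(\<Sum>u\<in>{b, d}. wt (L u)) \<ge> 3" using d b1 wt_ge[of "L d"] by (auto simp: wt_def)
    ultimately show False using all_ok[of c] c2 sub by (auto simp: ok_def)
  qed
  have b: "L b = 2" using *[OF d sub ab bc cd] L[of b] sub by auto
  have c: "L c = 2" using *[of d c b a] d sub ab bc cd L[of c] by (auto simp: adj_comm)
  have nb: "{a, c} \<subseteq> nbs L b" using ab bc sub by (auto simp: adj_comm nbs_def)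
  have sb: "(\<Sum>u\<in>{a, c}. wt (L u)) \<le> 2"
    using sum_wt_le[OF nb] all_ok[of b] b sub by (auto simp: ok_def)
  have a: "L a = 2" using sb d L[of a] sub c by (auto simp: wt_def split: if_splits)
  have ac: "adj a c" using all_ok[of b] nb a b c d sub by (auto simp: ok_def)
  have nc: "{a, b, d} \<subseteq> nbs L c" using ac bc cd sub by (auto simp: adj_comm nbs_def)
  have "(\<Sum>u\<in>{a, b, d}. wt (L u)) \<le> 2"
    using sum_wt_le[OF nc] all_ok[of c] c sub by (auto simp: ok_def)
  moreover have "(\<Sum>u\<in>{a, b, d}. wt (L u)) \<ge> 3"
    using d wt_ge[of "L a"] wt_ge[of "L b"] wt_ge[of "L d"] by auto
  ultimately show False by simp
qed

text \<open>
  In a component that is a triangle or a star: triangle vertices and star leaves get label 2, star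
  centers label 1. The only choice is in a single edge, where the smaller vertex becomes the center.
\<close>

lemma p4free_imp_ok:
  assumes S: "S \<subseteq> V" and free: "p4free (V - S)"
  shows "\<exists>L. (\<forall>v. L v \<in> {0, 1, 2}) \<and> (\<forall>v \<in> V. ok L v) \<and> {v \<in> V. L v = 0} = S"
proof -
  define N where "N = (\<lambda>v. {u \<in> V - S. adj v u})"
  define tri where "tri = (\<lambda>v. \<exists>a b. a \<in> N v \<and> b \<in> N v \<and> adj a b)"
  \<comment> \<open>Outside triangles a vertex fails to be a center only if it has a single neighbor
    and is not the smaller end of an isolated edge. Isolated vertices become centers.\<close>
  define center where "center = (\<lambda>v. \<not> tri v \<and> (\<forall>u. N v = {u} \<longrightarrow> N u = {v} \<and> v < u))"
  define L :: "nat \<Rightarrow> int" where "L = (\<lambda>v. if v \<in> S then 0 else if center v then 1 else 2)"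
  have nbs: "nbs L v = N v" for v
    using adj_V by (auto simp: nbs_def N_def L_def)
  have no4: False if "distinct [a, b, c, d]" "a \<in> N b" "c \<in> N b" "d \<in> N c" "b \<in> V - S" for a b c d
  proof -
    have "adj a b" "adj b c" "adj c d" "{a, b, c, d} \<subseteq> V - S"
      using that adj_sym[of b a] by (auto simp: N_def)
    then show False using free that(1) unfolding p4free_def by blast
  qed
  have N_sym: "u \<in> N v \<Longrightarrow> v \<in> V - S \<Longrightarrow> v \<in> N u" for u v
    by (auto simp: adj_comm N_def)
  have N_V: "u \<in> N v \<Longrightarrow> u \<in> V - S" for u v by (auto simp: N_def)
  have N_irrefl: "v \<notin> N v" for v using adj_irrefl by (auto simp: N_def)
  have N_adj: "u \<in> N v \<Longrightarrow> adj v u" for u v by (auto simp: N_def)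
  have adj_N: "adj v u \<Longrightarrow> u \<in> V - S \<Longrightarrow> u \<in> N v" for u v by (auto simp: N_def)
  \<comment> \<open>A third neighbor \<open>x\<close> of \<open>v\<close> would give the path
    \<open>x v a b\<close>.\<close>
  have tri_nb: "\<exists>a b. N v = {a, b} \<and> a \<noteq> b \<and> adj a b \<and> tri a \<and> tri b" if v: "v \<in> V - S" "tri v" for v
  proof -
    obtain a b where ab: "a \<in> N v" "b \<in> N v" "adj a b" using v by (auto simp: tri_def)
    have ne: "a \<noteq> b" "a \<noteq> v" "b \<noteq> v" using ab N_irrefl adj_irrefl by auto
    have "x = a \<or> x = b" if x: "x \<in> N v" for x
    proof (rule ccontr)
      assume "\<not> ?thesis"
      moreover have "x \<noteq> v" using x N_irrefl by blast
      moreover have "b \<in> N a" using adj_N ab N_V by blast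
      ultimately show False using no4[of x v a b] ab(1) ne x v(1) by simp
    qed
    moreover have "v \<in> N a" "b \<in> N a" "adj v b" using ab v N_sym adj_N N_V N_adj by blast+
    then have "tri a" unfolding tri_def by blast
    moreover have "v \<in> N b" "a \<in> N b" "adj v a" using ab v N_sym adj_N adj_sym N_V N_adj by blast+
    then have "tri b" unfolding tri_def by blast
    moreover have "N v = {a, b}" using ab calculation by blast
    ultimately show ?thesis using ab ne by blast
  qed
  \<comment> \<open>With a second neighbor \<open>y\<close> of \<open>v\<close>, a neighbor
    \<open>x\<close> of \<open>u\<close> besides \<open>v\<close> gives the path
    \<open>y v u x\<close>; the case \<open>x = y\<close> would close a triangle at
    \<open>v\<close>.\<close>
  have leaf: "N u = {v}" if v: "v \<in> V - S" "\<not> tri v" "u \<in> N v" "N v \<noteq> {u}" for u v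
  proof -
    obtain y where y: "y \<in> N v" "y \<noteq> u" using v by blast
    have "x = v" if x: "x \<in> N u" for x
    proof (rule ccontr)
      assume "x \<noteq> v"
      moreover have "x \<noteq> y"
      proof
        assume "x = y"
        then have "adj u y" using x N_adj by simp
        then show False using v(2,3) y(1) unfolding tri_def by blast
      qed
      moreover have "y \<noteq> v" "x \<noteq> u" using x y N_irrefl by blast+
      moreover have "u \<noteq> v" using v(3) N_irrefl by blast
      ultimately show False using no4[of y v u x] x y v by auto
    qed
    then show ?thesis using N_sym v by blast
  qed
  \<comment> \<open>A triangle at \<open>u\<close> uses all neighbors of \<open>u\<close>, so it
    would contain \<open>v\<close> and give \<open>v\<close> a second neighbor.\<close>
  have not_tri: "\<not> tri u" if "N v = {u}" "v \<in> V - S" for u v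
  proof
    assume "tri u"
    moreover have u: "u \<in> V - S" using that N_V by blast
    ultimately obtain a b where "N u = {a, b}" "a \<noteq> b" "adj a b" using tri_nb by blast
    moreover have "v \<in> N u" using that N_sym by blast
    ultimately obtain w where w: "w \<in> N u" "adj v w" using adj_sym[of a b] by auto
    then have "w \<in> N v" using N_V[of w u] adj_N[of v w] by simp
    then show False using that w(1) N_irrefl[of u] by auto
  qed
  have "ok L v" if v: "v \<in> V" for v
  proof -
    have C: "L u \<noteq> 1" if u: "u \<in> N v" "L v = 1" for u
    proof -
      have c: "center v" "v \<notin> S" using u by (auto simp: L_def split: if_splits)
      show ?thesis
      proof (cases "N v = {u}")
        case True
        then have "N u = {v}" "v < u" using c by (auto simp: center_def)
        then have "\<not> center u" by (auto simp: center_def)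
        then show ?thesis by (simp add: L_def)
      next
        case False
        then have "N u = {v}" using leaf[of v u] c v u by (auto simp: center_def)
        then have "\<not> center u" using False by (auto simp: center_def)
        then show ?thesis by (simp add: L_def)
      qed
    qed
    moreover have "(\<Sum>u\<in>N v. wt (L u)) = 2 \<and>
        (\<forall>a \<in> N v. \<forall>b \<in> N v. L a = 2 \<and> L b = 2 \<and> a \<noteq> b \<longrightarrow> adj a b)" if l: "L v = 2"
    proof -
      have c: "\<not> center v" "v \<notin> S" using l by (auto simp: L_def split: if_splits)
      show ?thesis
      proof (cases "tri v")
        case True
        then obtain a b where ab: "N v = {a, b}" "a \<noteq> b" "adj a b" "tri a" "tri b"
          using tri_nb v c by blast
        moreover have "L a = 2" "L b = 2"
          using ab N_V[of a v] N_V[of b v] by (auto simp: L_def center_def)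
        ultimately show ?thesis by (auto simp: adj_comm wt_def)
      next
        case False
        then obtain u where u: "N v = {u}" "\<not> (N u = {v} \<and> v < u)"
          using c by (auto simp: center_def)
        have uV: "u \<in> V - S" "u \<noteq> v" using u(1) N_V N_irrefl by blast+
        have "v \<in> N u" using N_sym u v c by blast
        have "\<not> tri u" using not_tri u(1) v c by blast
        have "center u" unfolding center_def
        proof (intro conjI allI impI)
          show "\<not> tri u" by fact
          fix x assume x: "N u = {x}"
          have "x = v" using x \<open>v \<in> N u\<close> by simp
          show "N x = {u}" using u(1) \<open>x = v\<close> by simp
          have "\<not> v < u" using u(2) x \<open>x = v\<close> by blast
          then show "u < x" using uV \<open>x = v\<close> by simp
        qed
        then have "L u = 1" using uV by (simp add: L_def)
        then show ?thesis using u(1) by (simp add: wt_def)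
      qed
    qed
    ultimately show ?thesis unfolding ok_def nbs by blast
  qed
  moreover have "{v \<in> V. L v = 0} = S" using S by (auto simp: L_def)
  moreover have "L v \<in> {0, 1, 2}" for v by (auto simp: L_def)
  ultimately show ?thesis by blast
qed

end

section \<open>Labels of bag vertices\<close>

fun code :: "int list \<Rightarrow> int" where
  "code [] = 0"
| "code (d # ds) = d + 5 * code ds"

text \<open>Inverse of \<open>code\<close>, read as a labelling. The default 5 is not a base-5 digit
  and can therefore mark vertices outside the bag.\<close>

fun digit_label :: "nat list \<Rightarrow> nat \<Rightarrow> nat \<Rightarrow> int" where
  "digit_label [] c = (\<lambda>_. 5)"
| "digit_label (x # xs) c = (digit_label xs (c div 5))(x := int (c mod 5))"

lemma digit_label_notin: "u \<notin> set xs \<Longrightarrow> digit_label xs c u = 5"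
  by (induction xs arbitrary: c) auto

lemma digit_label_range: "u \<in> set xs \<Longrightarrow> digit_label xs c u \<in> {0..4}"
  by (induction xs arbitrary: c) auto

lemma digit_label_nth: "distinct xs \<Longrightarrow> i < length xs \<Longrightarrow> digit_label xs c (xs ! i) = int (c div 5 ^ i mod 5)"
proof (induction xs arbitrary: c i)
  case (Cons x xs)
  then show ?case by (cases i) (auto simp: div_mult2_eq nth_mem)
qed simp

lemma code_digit_label: "distinct xs \<Longrightarrow> c < 5 ^ length xs \<Longrightarrow> code (map (digit_label xs c) xs) = int c"
proof (induction xs arbitrary: c)
  case (Cons x xs)
  have "map (digit_label (x # xs) c) xs = map (digit_label xs (c div 5)) xs"
    using Cons.prems by (intro map_cong) auto
  moreover have "c div 5 < 5 ^ length xs" using Cons.prems by auto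
  then have "code (map (digit_label xs (c div 5)) xs) = int (c div 5)" using Cons by simp
  moreover have "code (map (digit_label (x # xs) c) (x # xs)) = int (c mod 5) + 5 * code (map (digit_label (x # xs) c) xs)"
    by simp
  ultimately have "code (map (digit_label (x # xs) c) (x # xs)) = int (c mod 5) + 5 * int (c div 5)"
    by (simp only:)
  also have "\<dots> = int c" by (simp add: zmod_int zdiv_int)
  finally show ?case .
qed simp

lemma code_range: "set ds \<subseteq> {0..4} \<Longrightarrow> 0 \<le> code ds \<and> code ds < 5 ^ length ds"
  by (induction ds) auto

lemma digit_label_code:
  assumes "distinct xs" "\<And>u. u \<in> set xs \<Longrightarrow> lab u \<in> {0..4}" "u \<in> set xs"
  shows "digit_label xs (nat (code (map lab xs))) u = lab u"
  using assms
proof (induction xs arbitrary: u)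
  case (Cons x xs)
  have c: "0 \<le> code (map lab xs)" using code_range[of "map lab xs"] Cons.prems(2) by fastforce
  have l: "0 \<le> lab x" "lab x \<le> 4" using Cons.prems(2)[of x] by auto
  have "nat (lab x + 5 * code (map lab xs)) = nat (lab x) + 5 * nat (code (map lab xs))"
    using c l by (simp add: nat_add_distrib nat_mult_distrib)
  moreover have "nat (lab x) < 5" using l by auto
  ultimately show ?case using Cons l by auto
qed simp

lemma code_inj:
  assumes "map f xs \<noteq> map g xs" "set (map f xs) \<subseteq> {0..4}" "set (map g xs) \<subseteq> {0..4}"
  shows "code (map f xs) \<noteq> code (map g xs)"
  using assms
proof (induction xs)
  case (Cons x xs)
  have fg: "0 \<le> f x \<and> f x \<le> 4" "0 \<le> g x \<and> g x \<le> 4" using Cons.prems by auto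
  show ?case
  proof (cases "map f xs = map g xs")
    case True
    then have "code (map f xs) = code (map g xs)" by (rule arg_cong)
    moreover have "f x \<noteq> g x" using Cons.prems(1) True by auto
    ultimately show ?thesis unfolding list.map code.simps by linarith
  next
    case False
    then have "code (map f xs) \<noteq> code (map g xs)" using Cons by simp
    then show ?thesis using fg by simp
  qed
qed simp

text \<open>The value 0 encodes the minimum of the empty set and is what an untouched memory cell
  contains. To keep it unambiguous all members must be positive, which is why costs are stored plus
  one.\<close>

definition minval :: "int \<Rightarrow> int set \<Rightarrow> bool" where
  "minval x S \<longleftrightarrow> (\<forall>y \<in> S. 0 < y) \<and> (x = 0 \<and> S = {} \<or> x \<in> S \<and> (\<forall>y \<in> S. x \<le> y))"

lemma minval_empty: "minval 0 {}"
  by (simp add: minval_def)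

lemma minval_insert:
  assumes "minval x S" "0 < y"
  shows "minval (if x = 0 \<or> y < x then y else x) (insert y S)"
  using assms by (fastforce simp: minval_def)

text \<open>
  Labels in the tables: 0 deleted, 1 center, \<open>2 + i\<close> other vertex with forgotten neighbors of weight
  \<open>i\<close>. Label 5 marks the vertices of the parent bag that are not in the child bag.
\<close>

definition merge_ok :: "int \<Rightarrow> int \<Rightarrow> bool" where
  "merge_ok a b \<longleftrightarrow> 4 < a \<or> (a \<le> 1 \<and> a = b) \<or> (2 \<le> a \<and> 2 \<le> b \<and> a + b \<le> 6)"

text \<open>Forgotten weights of both sides add up: \<open>2 + (a - 2) + (b - 2)\<close>. With
  \<open>a = 5\<close> the child knows nothing about the vertex and the parent label is
  kept.\<close>

definition merge_label :: "int \<Rightarrow> int \<Rightarrow> int" where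
  "merge_label a b = (if 4 < a then b else if a \<le> 1 then a else a + b - 2)"

section \<open>Partial labellings and the elimination of bag vertices\<close>

context sgraph
begin

definition cur :: "(nat \<Rightarrow> int) \<Rightarrow> nat set \<Rightarrow> nat \<Rightarrow> int" where
  "cur L F u = (\<Sum>e\<in>nbs L u \<inter> F. wt (L e))"

definition lbl :: "(nat \<Rightarrow> int) \<Rightarrow> nat set \<Rightarrow> nat \<Rightarrow> int" where
  "lbl L F u = (if L u = 2 then 2 + cur L F u else L u)"

text \<open>\<open>L\<close> labels all vertices, but its values outside \<open>F\<close> and
  \<open>X\<close> are immaterial as long as the neighbors of \<open>F\<close> lie in
  \<open>F \<union> X\<close>; this allows labellings to be glued. The bound 4 caps the forgotten
  weight at 2.\<close>

definition good :: "(nat \<Rightarrow> int) \<Rightarrow> nat set \<Rightarrow> nat set \<Rightarrow> bool" where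
  "good L F X \<longleftrightarrow> (\<forall>v. L v \<in> {0, 1, 2}) \<and> (\<forall>v\<in>F. ok L v) \<and> (\<forall>u\<in>X. lbl L F u \<le> 4)"

definition realizable :: "nat set \<Rightarrow> nat set \<Rightarrow> (nat \<Rightarrow> int) \<Rightarrow> nat \<Rightarrow> bool" where
  "realizable F X lab c \<longleftrightarrow>
     (\<exists>L. good L F X \<and> (\<forall>u\<in>X. lab u = lbl L F u) \<and> c = card {v \<in> F. L v = 0})"

definition live_nbs :: "nat set \<Rightarrow> (nat \<Rightarrow> int) \<Rightarrow> nat \<Rightarrow> nat set" where
  "live_nbs X lab v = {u \<in> X. adj v u \<and> 0 < lab u}"

text \<open>This is \<open>ok\<close> at \<open>v\<close> in terms of table labels, together with
  the cap for the neighbors once \<open>v\<close> is forgotten: a center adds 2, so its live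
  neighbors must have label exactly 2; an other vertex adds 1, so they may have at most 3.\<close>

definition elim_ok :: "nat set \<Rightarrow> (nat \<Rightarrow> int) \<Rightarrow> nat \<Rightarrow> bool" where
  "elim_ok X lab v \<longleftrightarrow>
     (lab v = 1 \<longrightarrow> (\<forall>u\<in>live_nbs X lab v. lab u = 2)) \<and>
     (2 \<le> lab v \<longrightarrow> lab v - 2 + (\<Sum>u\<in>live_nbs X lab v. wt (lab u)) \<in> {0, 2} \<and>
        (\<forall>u\<in>live_nbs X lab v. lab u \<le> 3) \<and>
        (\<forall>a\<in>live_nbs X lab v. \<forall>b\<in>live_nbs X lab v. 2 \<le> lab a \<and> 2 \<le> lab b \<and> a \<noteq> b \<longrightarrow> adj a b))"

text \<open>The eliminated vertex gets label 0, so that it drops out of \<open>live_nbs\<close>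
  although \<open>X\<close> still contains it.\<close>

definition elim_lab :: "nat set \<Rightarrow> (nat \<Rightarrow> int) \<Rightarrow> nat \<Rightarrow> nat \<Rightarrow> int" where
  "elim_lab X lab v u = (if u = v then 0
     else if u \<in> live_nbs X lab v \<and> 0 < lab v \<and> 2 \<le> lab u then lab u + wt (lab v) else lab u)"

lemma cur_nonneg: "0 \<le> cur L F u"
  unfolding cur_def using wt_ge(1) by (intro sum_nonneg) (auto simp: wt_def)

lemma cur_insert:
  assumes "v \<notin> F"
  shows "cur L (insert v F) u = cur L F u + (if adj u v \<and> L v \<noteq> 0 then wt (L v) else 0)"
proof -
  have "nbs L u \<inter> insert v F = (if adj u v \<and> L v \<noteq> 0 then insert v (nbs L u \<inter> F) else nbs L u \<inter> F)"
    by (auto simp: nbs_def)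
  then show ?thesis unfolding cur_def using assms by (simp add: add.commute)
qed

lemma cur_mono: "F \<subseteq> F' \<Longrightarrow> cur L F u \<le> cur L F' u"
  unfolding cur_def by (intro sum_mono2) (auto simp: wt_def)

lemma cur_le: "cur L F u \<le> (\<Sum>e\<in>nbs L u. wt (L e))"
  unfolding cur_def by (intro sum_mono2) (auto simp: wt_def)

lemma lbl_simps:
  assumes "L u \<in> {0, 1, 2}"
  shows "lbl L F u = 0 \<longleftrightarrow> L u = 0" "lbl L F u = 1 \<longleftrightarrow> L u = 1" "2 \<le> lbl L F u \<longleftrightarrow> L u = 2"
    "0 \<le> lbl L F u" "wt (lbl L F u) = wt (L u)"
  using assms cur_nonneg[of L F u] by (auto simp: lbl_def wt_def)

text \<open>Further eliminations cannot repair a bad partial labelling: forgotten weights only grow,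
  and for \<open>v\<close> itself the cap follows from \<open>ok\<close>.\<close>

lemma good_antimono:
  assumes "good L (insert v F) (X - {v})"
  shows "good L F X"
proof -
  have "lbl L F u \<le> 4" if u: "u \<in> X" for u
  proof (cases "u = v")
    case True
    then have "ok L v" "L v \<in> {0, 1, 2}" using assms by (auto simp: good_def)
    then show ?thesis using cur_le[of L F v] True by (auto simp: ok_def lbl_def)
  next
    case False
    then have "lbl L (insert v F) u \<le> 4" using assms u by (auto simp: good_def)
    then show ?thesis using cur_mono[OF subset_insertI, of L F u v] by (auto simp: lbl_def split: if_splits)
  qed
  then show ?thesis using assms by (auto simp: good_def)
qed

lemma lbl_insert:
  assumes L: "\<And>v. L v \<in> {0, 1, 2}" and v: "v \<notin> F"
  shows "lbl L (insert v F) u =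
    (if 2 \<le> lbl L F u \<and> adj u v \<and> lbl L F v \<noteq> 0 then lbl L F u + wt (lbl L F v) else lbl L F u)"
proof -
  have u: "2 \<le> lbl L F u \<longleftrightarrow> L u = 2" using lbl_simps(3)[of L u F, OF L] .
  have v': "lbl L F v \<noteq> 0 \<longleftrightarrow> L v \<noteq> 0" "wt (lbl L F v) = wt (L v)"
    using lbl_simps(1,5)[of L v F, OF L] by auto
  show ?thesis unfolding u v' using cur_insert[OF v, of L u] by (simp add: lbl_def)
qed

text \<open>
  If two label-2 neighbors of \<open>v\<close> are nonadjacent and one of them has been eliminated, then that
  one already forces a third neighbor on \<open>v\<close>; so adjacency must only be tested inside the bag.
\<close>

lemma ok_in_bag:
  assumes L: "\<And>v. L v \<in> {0, 1, 2}" and F: "\<And>v. v \<in> F \<Longrightarrow> ok L v"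
    and v: "L v = 2"
    and sum: "(\<Sum>u\<in>nbs L v. wt (L u)) \<in> {0, 2}"
    and pairs: "\<forall>a \<in> nbs L v - F. \<forall>b \<in> nbs L v - F. L a = 2 \<and> L b = 2 \<and> a \<noteq> b \<longrightarrow> adj a b"
  shows "ok L v"
proof -
  have *: "adj a b" if a: "a \<in> nbs L v" "a \<in> F" "L a = 2" and b: "b \<in> nbs L v" "L b = 2" "a \<noteq> b" for a b
  proof -
    have va: "v \<in> nbs L a" using a v adj_sym by (auto simp: nbs_def)
    have "1 \<le> (\<Sum>u\<in>nbs L a. wt (L u))" using sum_wt_le[of "{v}" L a] va v by (auto simp: wt_def)
    then have s2: "(\<Sum>u\<in>nbs L a. wt (L u)) = 2" using F[OF a(2)] a(3) by (auto simp: ok_def)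
    \<comment> \<open>As \<open>v\<close> weighs only 1, \<open>a\<close> has a further neighbor
      \<open>x\<close>, which also weighs 1 and is therefore adjacent to \<open>v\<close>. The
      weight at \<open>v\<close> then leaves room only for \<open>x = b\<close>.\<close>
    have "nbs L a \<noteq> {v}" using s2 v by (auto simp: wt_def)
    then obtain x where x: "x \<in> nbs L a" "x \<noteq> v" using va by blast
    have "(\<Sum>u\<in>{v, x}. wt (L u)) \<le> 2" using sum_wt_le[of "{v, x}" L a] s2 va x by simp
    then have "L x \<noteq> 1" using x v by (auto simp: wt_def split: if_splits)
    then have x2: "L x = 2" using L[of x] x by (auto simp: nbs_def)
    have "adj v x" using F[OF a(2)] a(3) va x v x2 unfolding ok_def by blast
    then have xv: "x \<in> nbs L v" using x2 by (simp add: nbs_def)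
    have ax: "adj a x" using x by (simp add: nbs_def)
    have "x = b"
    proof (rule ccontr)
      assume "x \<noteq> b"
      moreover have "x \<noteq> a" using ax adj_irrefl by blast
      moreover have "(\<Sum>u\<in>{a, x, b}. wt (L u)) \<le> 2"
        using sum_wt_le[of "{a, x, b}" L v] sum xv a b by auto
      ultimately show False using b a x2 by (simp add: wt_def)
    qed
    then show ?thesis using ax by simp
  qed
  have "adj a b" if ab: "a \<in> nbs L v" "b \<in> nbs L v" "L a = 2" "L b = 2" "a \<noteq> b" for a b
    using pairs *[of a b] *[of b a] ab adj_sym[of b a] by blast
  then show ?thesis using sum v unfolding ok_def by auto
qed

text \<open>By \<open>nb\<close> every neighbor of \<open>v\<close> is forgotten or in the bag. The
  forgotten ones are summarized by the label of \<open>v\<close>, the others carry labels of their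
  own, so the bag alone decides \<open>ok\<close> at \<open>v\<close>.\<close>

lemma elim_step:
  assumes g: "good L F X" and lab: "\<And>u. u \<in> X \<Longrightarrow> lab u = lbl L F u"
    and v: "v \<in> X" and disj: "F \<inter> X = {}" and nb: "\<And>u. adj v u \<Longrightarrow> u \<in> F \<union> X"
  shows "good L (insert v F) (X - {v}) \<longleftrightarrow> elim_ok X lab v"
    "\<And>u. u \<in> X - {v} \<Longrightarrow> elim_lab X lab v u = lbl L (insert v F) u"
proof -
  have L: "\<And>v. L v \<in> {0, 1, 2}" and F: "\<And>v. v \<in> F \<Longrightarrow> ok L v" and le4: "\<And>u. u \<in> X \<Longrightarrow> lbl L F u \<le> 4"
    using g by (auto simp: good_def)
  have vF: "v \<notin> F" using v disj by blast
  note ls = lbl_simps[of L _ F, OF L]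
  have ns: "live_nbs X lab v = nbs L v - F"
  proof -
    have "0 < lab w \<longleftrightarrow> L w \<noteq> 0" if "w \<in> X" for w
      using lab[OF that] lbl_simps(1,4)[of L w F, OF L] by auto
    then show ?thesis using nb disj unfolding live_nbs_def nbs_def by blast
  qed
  have nsX: "\<And>u. u \<in> live_nbs X lab v \<Longrightarrow> u \<in> X" by (simp add: live_nbs_def)
  show new: "elim_lab X lab v u = lbl L (insert v F) u" if "u \<in> X - {v}" for u
    using that lab v lbl_insert[of L v F u, OF L vF] adj_comm[of u v] ls(4)[of v]
    unfolding elim_lab_def live_nbs_def by auto
  \<comment> \<open>Only live neighbors of \<open>v\<close> change their labels; the remaining bag
    vertices obey the cap by \<open>le4\<close>.\<close>
  have four: "(\<forall>u\<in>X - {v}. lbl L (insert v F) u \<le> 4) \<longleftrightarrow>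
      (\<forall>u\<in>live_nbs X lab v. 0 < lab v \<and> 2 \<le> lab u \<longrightarrow> lab u + wt (lab v) \<le> 4)" (is "?l \<longleftrightarrow> ?r")
  proof
    assume l: ?l
    show ?r
    proof (intro ballI impI)
      fix u assume u: "u \<in> live_nbs X lab v" "0 < lab v \<and> 2 \<le> lab u"
      then have "u \<in> X - {v}" using adj_irrefl by (auto simp: live_nbs_def)
      then show "lab u + wt (lab v) \<le> 4" using l new[of u] u by (auto simp: elim_lab_def)
    qed
  next
    assume r: ?r
    show ?l
    proof
      fix u assume u: "u \<in> X - {v}"
      then show "lbl L (insert v F) u \<le> 4" using r le4[of u] lab[of u] new[OF u, symmetric] u
        by (auto simp: elim_lab_def)
    qed
  qed
  have g': "good L (insert v F) (X - {v}) \<longleftrightarrow> ok L v \<and>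
      (\<forall>u\<in>live_nbs X lab v. 0 < lab v \<and> 2 \<le> lab u \<longrightarrow> lab u + wt (lab v) \<le> 4)"
    unfolding four[symmetric] good_def using L F by auto
  have lv: "lab v = lbl L F v" using lab v by simp
  have l14: "lab u \<in> {1..4}" if "u \<in> live_nbs X lab v" for u
    using that lab[of u] le4[of u] ls(4)[of u] by (auto simp: live_nbs_def)
  consider "L v = 0" | "L v = 1" | "L v = 2" using L[of v] by auto
  then show "good L (insert v F) (X - {v}) \<longleftrightarrow> elim_ok X lab v"
  proof cases
    case 1
    then show ?thesis using g' by (simp add: lv elim_ok_def ok_def lbl_def)
  next
    case 2
    have "ok L v \<longleftrightarrow> (\<forall>u\<in>live_nbs X lab v. lab u \<noteq> 1)"
    proof -
      \<comment> \<open>A forgotten center next to the center \<open>v\<close> has already been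
        ruled out by its own check.\<close>
      have "L u \<noteq> 1" if u: "u \<in> nbs L v" "u \<in> F" for u
      proof
        assume "L u = 1"
        moreover have "v \<in> nbs L u" using u 2 adj_sym by (auto simp: nbs_def)
        ultimately show False using F[OF u(2)] 2 by (auto simp: ok_def)
      qed
      then have "ok L v \<longleftrightarrow> (\<forall>u\<in>nbs L v - F. L u \<noteq> 1)" using 2 by (auto simp: ok_def)
      then show ?thesis unfolding ns[symmetric] using nsX lab ls(2) by auto
    qed
    moreover have "lab v = 1" using 2 lv by (simp add: lbl_def)
    ultimately show ?thesis using g' l14 by (fastforce simp: elim_ok_def wt_def)
  next
    case 3
    have "cur L F v + (\<Sum>u\<in>live_nbs X lab v. wt (lab u)) = (\<Sum>u\<in>nbs L v. wt (L u))"
    proof -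
      have "(\<Sum>u\<in>live_nbs X lab v. wt (lab u)) = (\<Sum>u\<in>nbs L v - F. wt (L u))"
        using nsX lab ls(5) by (intro sum.cong) (auto simp: ns)
      moreover have "(\<Sum>u\<in>nbs L v \<inter> F. wt (L u)) + (\<Sum>u\<in>nbs L v - F. wt (L u)) = (\<Sum>u\<in>nbs L v. wt (L u))"
        by (subst sum.union_disjoint[symmetric]) (auto intro!: sum.cong)
      ultimately show ?thesis by (simp add: cur_def)
    qed
    moreover have "lab v - 2 = cur L F v" using 3 lv by (simp add: lbl_def)
    ultimately have s: "lab v - 2 + (\<Sum>u\<in>live_nbs X lab v. wt (lab u)) = (\<Sum>u\<in>nbs L v. wt (L u))"
      by simp
    have two: "2 \<le> lab v" using 3 lv ls(3) by simp
    have lab2: "2 \<le> lab u \<longleftrightarrow> L u = 2" if "u \<in> live_nbs X lab v" for u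
      using nsX[OF that] lab ls(3) by simp
    have "ok L v \<longleftrightarrow> (\<Sum>u\<in>nbs L v. wt (L u)) \<in> {0, 2} \<and>
      (\<forall>a\<in>nbs L v - F. \<forall>b\<in>nbs L v - F. L a = 2 \<and> L b = 2 \<and> a \<noteq> b \<longrightarrow> adj a b)"
      using ok_in_bag[OF L F 3] 3 by (auto simp: ok_def)
    also have "\<dots> \<longleftrightarrow> lab v - 2 + (\<Sum>u\<in>live_nbs X lab v. wt (lab u)) \<in> {0, 2} \<and>
      (\<forall>a\<in>live_nbs X lab v. \<forall>b\<in>live_nbs X lab v. 2 \<le> lab a \<and> 2 \<le> lab b \<and> a \<noteq> b \<longrightarrow> adj a b)"
      unfolding s ns[symmetric] using lab2 by auto
    finally have okv: "ok L v \<longleftrightarrow> \<dots>" .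
    have "(\<forall>u\<in>live_nbs X lab v. 0 < lab v \<and> 2 \<le> lab u \<longrightarrow> lab u + wt (lab v) \<le> 4) \<longleftrightarrow>
      (\<forall>u\<in>live_nbs X lab v. lab u \<le> 3)"
      using two l14 by (fastforce simp: wt_def)
    then show ?thesis using g' okv two unfolding elim_ok_def by auto
  qed
qed

text \<open>\<open>X\<close> stays fixed during the eliminations, as on the machine, where the scan
  for neighbors always runs over the whole child bag. The second component counts deletions, the
  third tells whether all checks were passed.\<close>

definition elim_seq :: "nat set \<Rightarrow> nat list \<Rightarrow> (nat \<Rightarrow> int) \<Rightarrow> (nat \<Rightarrow> int) \<times> nat \<times> bool" where
  "elim_seq X zs lab = foldl (\<lambda>(lab, c, f) v.
     (elim_lab X lab v, c + (if lab v \<le> 0 then 1 else 0), f \<and> elim_ok X lab v)) (lab, 0, True) zs"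

lemma elim_seq_Nil [simp]: "elim_seq X [] lab = (lab, 0, True)"
  by (simp add: elim_seq_def)

lemma elim_seq_snoc:
  "elim_seq X (zs @ [v]) lab = (case elim_seq X zs lab of (lab, c, f) \<Rightarrow>
     (elim_lab X lab v, c + (if lab v \<le> 0 then 1 else 0), f \<and> elim_ok X lab v))"
  by (simp add: elim_seq_def split: prod.split)

text \<open>A failed check is final by \<open>good_antimono\<close>, and labels have no meaning
  afterwards, so the other conclusions are conditional on \<open>f\<close>. The zero labels of
  eliminated vertices are carried along to identify the live neighbors in \<open>X\<close> with
  those in the remaining bag.\<close>

lemma elim_seq_correct:
  assumes g: "good L F X" and lab: "\<And>u. u \<in> X \<Longrightarrow> lab u = lbl L F u"
    and zs: "distinct zs" "set zs \<subseteq> X" and disj: "F \<inter> X = {}" and F: "finite F"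
    and nb: "\<And>v u. v \<in> set zs \<Longrightarrow> adj v u \<Longrightarrow> u \<in> F \<union> X"
    and seq: "elim_seq X zs lab = (lab', c, f)"
  shows "(f \<longleftrightarrow> good L (F \<union> set zs) (X - set zs)) \<and>
    (f \<longrightarrow> (\<forall>u\<in>X - set zs. lab' u = lbl L (F \<union> set zs) u)) \<and>
    (f \<longrightarrow> (\<forall>u\<in>set zs. lab' u = 0)) \<and>
    (f \<longrightarrow> card {v \<in> F \<union> set zs. L v = 0} = card {v \<in> F. L v = 0} + c)"
  using zs nb seq
proof (induction zs arbitrary: lab' c f rule: rev_induct)
  case Nil
  then show ?case using g lab by auto
next
  case (snoc v zs)
  obtain lab1 c1 f1 where s1: "elim_seq X zs lab = (lab1, c1, f1)" by (cases "elim_seq X zs lab")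
  have new: "lab' = elim_lab X lab1 v" "c = c1 + (if lab1 v \<le> 0 then 1 else 0)" "f \<longleftrightarrow> f1 \<and> elim_ok X lab1 v"
    using snoc.prems(4) by (simp_all add: elim_seq_snoc s1)
  let ?F = "F \<union> set zs" and ?X = "X - set zs"
  have IH: "f1 \<longleftrightarrow> good L ?F ?X" "f1 \<Longrightarrow> \<forall>u\<in>?X. lab1 u = lbl L ?F u" "f1 \<Longrightarrow> \<forall>u\<in>set zs. lab1 u = 0"
    "f1 \<Longrightarrow> card {v \<in> ?F. L v = 0} = card {v \<in> F. L v = 0} + c1"
    using snoc.IH[OF _ _ _ s1] snoc.prems by auto
  have sets: "F \<union> set (zs @ [v]) = insert v ?F" "X - set (zs @ [v]) = ?X - {v}" by auto
  show ?case
  proof (cases f1)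
    case False
    then have "\<not> good L (insert v ?F) (?X - {v})" using IH(1) good_antimono by blast
    then show ?thesis unfolding sets new using False by simp
  next
    case True
    have v: "v \<in> ?X" "v \<notin> ?F" using snoc.prems(1,2) disj by auto
    have "live_nbs X lab1 v = live_nbs ?X lab1 v" using IH(3)[OF True] by (auto simp: live_nbs_def)
    then have eq: "elim_ok X lab1 v = elim_ok ?X lab1 v" "elim_lab X lab1 v = elim_lab ?X lab1 v"
      by (auto simp: elim_ok_def elim_lab_def)
    have g1: "good L ?F ?X" using IH(1) True by simp
    have l1: "\<And>u. u \<in> ?X \<Longrightarrow> lab1 u = lbl L ?F u" using IH(2) True by simp
    have nb1: "\<And>u. adj v u \<Longrightarrow> u \<in> ?F \<union> ?X" using snoc.prems(3) by auto
    have d1: "?F \<inter> ?X = {}" using disj by auto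
    note st = elim_step[OF g1 l1 v(1) d1 nb1]
    have L: "\<And>v. L v \<in> {0, 1, 2}" using g by (auto simp: good_def)
    have "{x \<in> insert v ?F. L x = 0} = (if L v = 0 then insert v {x \<in> ?F. L x = 0} else {x \<in> ?F. L x = 0})"
      by auto
    then have card: "card {x \<in> insert v ?F. L x = 0} = card {x \<in> ?F. L x = 0} + (if lab1 v \<le> 0 then 1 else 0)"
      using v F lbl_simps(1,4)[of L v ?F, OF L] l1[OF v(1)] by auto
    have zero: "elim_lab X lab1 v u = 0" if "u \<in> set (zs @ [v])" for u
      using that IH(3)[OF True] by (auto simp: elim_lab_def)
    have "f \<longleftrightarrow> good L (insert v ?F) (?X - {v})" using st(1) new(3) eq True by simp
    moreover have "\<forall>u\<in>?X - {v}. lab' u = lbl L (insert v ?F) u" using st(2) new(1) eq by simp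
    moreover have "\<forall>u\<in>set (zs @ [v]). lab' u = 0" using zero new(1) by simp
    moreover have "card {x \<in> insert v ?F. L x = 0} = card {v \<in> F. L v = 0} + c"
      using card new(2) IH(4)[OF True] by simp
    ultimately show ?thesis unfolding sets by blast
  qed
qed

text \<open>The label array of the machine contains leftovers outside the two bags. Elimination
  reads only labels in \<open>X\<close>, so agreement on both bags is enough to determine count,
  flag and resulting labels there.\<close>

lemma elim_seq_cong:
  assumes "\<And>u. u \<in> X \<union> Y \<Longrightarrow> lab u = lab2 u" "set zs \<subseteq> X"
    "elim_seq X zs lab = (lab', c, f)" "elim_seq X zs lab2 = (lab2', c2, f2)"
  shows "c = c2 \<and> f = f2 \<and> (\<forall>u\<in>X \<union> Y. lab' u = lab2' u)"
  using assms
proof (induction zs arbitrary: lab' c f lab2' c2 f2 rule: rev_induct)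
  case (snoc v zs)
  obtain lab1 c1 f1 where s1: "elim_seq X zs lab = (lab1, c1, f1)" by (cases "elim_seq X zs lab")
  obtain lab3 c3 f3 where s3: "elim_seq X zs lab2 = (lab3, c3, f3)" by (cases "elim_seq X zs lab2")
  have IH: "c1 = c3 \<and> f1 = f3 \<and> (\<forall>u\<in>X \<union> Y. lab1 u = lab3 u)"
    using snoc.IH[OF snoc.prems(1) _ s1 s3] snoc.prems(2) by simp
  then have v: "lab1 v = lab3 v" using snoc.prems(2) by auto
  have ns: "live_nbs X lab1 v = live_nbs X lab3 v" using IH by (auto simp: live_nbs_def)
  have "elim_ok X lab1 v = elim_ok X lab3 v"
  proof -
    have "(\<Sum>u\<in>live_nbs X lab3 v. wt (lab1 u)) = (\<Sum>u\<in>live_nbs X lab3 v. wt (lab3 u))"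
      using IH by (intro sum.cong) (auto simp: live_nbs_def)
    moreover have "\<And>u. u \<in> live_nbs X lab3 v \<Longrightarrow> lab1 u = lab3 u" using IH by (auto simp: live_nbs_def)
    ultimately show ?thesis unfolding elim_ok_def ns v by auto
  qed
  moreover have "\<forall>u\<in>X \<union> Y. elim_lab X lab1 v u = elim_lab X lab3 v u"
    using IH by (auto simp: elim_lab_def ns v)
  ultimately show ?case using snoc.prems(3,4) IH v by (auto simp: elim_seq_snoc s1 s3)
qed auto

text \<open>Preserves the marker 5 on vertices that only the parent bag contains.\<close>

lemma elim_seq_outside:
  assumes "elim_seq X zs lab = (lab', c, f)" "set zs \<subseteq> X" "u \<notin> X"
  shows "lab' u = lab u"
  using assms
proof (induction zs arbitrary: lab' c f rule: rev_induct)
  case (snoc v zs)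
  obtain lab1 c1 f1 where s1: "elim_seq X zs lab = (lab1, c1, f1)" by (cases "elim_seq X zs lab")
  then have "lab1 u = lab u" using snoc by simp
  moreover have "lab' = elim_lab X lab1 v" "u \<noteq> v" using snoc.prems by (auto simp: elim_seq_snoc s1)
  ultimately show ?case using snoc.prems(3) by (simp add: elim_lab_def live_nbs_def)
qed auto

end

section \<open>Merging tables\<close>

lemma code_map_range:
  assumes "\<And>u. u \<in> set xs \<Longrightarrow> lab u \<in> {0..4}"
  shows "0 \<le> code (map lab xs)" "code (map lab xs) < 5 ^ length xs"
proof -
  have "set (map lab xs) \<subseteq> {0..4}" using assms by (simp add: image_subset_iff)
  then show "0 \<le> code (map lab xs)" "code (map lab xs) < 5 ^ length xs"
    using code_range[of "map lab xs"] by simp_all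
qed

text \<open>The computed costs form a subset of the achievable ones; the minimum is still right if
  every achievable cost is matched or beaten by a computed one.\<close>

lemma minval_transfer:
  assumes "minval x S" "S \<subseteq> R" "\<And>y. y \<in> R \<Longrightarrow> \<exists>z\<in>S. z \<le> y" "\<And>y. y \<in> R \<Longrightarrow> 0 < y"
  shows "minval x R"
  using assms unfolding minval_def by (metis equals0D equals0I order_trans subset_iff)

lemma minval_pos: "minval x S \<Longrightarrow> 0 < x \<Longrightarrow> x \<in> S"
  by (auto simp: minval_def)

lemma minval_le: "minval x S \<Longrightarrow> y \<in> S \<Longrightarrow> 0 < x \<and> x \<le> y"
  by (auto simp: minval_def)

context sgraph
begin

text \<open>Only deletions of forgotten vertices are counted. A deleted bag vertex is paid for when
  it is eliminated, so a vertex that occurs in many bags is paid for once.\<close>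

definition represents :: "nat list \<Rightarrow> nat set \<Rightarrow> (int \<Rightarrow> int) \<Rightarrow> bool" where
  "represents xs F T \<longleftrightarrow> (\<forall>lab. (\<forall>u\<in>set xs. lab u \<in> {0..4}) \<longrightarrow>
     minval (T (code (map lab xs))) ((\<lambda>c. int c + 1) ` {c. realizable F (set xs) lab c}))"

text \<open>Both table entries are shifted by one, hence the \<open>- 1\<close>: the sum is
  \<open>(c1 + 1) + ce + (c2 + 1) - 1\<close>.\<close>

definition all_push_costs :: "nat list \<Rightarrow> nat list \<Rightarrow> (int \<Rightarrow> int) \<Rightarrow> (int \<Rightarrow> int) \<Rightarrow> int \<Rightarrow> int set" where
  "all_push_costs xt xp Tt Tp g = {Tt (int ca) + int ce + Tp (int cb) - 1 | ca cb ce lab.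
     ca < 5 ^ length xt \<and> cb < 5 ^ length xp \<and> 0 < Tt (int ca) \<and> 0 < Tp (int cb) \<and>
     elim_seq (set xt) (filter (\<lambda>v. v \<notin> set xp) xt) (digit_label xt ca) = (lab, ce, True) \<and>
     (\<forall>u\<in>set xp. merge_ok (lab u) (digit_label xp cb u)) \<and>
     g = code (map (\<lambda>u. merge_label (lab u) (digit_label xp cb u)) xp)}"

lemma lbl_cong: "(\<And>v. v \<in> insert u F \<Longrightarrow> L v = L' v) \<Longrightarrow> lbl L F u = lbl L' F u"
proof -
  assume a: "\<And>v. v \<in> insert u F \<Longrightarrow> L v = L' v"
  have "nbs L u \<inter> F = nbs L' u \<inter> F" using a by (auto simp: nbs_def)
  moreover have "(\<Sum>e\<in>nbs L' u \<inter> F. wt (L e)) = (\<Sum>e\<in>nbs L' u \<inter> F. wt (L' e))"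
    using a by (intro sum.cong) auto
  ultimately show ?thesis using a by (simp add: lbl_def cur_def)
qed

lemma ok_cong: "(\<And>u. u = v \<or> adj v u \<Longrightarrow> L u = L' u) \<Longrightarrow> ok L v = ok L' v"
proof -
  assume a: "\<And>u. u = v \<or> adj v u \<Longrightarrow> L u = L' u"
  have n: "nbs L v = nbs L' v" using a by (auto simp: nbs_def)
  have l: "\<And>u. u \<in> nbs L' v \<Longrightarrow> L u = L' u" using a by (simp add: nbs_def)
  have "(\<Sum>u\<in>nbs L' v. wt (L u)) = (\<Sum>u\<in>nbs L' v. wt (L' u))"
    using l by (intro sum.cong) auto
  then show ?thesis using a l unfolding ok_def n by auto
qed

text \<open>The basis of gluing: two labellings that agree on \<open>F\<close> and on the bag that
  encloses it cannot be distinguished.\<close>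

lemma good_cong:
  assumes "\<And>v. v \<in> F \<union> X \<Longrightarrow> L v = L' v" "\<And>v u. v \<in> F \<Longrightarrow> adj v u \<Longrightarrow> u \<in> F \<union> X"
    "\<And>v. L v \<in> {0, 1, 2}" "\<And>v. L' v \<in> {0, 1, 2}"
  shows "good L F X \<longleftrightarrow> good L' F X"
proof -
  have "ok L v = ok L' v" if "v \<in> F" for v using assms(1,2) that by (intro ok_cong) auto
  moreover have "lbl L F u = lbl L' F u" if "u \<in> X" for u using assms(1) that by (intro lbl_cong) auto
  ultimately show ?thesis unfolding good_def using assms(3,4) by auto
qed

text \<open>\<open>Ft\<close> sees the parent bag only through \<open>Xc\<close> and is disjoint
  from \<open>Fp\<close>, so forgotten weights from the two sides simply add. For a common
  \<open>L\<close>, \<open>merge_ok\<close> is then just the cap of 4 on the combined label.\<close>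

lemma good_union:
  assumes L: "\<And>v. L v \<in> {0, 1, 2}"
    and disj: "Ft \<inter> (Fp \<union> Xp) = {}" and Xc: "Xc \<subseteq> Xp" and fin: "finite Ft" "finite Fp"
    and nbt: "\<And>v u. v \<in> Ft \<Longrightarrow> adj v u \<Longrightarrow> u \<in> Ft \<union> Xc"
  shows "\<And>u. u \<in> Xp \<Longrightarrow> lbl L (Fp \<union> Ft) u =
      (if u \<in> Xc then (if lbl L Ft u \<le> 1 then lbl L Ft u else lbl L Ft u + lbl L Fp u - 2) else lbl L Fp u)"
    "good L (Fp \<union> Ft) Xp \<longleftrightarrow> good L Ft Xc \<and> good L Fp Xp \<and> (\<forall>u\<in>Xc. merge_ok (lbl L Ft u) (lbl L Fp u))"
proof -
  have cur: "cur L (Fp \<union> Ft) u = cur L Fp u + cur L Ft u" for u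
  proof -
    have "nbs L u \<inter> (Fp \<union> Ft) = (nbs L u \<inter> Fp) \<union> (nbs L u \<inter> Ft)" by auto
    then show ?thesis unfolding cur_def using disj fin by (subst sum.union_disjoint[symmetric]) auto
  qed
  have zero: "cur L Ft u = 0" if "u \<in> Xp" "u \<notin> Xc" for u
  proof -
    have "nbs L u \<inter> Ft = {}" using that nbt[of _ u] disj adj_sym unfolding nbs_def by blast
    then show ?thesis by (simp add: cur_def)
  qed
  show lab: "lbl L (Fp \<union> Ft) u =
      (if u \<in> Xc then (if lbl L Ft u \<le> 1 then lbl L Ft u else lbl L Ft u + lbl L Fp u - 2) else lbl L Fp u)"
    if "u \<in> Xp" for u
    using L[of u] cur[of u] zero[OF that] cur_nonneg[of L Ft u] by (auto simp: lbl_def)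
  have mono: "lbl L Ft u \<le> lbl L (Fp \<union> Ft) u" "lbl L Fp u \<le> lbl L (Fp \<union> Ft) u" for u
    using cur[of u] cur_nonneg[of L Ft u] cur_nonneg[of L Fp u] by (auto simp: lbl_def)
  have mok: "merge_ok (lbl L Ft u) (lbl L Fp u) \<longleftrightarrow> lbl L (Fp \<union> Ft) u \<le> 4" if "lbl L Ft u \<le> 4" for u
    using that L[of u] cur[of u] cur_nonneg[of L Ft u] cur_nonneg[of L Fp u] by (auto simp: lbl_def merge_ok_def)
  show "good L (Fp \<union> Ft) Xp \<longleftrightarrow> good L Ft Xc \<and> good L Fp Xp \<and> (\<forall>u\<in>Xc. merge_ok (lbl L Ft u) (lbl L Fp u))"
    (is "?l \<longleftrightarrow> ?r")
  proof
    assume l: ?l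
    then have 4: "\<And>u. u \<in> Xp \<Longrightarrow> lbl L (Fp \<union> Ft) u \<le> 4" by (simp add: good_def)
    then have "\<And>u. u \<in> Xp \<Longrightarrow> lbl L Ft u \<le> 4 \<and> lbl L Fp u \<le> 4" using mono order_trans by blast
    then show ?r using l Xc 4 mok by (auto simp: good_def)
  next
    assume r: ?r
    have "lbl L (Fp \<union> Ft) u \<le> 4" if "u \<in> Xp" for u
    proof (cases "u \<in> Xc")
      case True
      then show ?thesis using r mok by (auto simp: good_def)
    next
      case False
      then show ?thesis using lab[OF that] r that by (auto simp: good_def)
    qed
    then show ?l using r by (auto simp: good_def)
  qed
qed

lemma good_antimono_list: "good L (F \<union> set zs) (X - set zs) \<Longrightarrow> good L F X"
proof (induction zs arbitrary: F X)
  case (Cons z zs)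
  have "F \<union> set (z # zs) = insert z F \<union> set zs" "X - set (z # zs) = X - {z} - set zs" by auto
  then have "good L (insert z F) (X - {z})" using Cons by metis
  then show ?case by (rule good_antimono)
qed simp

lemma lbl_range: "good L F X \<Longrightarrow> u \<in> X \<Longrightarrow> lbl L F u \<in> {0..4}"
  using lbl_simps(4)[of L u F] by (simp add: good_def)

lemma represents_entry:
  assumes "represents xs F T" "distinct xs" "c < 5 ^ length xs"
  shows "minval (T (int c)) ((\<lambda>c. int c + 1) ` {k. realizable F (set xs) (digit_label xs c) k})"
  using assms digit_label_range[of _ xs c] code_digit_label[OF assms(2,3)] unfolding represents_def by metis

text \<open>Soundness glues a labelling for the child side to one for the parent side along the
  shared bag vertices; completeness reads both labellings off a single one. Costs add because the
  forgotten sets are disjoint.\<close>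

theorem push_correct:
  assumes dist: "distinct xt" "distinct xp"
    and rep: "represents xt F Tt" "represents xp Fp Tp"
    and fin: "finite F" "finite Fp"
  defines "Ft \<equiv> F \<union> (set xt - set xp)"
  assumes F: "F \<inter> set xt = {}"
    and nb: "\<And>v u. v \<in> Ft \<Longrightarrow> adj v u \<Longrightarrow> u \<in> F \<union> set xt"
    and disj: "Ft \<inter> (Fp \<union> set xp) = {}"
    and Fp: "Fp \<inter> set xp = {}" and nbp: "\<And>v u. v \<in> Fp \<Longrightarrow> adj v u \<Longrightarrow> u \<in> Fp \<union> set xp"
    and T: "\<And>g. 0 \<le> g \<Longrightarrow> g < 5 ^ length xp \<Longrightarrow> minval (T g) (all_push_costs xt xp Tt Tp g)"
  shows "represents xp (Fp \<union> Ft) T"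
  unfolding represents_def
proof (intro allI impI)
  fix \<gamma> :: "nat \<Rightarrow> int" assume \<gamma>: "\<forall>u\<in>set xp. \<gamma> u \<in> {0..4}"
  define g where "g = code (map \<gamma> xp)"
  have g: "0 \<le> g" "g < 5 ^ length xp"
    using code_map_range[of xp \<gamma>] \<gamma> by (simp_all add: g_def)
  define zs where "zs = filter (\<lambda>v. v \<notin> set xp) xt"
  define Xc where "Xc = set xt \<inter> set xp"
  have zs: "distinct zs" "set zs \<subseteq> set xt" "F \<union> set zs = Ft" "set xt - set zs = Xc"
    using dist by (auto simp: zs_def Ft_def Xc_def)
  have finFt: "finite Ft" using fin by (simp add: Ft_def)
  have nbt: "\<And>v u. v \<in> Ft \<Longrightarrow> adj v u \<Longrightarrow> u \<in> Ft \<union> Xc" using nb by (auto simp: Ft_def Xc_def)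
  have XcXp: "Xc \<subseteq> set xp" by (simp add: Xc_def)
  have nbzs: "\<And>v u. v \<in> set zs \<Longrightarrow> adj v u \<Longrightarrow> u \<in> F \<union> set xt" using nb zs(3) by blast
  let ?R = "(\<lambda>c. int c + 1) ` {c. realizable (Fp \<union> Ft) (set xp) \<gamma> c}"
  let ?S = "all_push_costs xt xp Tt Tp g"
  have card: "card {v \<in> Fp \<union> Ft. L v = 0} = card {v \<in> Fp. L v = 0} + card {v \<in> Ft. L v = 0}" for L :: "nat \<Rightarrow> int"
  proof -
    have "{v \<in> Fp \<union> Ft. L v = 0} = {v \<in> Fp. L v = 0} \<union> {v \<in> Ft. L v = 0}" by auto
    then show ?thesis using fin finFt disj by (subst card_Un_disjoint[symmetric]) auto
  qed
  have outside: "lab u = 5" if "elim_seq (set xt) zs (digit_label xt ca) = (lab, ce, f)" "u \<in> set xp - Xc" for lab ca ce f u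
    using elim_seq_outside[OF that(1) zs(2)] that(2) digit_label_notin by (auto simp: Xc_def)
  have gu1: "lbl L (Fp \<union> Ft) u =
      (if u \<in> Xc then (if lbl L Ft u \<le> 1 then lbl L Ft u else lbl L Ft u + lbl L Fp u - 2) else lbl L Fp u)"
    if L: "\<And>v. L v \<in> {0, 1, 2}" and u: "u \<in> set xp" for L u
    by (rule good_union(1)[where Xp = "set xp"]) (fact L u disj XcXp finFt fin(2) nbt)+
  have gu2: "good L (Fp \<union> Ft) (set xp) \<longleftrightarrow>
      good L Ft Xc \<and> good L Fp (set xp) \<and> (\<forall>u\<in>Xc. merge_ok (lbl L Ft u) (lbl L Fp u))"
    if L: "\<And>v. L v \<in> {0, 1, 2}" for L
    by (rule good_union(2)) (fact L disj XcXp finFt fin(2) nbt)+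
  have sound: "x \<in> ?R" if "x \<in> ?S" for x
  proof -
    obtain ca cb ce lab where x: "x = Tt (int ca) + int ce + Tp (int cb) - 1"
      and ca: "ca < 5 ^ length xt" and cb: "cb < 5 ^ length xp"
      and pos: "0 < Tt (int ca)" "0 < Tp (int cb)"
      and es: "elim_seq (set xt) zs (digit_label xt ca) = (lab, ce, True)"
      and mok: "\<forall>u\<in>set xp. merge_ok (lab u) (digit_label xp cb u)"
      and gc: "g = code (map (\<lambda>u. merge_label (lab u) (digit_label xp cb u)) xp)"
      using \<open>x \<in> ?S\<close> unfolding all_push_costs_def zs_def by blast
    obtain c1 where c1: "Tt (int ca) = int c1 + 1" "realizable F (set xt) (digit_label xt ca) c1"
      using minval_pos[OF represents_entry[OF rep(1) dist(1) ca] pos(1)] by auto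
    obtain c2 where c2: "Tp (int cb) = int c2 + 1" "realizable Fp (set xp) (digit_label xp cb) c2"
      using minval_pos[OF represents_entry[OF rep(2) dist(2) cb] pos(2)] by auto
    obtain L1 where L1: "good L1 F (set xt)" "\<And>u. u \<in> set xt \<Longrightarrow> digit_label xt ca u = lbl L1 F u"
      "c1 = card {v \<in> F. L1 v = 0}" using c1(2) unfolding realizable_def by blast
    obtain L2 where L2: "good L2 Fp (set xp)" "\<And>u. u \<in> set xp \<Longrightarrow> digit_label xp cb u = lbl L2 Fp u"
      "c2 = card {v \<in> Fp. L2 v = 0}" using c2(2) unfolding realizable_def by blast
    have V: "\<And>v. L1 v \<in> {0, 1, 2}" "\<And>v. L2 v \<in> {0, 1, 2}" using L1 L2 by (auto simp: good_def)
    have e: "good L1 Ft Xc" "\<And>u. u \<in> Xc \<Longrightarrow> lab u = lbl L1 Ft u"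
      "card {v \<in> Ft. L1 v = 0} = c1 + ce"
      using elim_seq_correct[OF L1(1,2) zs(1,2) F fin(1) nbzs es] L1(3) unfolding zs(3,4) by auto
    define L where "L = (\<lambda>v. if v \<in> Ft then L1 v else L2 v)"
    have LV: "\<And>v. L v \<in> {0, 1, 2}" using V by (simp add: L_def)
    \<comment> \<open>\<open>merge_ok\<close> forces both sides to agree on deleted, center or
      other, and this determines the value of a global labelling.\<close>
    have eqc: "L1 u = L2 u" if u: "u \<in> Xc" for u
    proof -
      have "merge_ok (lbl L1 Ft u) (lbl L2 Fp u)" using mok e(2)[OF u] L2(2) XcXp u by fastforce
      moreover have "lbl L1 Ft u \<le> 4" using e(1) u by (simp add: good_def)
      ultimately show ?thesis
        using lbl_simps(1-3)[of L1 u Ft, OF V(1)] lbl_simps(1-3)[of L2 u Fp, OF V(2)] V(1)[of u] V(2)[of u]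
        unfolding merge_ok_def insert_iff empty_iff by (smt (verit))
    qed
    have LX: "\<And>v. v \<in> Ft \<union> Xc \<Longrightarrow> L v = L1 v" using eqc by (auto simp: L_def)
    have LP: "\<And>v. v \<in> Fp \<union> set xp \<Longrightarrow> L v = L2 v" using disj by (auto simp: L_def)
    have lt: "\<And>u. u \<in> Xc \<Longrightarrow> lbl L Ft u = lbl L1 Ft u" using LX by (intro lbl_cong) auto
    have lp: "\<And>u. u \<in> set xp \<Longrightarrow> lbl L Fp u = lbl L2 Fp u" using LP by (intro lbl_cong) auto
    have "good L Ft Xc \<longleftrightarrow> good L1 Ft Xc" by (rule good_cong) (fact LX nbt LV V(1))+
    then have gt: "good L Ft Xc" using e(1) by simp
    have "good L Fp (set xp) \<longleftrightarrow> good L2 Fp (set xp)" by (rule good_cong) (fact LP nbp LV V(2))+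
    then have gp: "good L Fp (set xp)" using L2(1) by simp
    note gu = gu1[of L, OF LV] gu2[of L, OF LV]
    have "\<forall>u\<in>Xc. merge_ok (lbl L Ft u) (lbl L Fp u)"
      using mok e(2) lt lp L2(2) XcXp by fastforce
    then have gL: "good L (Fp \<union> Ft) (set xp)" using gu(2) gt gp by blast
    have mv: "merge_label (lab u) (digit_label xp cb u) = lbl L (Fp \<union> Ft) u" if u: "u \<in> set xp" for u
    proof (cases "u \<in> Xc")
      case True
      moreover have "lab u \<le> 4" using e(1,2) True by (auto simp: good_def)
      ultimately show ?thesis using gu(1)[OF u] e(2) lt[OF True] lp[OF u] L2(2)[OF u]
        by (simp add: merge_label_def)
    next
      case False
      then show ?thesis using gu(1)[OF u] outside[OF es] u lp[OF u] L2(2)[OF u]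
        by (simp add: merge_label_def)
    qed
    have "map (\<lambda>u. merge_label (lab u) (digit_label xp cb u)) xp = map (lbl L (Fp \<union> Ft)) xp"
      using mv by simp
    \<comment> \<open>The cell only determines a code. As all labels are below 5, equal codes come
      from equal labels, so the glued labelling realizes \<open>\<gamma>\<close> itself.\<close>
    then have "code (map \<gamma> xp) = code (map (lbl L (Fp \<union> Ft)) xp)" using gc g_def by metis
    moreover have "set (map \<gamma> xp) \<subseteq> {0..4}" "set (map (lbl L (Fp \<union> Ft)) xp) \<subseteq> {0..4}"
      unfolding set_map image_subset_iff using \<gamma> lbl_range[OF gL] by blast+
    ultimately have "map \<gamma> xp = map (lbl L (Fp \<union> Ft)) xp" using code_inj by blast
    then have "\<forall>u\<in>set xp. \<gamma> u = lbl L (Fp \<union> Ft) u" by simp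
    then have "realizable (Fp \<union> Ft) (set xp) \<gamma> (card {v \<in> Fp \<union> Ft. L v = 0})"
      unfolding realizable_def using gL by blast
    moreover have "card {v \<in> Fp \<union> Ft. L v = 0} = c2 + (c1 + ce)"
    proof -
      have "{v \<in> Fp. L v = 0} = {v \<in> Fp. L2 v = 0}" "{v \<in> Ft. L v = 0} = {v \<in> Ft. L1 v = 0}"
        using LP LX by auto
      then show ?thesis unfolding card using L2(3) e(3) by simp
    qed
    ultimately have "realizable (Fp \<union> Ft) (set xp) \<gamma> (c2 + (c1 + ce))" by simp
    then show ?thesis unfolding x c1(1) c2(1) by (intro rev_image_eqI[of "c2 + (c1 + ce)"]) auto
  qed
  have complete: "\<exists>z\<in>?S. z \<le> y" if "y \<in> ?R" for y
  proof -
    obtain L where gL: "good L (Fp \<union> Ft) (set xp)" and lg: "\<And>u. u \<in> set xp \<Longrightarrow> \<gamma> u = lbl L (Fp \<union> Ft) u"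
      and y: "y = int (card {v \<in> Fp \<union> Ft. L v = 0}) + 1" using \<open>y \<in> ?R\<close> unfolding realizable_def by blast
    have V: "\<And>v. L v \<in> {0, 1, 2}" using gL by (auto simp: good_def)
    note gu = gu1[of L, OF V] gu2[of L, OF V]
    have gt: "good L Ft Xc" and gp: "good L Fp (set xp)"
      and mok: "\<forall>u\<in>Xc. merge_ok (lbl L Ft u) (lbl L Fp u)" using gu(2) gL by blast+
    \<comment> \<open>Goodness after the eliminations implies goodness before them, so the
      restriction of \<open>L\<close> is covered by the child table.\<close>
    have gF: "good L F (set xt)" using good_antimono_list[of L F zs "set xt"] gt zs(3,4) by simp
    define \<alpha> where "\<alpha> = lbl L F"
    define \<beta> where "\<beta> = lbl L Fp"
    have \<alpha>: "\<And>u. u \<in> set xt \<Longrightarrow> \<alpha> u \<in> {0..4}" using lbl_range[OF gF] by (simp add: \<alpha>_def)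
    have \<beta>: "\<And>u. u \<in> set xp \<Longrightarrow> \<beta> u \<in> {0..4}" using lbl_range[OF gp] by (simp add: \<beta>_def)
    define ca where "ca = nat (code (map \<alpha> xt))"
    define cb where "cb = nat (code (map \<beta> xp))"
    have ca0: "0 \<le> code (map \<alpha> xt)" "code (map \<alpha> xt) < 5 ^ length xt"
      using code_map_range[of xt \<alpha>] \<alpha> by blast+
    have cb0: "0 \<le> code (map \<beta> xp)" "code (map \<beta> xp) < 5 ^ length xp"
      using code_map_range[of xp \<beta>] \<beta> by blast+
    have ca: "ca < 5 ^ length xt" "int ca = code (map \<alpha> xt)"
      using ca0 by (auto simp: ca_def nat_less_iff)
    have cb: "cb < 5 ^ length xp" "int cb = code (map \<beta> xp)"
      using cb0 by (auto simp: cb_def nat_less_iff)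
    have da: "\<And>u. u \<in> set xt \<Longrightarrow> digit_label xt ca u = lbl L F u"
      using digit_label_code[OF dist(1) \<alpha>] by (simp add: ca_def \<alpha>_def)
    have db: "\<And>u. u \<in> set xp \<Longrightarrow> digit_label xp cb u = lbl L Fp u"
      using digit_label_code[OF dist(2) \<beta>] by (simp add: cb_def \<beta>_def)
    have "realizable F (set xt) \<alpha> (card {v \<in> F. L v = 0})"
      unfolding realizable_def \<alpha>_def using gF by blast
    then have ta: "0 < Tt (int ca) \<and> Tt (int ca) \<le> int (card {v \<in> F. L v = 0}) + 1"
      using rep(1) \<alpha> unfolding represents_def ca(2) by (intro minval_le) auto
    have "realizable Fp (set xp) \<beta> (card {v \<in> Fp. L v = 0})"
      unfolding realizable_def \<beta>_def using gp by blast
    then have tb: "0 < Tp (int cb) \<and> Tp (int cb) \<le> int (card {v \<in> Fp. L v = 0}) + 1"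
      using rep(2) \<beta> unfolding represents_def cb(2) by (intro minval_le) auto
    obtain lab ce f where es: "elim_seq (set xt) zs (digit_label xt ca) = (lab, ce, f)"
      by (cases "elim_seq (set xt) zs (digit_label xt ca)")
    have e: "f" "\<And>u. u \<in> Xc \<Longrightarrow> lab u = lbl L Ft u"
      "card {v \<in> Ft. L v = 0} = card {v \<in> F. L v = 0} + ce"
      using elim_seq_correct[OF gF da zs(1,2) F fin(1) nbzs es] gt unfolding zs(3,4) by auto
    have mk: "\<forall>u\<in>set xp. merge_ok (lab u) (digit_label xp cb u)"
    proof
      fix u assume u: "u \<in> set xp"
      show "merge_ok (lab u) (digit_label xp cb u)"
      proof (cases "u \<in> Xc")
        case True
        then show ?thesis using mok e(2) db u by auto
      next
        case False
        then show ?thesis using outside[OF es] u by (simp add: merge_ok_def)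
      qed
    qed
    have mv: "merge_label (lab u) (digit_label xp cb u) = \<gamma> u" if u: "u \<in> set xp" for u
    proof (cases "u \<in> Xc")
      case True
      moreover have "lab u \<le> 4" using gt e(2) True by (auto simp: good_def)
      ultimately show ?thesis using gu(1)[OF u] e(2) lg[OF u] db[OF u] by (simp add: merge_label_def)
    next
      case False
      then show ?thesis using gu(1)[OF u] outside[OF es] u lg[OF u] db[OF u] by (simp add: merge_label_def)
    qed
    have "g = code (map (\<lambda>u. merge_label (lab u) (digit_label xp cb u)) xp)"
      unfolding g_def using mv by (intro arg_cong[of _ _ code]) simp
    moreover have "elim_seq (set xt) zs (digit_label xt ca) = (lab, ce, True)" using es e(1) by simp
    ultimately have "Tt (int ca) + int ce + Tp (int cb) - 1 \<in> ?S"
      unfolding all_push_costs_def zs_def[symmetric] using ca(1) cb(1) ta tb mk by blast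
    moreover have "Tt (int ca) + int ce + Tp (int cb) - 1 \<le> y"
      unfolding y card e(3) using ta tb by simp
    ultimately show ?thesis by blast
  qed
  have "minval (T g) ?R"
    using T[OF g] by (rule minval_transfer) (use sound complete in auto)
  then show "minval (T (code (map \<gamma> xp))) ?R" by (simp add: g_def)
qed

text \<open>With nothing forgotten, labels 3 and 4 cannot occur and every other labelling has cost
  0, stored as 1.\<close>

lemma represents_unit:
  assumes "\<And>lab. (\<forall>u\<in>set xs. lab u \<in> {0..4}) \<Longrightarrow>
    T (code (map lab xs)) = (if \<forall>u\<in>set xs. lab u \<le> 2 then 1 else 0)"
  shows "represents xs {} T"
  unfolding represents_def
proof (intro allI impI)
  fix lab :: "nat \<Rightarrow> int" assume l: "\<forall>u\<in>set xs. lab u \<in> {0..4}"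
  have lb: "lbl L {} u = L u" for L u by (simp add: lbl_def cur_def)
  have "realizable {} (set xs) lab c \<longleftrightarrow> c = 0 \<and> (\<forall>u\<in>set xs. lab u \<le> 2)" for c
  proof
    assume "realizable {} (set xs) lab c"
    then obtain L where "good L {} (set xs)" "\<forall>u\<in>set xs. lab u = L u" "c = 0"
      unfolding realizable_def lb by auto
    moreover have "L u \<le> 2" for u using calculation(1) unfolding good_def by (metis insert_iff empty_iff order.refl zero_le_numeral one_le_numeral)
    ultimately show "c = 0 \<and> (\<forall>u\<in>set xs. lab u \<le> 2)" by simp
  next
    assume a: "c = 0 \<and> (\<forall>u\<in>set xs. lab u \<le> 2)"
    let ?L = "\<lambda>u. if u \<in> set xs then lab u else 0"
    have "?L u \<in> {0, 1, 2}" for u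
    proof (cases "u \<in> set xs")
      case True
      then have "0 \<le> lab u" "lab u \<le> 2" using l a by auto
      then show ?thesis using True by auto
    qed simp
    then show "realizable {} (set xs) lab c" unfolding realizable_def lb using a l
      by (intro exI[of _ ?L]) (auto simp: good_def lb)
  qed
  then have "(\<lambda>c. int c + 1) ` {c. realizable {} (set xs) lab c} = (if \<forall>u\<in>set xs. lab u \<le> 2 then {1} else {})"
    by auto
  then show "minval (T (code (map lab xs))) ((\<lambda>c. int c + 1) ` {c. realizable {} (set xs) lab c})"
    using assms[OF l] by (simp add: minval_def)
qed

text \<open>For an empty bag with everything forgotten, \<open>good\<close> amounts to
  \<open>ok\<close> at all vertices, and the characterization of \<open>p4free\<close> by labellings
  applies.\<close>

lemma realizable_root:
  "(\<exists>c. realizable V {} lab c \<and> int c \<le> k) \<longleftrightarrow> (\<exists>S\<subseteq>V. int (card S) \<le> k \<and> p4free (V - S))"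
proof
  assume "\<exists>c. realizable V {} lab c \<and> int c \<le> k"
  then obtain L where L: "good L V {}" "int (card {v \<in> V. L v = 0}) \<le> k" unfolding realizable_def by blast
  have "p4free {v \<in> V. L v \<noteq> 0}" using L(1) by (intro ok_imp_p4free) (auto simp: good_def)
  moreover have "{v \<in> V. L v \<noteq> 0} = V - {v \<in> V. L v = 0}" by auto
  ultimately show "\<exists>S\<subseteq>V. int (card S) \<le> k \<and> p4free (V - S)"
    using L(2) by (intro exI[of _ "{v \<in> V. L v = 0}"]) auto
next
  assume "\<exists>S\<subseteq>V. int (card S) \<le> k \<and> p4free (V - S)"
  then obtain S where "S \<subseteq> V" "int (card S) \<le> k" "p4free (V - S)" by blast
  then obtain L where "\<forall>v. L v \<in> {0, 1, 2}" "\<forall>v \<in> V. ok L v" "{v \<in> V. L v = 0} = S" using p4free_imp_ok by blast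
  then show "\<exists>c. realizable V {} lab c \<and> int c \<le> k"
    using \<open>int (card S) \<le> k\<close> unfolding realizable_def good_def by auto
qed

end

section \<open>Subtrees of a tree decomposition\<close>

locale treedec =
  fixes G :: "nat pair_pre_digraph" and T :: "nat set" and r :: nat and p :: "nat \<Rightarrow> nat"
    and X :: "nat \<Rightarrow> nat set"
  assumes G: "pair_graph G" and td: "tree_decomposition G T r p X"
begin

definition adj :: "nat \<Rightarrow> nat \<Rightarrow> bool" where
  "adj u v \<longleftrightarrow> (u, v) \<in> parcs G"

definition desc :: "nat \<Rightarrow> nat set" where
  "desc t = {s \<in> T. \<exists>i. (p ^^ i) s = t}"

definition below :: "nat \<Rightarrow> nat set" where
  "below t = (\<Union>s\<in>desc t. X s)"

text \<open>\<open>Q\<close> stands for the children already merged into \<open>q\<close>, so that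
  the table of \<open>q\<close> is described also while other children are pending.\<close>

definition forgotten :: "nat \<Rightarrow> nat set \<Rightarrow> nat set" where
  "forgotten q Q = (\<Union>t\<in>Q. below t) - X q"

abbreviation ch :: "nat \<Rightarrow> nat set" where
  "ch \<equiv> children T p"

lemma rooted: "finite T" "r \<in> T" "p r = r" "\<And>t. t \<in> T \<Longrightarrow> p t \<in> T" "\<And>t. t \<in> T \<Longrightarrow> \<exists>i. (p ^^ i) t = r"
  using td by (auto simp: tree_decomposition_def rooted_tree_def)

lemma bags_V: "(\<Union>t\<in>T. X t) = pverts G"
  using td by (auto simp: tree_decomposition_def)

lemma arc_bag: "adj u v \<Longrightarrow> \<exists>t\<in>T. u \<in> X t \<and> v \<in> X t"
  using td by (auto simp: tree_decomposition_def adj_def)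

lemma sgraph: "sgraph (pverts G) adj"
proof -
  interpret pair_graph G by (rule G)
  show ?thesis
    by unfold_locales (use arcs_symmetric no_loops' in \<open>auto simp: adj_def dest: in_arcsD1 in_arcsD2\<close>)
qed

lemma pow_r: "(p ^^ i) r = r"
  by (induction i) (auto simp: rooted)

text \<open>Otherwise \<open>t\<close> would return to itself after \<open>Suc i\<close> steps and
  so after every multiple of that, although it has reached the fixed root after \<open>k\<close>
  steps.\<close>

lemma p_not_desc: assumes "t \<in> T" "t \<noteq> r" shows "p t \<notin> desc t"
proof
  assume "p t \<in> desc t"
  then obtain i where "(p ^^ i) (p t) = t" by (auto simp: desc_def)
  then have i: "(p ^^ Suc i) t = t" by (simp add: funpow_swap1)
  have rep: "(p ^^ (n * Suc i)) t = t" for n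
  proof (induction n)
    case (Suc n)
    have "(p ^^ (Suc n * Suc i)) t = (p ^^ Suc i) ((p ^^ (n * Suc i)) t)"
      by (simp only: funpow_add mult_Suc o_apply)
    then show ?case using Suc i by simp
  qed simp
  obtain k where k: "(p ^^ k) t = r" using rooted(5) assms by blast
  have "(p ^^ (k * Suc i)) t = (p ^^ (k * i)) ((p ^^ k) t)"
    by (metis funpow_add o_apply mult_Suc_right add.commute)
  then show False using rep[of k] k pow_r assms(2) by simp
qed

lemma desc_refl: "t \<in> T \<Longrightarrow> t \<in> desc t"
  by (auto simp: desc_def intro: exI[of _ 0])

lemma desc_step:
  assumes "x \<in> desc t" "x \<noteq> t" shows "p x \<in> desc t"
proof -
  obtain i where i: "(p ^^ i) x = t" "x \<in> T" using assms by (auto simp: desc_def)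
  then obtain j where "i = Suc j" using assms(2) by (cases i) auto
  then have "(p ^^ j) (p x) = t" using i by (simp add: funpow_swap1)
  then show ?thesis using i rooted(4) by (auto simp: desc_def)
qed

lemma desc_up: "p y \<in> desc t \<Longrightarrow> y \<in> T \<Longrightarrow> y \<in> desc t"
  by (auto simp: desc_def funpow_swap1 intro: exI[of _ "Suc _"])

lemma desc_rec: assumes "t \<in> T" shows "desc t = insert t (\<Union>c\<in>ch t. desc c)"
proof (intro equalityI subsetI)
  fix s assume s: "s \<in> desc t"
  then obtain i where i: "s \<in> T" "(p ^^ i) s = t" by (auto simp: desc_def)
  from i show "s \<in> insert t (\<Union>c\<in>ch t. desc c)"
  proof (induction i arbitrary: s)
    case (Suc i)
    show ?case
    proof (cases "p s = t")
      case True
      then show ?thesis using Suc.prems desc_refl by (auto simp: children_def)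
    next
      case False
      have "p s \<in> insert t (\<Union>c\<in>ch t. desc c)"
        using Suc.IH[of "p s"] Suc.prems rooted(4) by (simp add: funpow_swap1)
      then show ?thesis using False desc_up Suc.prems by auto
    qed
  qed simp
next
  fix s assume "s \<in> insert t (\<Union>c\<in>ch t. desc c)"
  then consider "s = t" | c where "c \<in> ch t" "s \<in> desc c" by blast
  then show "s \<in> desc t"
  proof cases
    case 2
    then obtain i where "s \<in> T" "(p ^^ i) s = c" "p c = t" by (auto simp: desc_def children_def)
    then show ?thesis by (auto simp: desc_def intro: exI[of _ "Suc i"])
  qed (use desc_refl assms in simp)
qed

lemma below_rec: "t \<in> T \<Longrightarrow> below t = X t \<union> forgotten t (ch t)"
  unfolding below_def forgotten_def using desc_rec by (auto simp: below_def)

text \<open>A walk can leave the subtree of \<open>t\<close> only along the edge from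
  \<open>t\<close> to \<open>p t\<close>. The nodes whose bags contain \<open>v\<close> are
  connected, so a walk inside them from \<open>s\<close> to \<open>s'\<close> must use this
  edge.\<close>

lemma separation:
  assumes t: "t \<in> T" "t \<noteq> r" and s: "s \<in> desc t" and s': "s' \<in> T" "s' \<notin> desc t"
    and v: "v \<in> X s" "v \<in> X s'"
  shows "v \<in> X t \<and> v \<in> X (p t)"
proof (rule ccontr)
  assume no: "\<not> ?thesis"
  let ?H = "with_proj (tree_graph T p) \<restriction> {t \<in> T. v \<in> X t}"
  have vV: "v \<in> pverts G" using bags_V v s' by blast
  have "connected ?H" using td vV by (auto simp: tree_decomposition_def)
  moreover have "s \<in> verts ?H" "s' \<in> verts ?H" using s s' v by (auto simp: desc_def)
  ultimately have "s \<rightarrow>\<^sup>*\<^bsub>mk_symmetric ?H\<^esub> s'"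
    unfolding connected_def strongly_connected_def by simp
  then have "(s, s') \<in> rtrancl_on {t \<in> T. v \<in> X t} (parcs (mk_symmetric ?H))"
    by (simp add: reachable_def)
  then have "s' \<in> desc t"
  proof (induction rule: rtrancl_on_induct)
    case base
    show ?case by fact
  next
    case (step y z)
    have "y \<in> {t \<in> T. v \<in> X t}" "z \<in> {t \<in> T. v \<in> X t}"
      using step.hyps by (auto simp: parcs_mk_symmetric tree_graph_def)
    moreover have "p y = z \<or> p z = y"
      using step.hyps by (auto simp: parcs_mk_symmetric tree_graph_def)
    ultimately show ?case using step.IH no desc_step[of y t] desc_up[of z t] by auto
  qed
  then show False using s' by simp
qed

lemma below_parent:
  assumes t: "t \<in> T" "t \<noteq> r" shows "below t \<inter> X (p t) \<subseteq> X t"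
  using separation[OF t _ _ p_not_desc[OF t]] rooted(4)[OF t(1)] by (auto simp: below_def)

text \<open>A bag that contains both ends of the edge cannot lie outside the subtree, since
  \<open>v\<close> would then belong to \<open>X (p t)\<close> by \<open>separation\<close>.\<close>

lemma below_nb:
  assumes t: "t \<in> T" "t \<noteq> r" and v: "v \<in> below t - X (p t)" and uv: "adj v u"
  shows "u \<in> below t"
proof -
  obtain s where s: "s \<in> desc t" "v \<in> X s" using v by (auto simp: below_def)
  obtain s' where s': "s' \<in> T" "v \<in> X s'" "u \<in> X s'" using arc_bag[OF uv] by blast
  have "s' \<in> desc t" using separation[OF t s(1) s'(1) _ s(2) s'(2)] v by blast
  then show ?thesis using s' by (auto simp: below_def)
qed

lemma desc_siblings:
  assumes "t \<in> T" "c \<in> T" "t \<noteq> c" "p t = p c" "t \<noteq> r" "c \<noteq> r"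
  shows "desc t \<inter> desc c = {}"
proof -
  \<comment> \<open>If \<open>s\<close> reaches both siblings, the one reached later is a proper
    ancestor of the other, hence an ancestor of their common parent; this contradicts
    \<open>p_not_desc\<close>.\<close>
  have *: False if "(p ^^ i) s = t" "(p ^^ j) s = c" "i \<le> j" "t \<in> T" "c \<in> T" "t \<noteq> c" "p t = p c" "c \<noteq> r" for s i j t c
  proof -
    have "(p ^^ (j - i)) t = c" using that(1-3) by (metis funpow_add le_add_diff_inverse2 o_apply)
    moreover have "j - i \<noteq> 0" using calculation that(6) by (cases "j - i") auto
    ultimately obtain k where "(p ^^ Suc k) t = c" by (metis not0_implies_Suc)
    then have "(p ^^ k) (p c) = c" using that(7) by (simp add: funpow_swap1)
    then have "p c \<in> desc c" using rooted(4)[OF that(5)] by (auto simp: desc_def)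
    then show False using p_not_desc that by blast
  qed
  show ?thesis
  proof (rule ccontr)
    assume "\<not> ?thesis"
    then obtain s i j where "(p ^^ i) s = t" "(p ^^ j) s = c" by (auto simp: desc_def)
    then show False using *[of i s t j c] *[of j s c i t] assms by (cases "i \<le> j") auto
  qed
qed

lemma below_siblings:
  assumes t: "t \<in> T" "c \<in> T" "t \<noteq> c" "p t = p c" "t \<noteq> r" "c \<noteq> r"
  shows "below t \<inter> below c \<subseteq> X (p t)"
proof
  fix v assume "v \<in> below t \<inter> below c"
  then obtain s s' where s: "s \<in> desc t" "s' \<in> desc c" "v \<in> X s" "v \<in> X s'" by (auto simp: below_def)
  moreover have "s' \<notin> desc t" using desc_siblings[OF t] s by blast
  ultimately show "v \<in> X (p t)" using separation[OF t(1,5) s(1) _ _ s(3,4)] by (auto simp: desc_def)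
qed

lemma ch_props: "c \<in> ch q \<Longrightarrow> q \<in> T \<Longrightarrow> c \<in> T \<and> c \<noteq> r \<and> p c = q"
  using rooted(3) by (auto simp: children_def)

text \<open>The set-theoretic hypotheses of \<open>push_correct\<close> for merging \<open>t\<close>
  into a parent that has already absorbed the children in \<open>Q\<close>.\<close>

lemma
  assumes t: "t \<in> T" "t \<noteq> r" and Q: "Q \<subseteq> ch (p t)" "t \<notin> Q"
  defines "Ft \<equiv> forgotten t (ch t) \<union> (X t - X (p t))"
  shows push_forgotten: "forgotten (p t) (insert t Q) = forgotten (p t) Q \<union> Ft"
    and push_nb: "\<And>v u. v \<in> Ft \<Longrightarrow> adj v u \<Longrightarrow> u \<in> forgotten t (ch t) \<union> X t"
    and push_disj: "Ft \<inter> (forgotten (p t) Q \<union> X (p t)) = {}"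
    and forgotten_nb: "\<And>v u. v \<in> forgotten (p t) Q \<Longrightarrow> adj v u \<Longrightarrow> u \<in> forgotten (p t) Q \<union> X (p t)"
proof -
  \<comment> \<open>By \<open>below_parent\<close> no vertex forgotten at \<open>t\<close> reappears
    in the parent bag.\<close>
  have Ft: "Ft = below t - X (p t)"
    using below_parent[OF t] unfolding Ft_def below_rec[OF t(1)] by (auto simp: forgotten_def)
  show "forgotten (p t) (insert t Q) = forgotten (p t) Q \<union> Ft" by (auto simp: forgotten_def Ft)
  show "u \<in> forgotten t (ch t) \<union> X t" if "v \<in> Ft" "adj v u" for u v
    using below_nb[OF t _ that(2)] that(1) Ft below_rec[OF t(1)] by auto
  have pT: "p t \<in> T" using rooted(4) t by simp
  have Qp: "c \<in> T" "c \<noteq> r" "p c = p t" "c \<noteq> t" if "c \<in> Q" for c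
    using that ch_props[OF _ pT] Q by blast+
  show "Ft \<inter> (forgotten (p t) Q \<union> X (p t)) = {}"
  proof -
    have "below t \<inter> below c \<subseteq> X (p t)" if "c \<in> Q" for c
      by (rule below_siblings) (use Qp[OF that] t in simp_all)
    then show ?thesis unfolding Ft forgotten_def by blast
  qed
  show "u \<in> forgotten (p t) Q \<union> X (p t)" if v: "v \<in> forgotten (p t) Q" and uv: "adj v u" for u v
  proof -
    obtain c where c: "c \<in> Q" "v \<in> below c" "v \<notin> X (p t)" using v by (auto simp: forgotten_def)
    then have "u \<in> below c" using below_nb[of c v u] Qp[OF c(1)] uv by auto
    then show ?thesis using c by (auto simp: forgotten_def)
  qed
qed

lemma finite_forgotten: "finite (forgotten q Q)" "forgotten q Q \<subseteq> pverts G"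
proof -
  interpret sgraph "pverts G" adj by (rule sgraph)
  show "forgotten q Q \<subseteq> pverts G" using bags_V by (auto simp: forgotten_def below_def desc_def)
  then show "finite (forgotten q Q)" using finite_V finite_subset by blast
qed

lemma forgotten_root: "X r = {} \<Longrightarrow> forgotten r (ch r) = pverts G"
proof -
  assume r: "X r = {}"
  have "desc r = T" using rooted(5) by (auto simp: desc_def)
  then show ?thesis using below_rec[OF rooted(2)] r bags_V by (auto simp: below_def)
qed

end

section \<open>Running time of structured programs\<close>

definition halts :: "prog \<Rightarrow> nat \<Rightarrow> (memory \<Rightarrow> bool) \<Rightarrow> memory \<Rightarrow> bool" where
  "halts P t Q s \<longleftrightarrow> (\<exists>\<tau> s'. run P s \<tau> s' \<and> \<tau> \<le> t \<and> Q s')"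

lemma halts_mono: "halts P t Q s \<Longrightarrow> t \<le> t' \<Longrightarrow> (\<And>s'. Q s' \<Longrightarrow> Q' s') \<Longrightarrow> halts P t' Q' s"
  unfolding halts_def by (meson order_trans)

lemma halts_Seq:
  assumes "halts P t (\<lambda>s'. halts P' t' Q s') s"
  shows "halts (Seq P P') (t + t') Q s"
proof -
  obtain \<tau> s' where a: "run P s \<tau> s'" "\<tau> \<le> t" "halts P' t' Q s'" using assms by (auto simp: halts_def)
  then obtain \<tau>' s'' where "run P' s' \<tau>' s''" "\<tau>' \<le> t'" "Q s''" by (auto simp: halts_def)
  then show ?thesis using a run_Seq unfolding halts_def by (meson add_mono)
qed

lemma halts_Seq':
  assumes "halts P t R s" "\<And>s'. R s' \<Longrightarrow> halts P' t' Q s'"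
  shows "halts (Seq P P') (t + t') Q s"
  using assms by (intro halts_Seq) (auto elim: halts_mono)

lemma halts_IfPos:
  assumes "0 < eval e s \<Longrightarrow> halts P t Q s" "eval e s \<le> 0 \<Longrightarrow> halts P' t Q s"
  shows "halts (IfPos e P P') (cost e + 1 + t) Q s"
proof (cases "0 < eval e s")
  case True
  then obtain \<tau> s' where "run P s \<tau> s'" "\<tau> \<le> t" "Q s'" using assms by (auto simp: halts_def)
  then show ?thesis using run_If_pos[OF True, of P \<tau> s' P'] unfolding halts_def by (meson add_left_mono)
next
  case False
  then obtain \<tau> s' where a: "run P' s \<tau> s'" "\<tau> \<le> t" "Q s'" using assms by (auto simp: halts_def)
  have "run (IfPos e P P') s (cost e + 1 + \<tau>) s'" using False a by (intro run_If_nonpos) auto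
  then show ?thesis using a unfolding halts_def by (meson add_left_mono)
qed

text \<open>\<open>x\<close> bounds the number of remaining rounds; the extra 1 pays for the final
  failing test.\<close>

lemma halts_While:
  fixes I :: "nat \<Rightarrow> memory \<Rightarrow> bool"
  assumes body: "\<And>x s. I x s \<Longrightarrow> 0 < eval e s \<Longrightarrow> halts P t (\<lambda>s'. \<exists>y<x. I y s') s"
    and fin: "\<And>x s. I x s \<Longrightarrow> eval e s \<le> 0 \<Longrightarrow> Q s"
  shows "I x s \<Longrightarrow> halts (WhilePos e P) ((x + 1) * (t + cost e + 1)) Q s"
proof (induction x arbitrary: s rule: less_induct)
  case (less x)
  show ?case
  proof (cases "0 < eval e s")
    case True
    then obtain \<tau> s' y where a: "run P s \<tau> s'" "\<tau> \<le> t" "y < x" "I y s'"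
      using body[OF less.prems True] by (auto simp: halts_def)
    then obtain \<tau>' s'' where b: "run (WhilePos e P) s' \<tau>' s''" "\<tau>' \<le> (y + 1) * (t + cost e + 1)" "Q s''"
      using less.IH[OF a(3,4)] by (auto simp: halts_def)
    have "(y + 1) * (t + cost e + 1) \<le> x * (t + cost e + 1)" using a(3) by (intro mult_le_mono1) simp
    then have "cost e + 1 + \<tau> + \<tau>' \<le> (x + 1) * (t + cost e + 1)"
      using a(2) b(2) by (simp only: distrib_right mult_1)
    then show ?thesis using run_While_pos[OF True a(1) b(1)] b(3) unfolding halts_def by blast
  next
    case False
    have "run (WhilePos e P) s (cost e + 1) s" using False by (intro run_While_nonpos) simp
    moreover have "Q s" using fin less.prems False by simp
    ultimately show ?thesis unfolding halts_def by (intro exI conjI) auto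
  qed
qed

section \<open>Symbolic execution of loop-free code\<close>

primrec loopfree :: "prog \<Rightarrow> bool" where
  "loopfree Skip = True"
| "loopfree (Store a e) = True"
| "loopfree (Seq P Q) = (loopfree P \<and> loopfree Q)"
| "loopfree (IfPos e P Q) = (loopfree P \<and> loopfree Q)"
| "loopfree (WhilePos e P) = False"

primrec result :: "prog \<Rightarrow> memory \<Rightarrow> memory" where
  "result Skip s = s"
| "result (Store a e) s = s(eval a s := eval e s)"
| "result (Seq P Q) s = result Q (result P s)"
| "result (IfPos e P Q) s = (if 0 < eval e s then result P s else result Q s)"
| "result (WhilePos e P) s = s"

text \<open>Both branches of a conditional are charged, which makes the bound independent of the
  memory. The value for loops is a dummy.\<close>

primrec wcost :: "prog \<Rightarrow> nat" where
  "wcost Skip = 1"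
| "wcost (Store a e) = cost a + cost e + 1"
| "wcost (Seq P Q) = wcost P + wcost Q"
| "wcost (IfPos e P Q) = cost e + 1 + (wcost P + wcost Q)"
| "wcost (WhilePos e P) = 0"

lemma run_loopfree: "loopfree P \<Longrightarrow> \<exists>\<tau>. run P s \<tau> (result P s) \<and> \<tau> \<le> wcost P"
proof (induction P arbitrary: s)
  case (Seq P Q)
  obtain \<tau> \<tau>' where "run P s \<tau> (result P s)" "\<tau> \<le> wcost P"
    "run Q (result P s) \<tau>' (result Q (result P s))" "\<tau>' \<le> wcost Q"
    using Seq by fastforce
  then have "run (Seq P Q) s (\<tau> + \<tau>') (result (Seq P Q) s)" "\<tau> + \<tau>' \<le> wcost (Seq P Q)"
    by (auto intro: run_Seq)
  then show ?case by blast
next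
  case (IfPos e P Q)
  show ?case
  proof (cases "0 < eval e s")
    case True
    obtain \<tau> where a: "run P s \<tau> (result P s)" "\<tau> \<le> wcost P" using IfPos by fastforce
    then have "run (IfPos e P Q) s (cost e + 1 + \<tau>) (result P s)" using True by (intro run_If_pos)
    then show ?thesis using a True by (intro exI[of _ "cost e + 1 + \<tau>"]) auto
  next
    case False
    obtain \<tau> where a: "run Q s \<tau> (result Q s)" "\<tau> \<le> wcost Q" using IfPos by fastforce
    then have "run (IfPos e P Q) s (cost e + 1 + \<tau>) (result Q s)" using False by (intro run_If_nonpos) auto
    then show ?thesis using a False by (intro exI[of _ "cost e + 1 + \<tau>"]) auto
  qed
qed (auto intro: run_Skip run_Store)

lemma halts_loopfree: "loopfree P \<Longrightarrow> Q (result P s) \<Longrightarrow> halts P (wcost P) Q s"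
  using run_loopfree unfolding halts_def by blast

lemma halts_straight: "loopfree P \<Longrightarrow> wcost P \<le> t \<Longrightarrow> Q (result P s) \<Longrightarrow> halts P t Q s"
  using halts_loopfree halts_mono by blast

text \<open>
  The work space at negative addresses is divided into 16 interleaved banks; bank 0 holds the
  registers. \<open>adr\<close> is injective on all integer indices, and index \<open>x \<ge> 0\<close> avoids the input.
\<close>

definition adr :: "int \<Rightarrow> int \<Rightarrow> int" where
  "adr c x = - 1 - c - 16 * x"

lemma adr_eq_iff:
  "0 \<le> c \<Longrightarrow> c < 16 \<Longrightarrow> 0 \<le> d \<Longrightarrow> d < 16 \<Longrightarrow> adr c x = adr d y \<longleftrightarrow> c = d \<and> x = y"
proof -
  assume c: "0 \<le> c" "c < 16" "0 \<le> d" "d < 16"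
  have "c + 16 * x = d + 16 * y \<longleftrightarrow> c = d \<and> x = y"
  proof
    assume eq: "c + 16 * x = d + 16 * y"
    then have "(c + 16 * x) mod 16 = (d + 16 * y) mod 16" by simp
    then have "c = d" using c by simp
    then show "c = d \<and> x = y" using eq by simp
  qed auto
  then show ?thesis unfolding adr_def by linarith
qed

lemma adr_eq_same [simp]: "adr c x = adr c y \<longleftrightarrow> x = y"
  unfolding adr_def by auto

lemma adr_neg: "0 \<le> c \<Longrightarrow> 0 \<le> x \<Longrightarrow> adr c x < 0"
  unfolding adr_def by simp

definition dbl :: "expr \<Rightarrow> expr" where
  "dbl e = Add e e"

text \<open>Multiplication by 16 as four doublings. As \<open>dbl\<close> copies its argument, each
  indexed access costs about 16 times its index expression, which explains the large numbers in the
  time bounds below.\<close>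

definition A :: "int \<Rightarrow> expr \<Rightarrow> expr" where
  "A c e = Sub (Const (- 1 - c)) (dbl (dbl (dbl (dbl e))))"

definition M :: "int \<Rightarrow> expr \<Rightarrow> expr" where
  "M c e = Load (A c e)"

definition R :: "int \<Rightarrow> expr" where
  "R i = Load (Const (adr 0 i))"

abbreviation Set :: "int \<Rightarrow> expr \<Rightarrow> prog" where
  "Set i e \<equiv> Store (Const (adr 0 i)) e"

lemma eval_A [simp]: "eval (A c e) s = adr c (eval e s)"
  by (simp add: A_def dbl_def adr_def)

lemma eval_M [simp]: "eval (M c e) s = s (adr c (eval e s))"
  by (simp add: M_def)

lemma eval_R [simp]: "eval (R i) s = s (adr 0 i)"
  by (simp add: R_def)

text \<open>The bound \<open>e\<close> is evaluated again in every round, so an invariant of the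
  loop has to fix its value.\<close>

definition For :: "int \<Rightarrow> expr \<Rightarrow> prog \<Rightarrow> prog" where
  "For i e P = Seq (Set i (Const 0)) (WhilePos (Sub e (R i)) (Seq P (Set i (Add (R i) (Const 1)))))"

text \<open>The increment takes 6 and the test \<open>cost e + 4\<close>; the initialization takes 3
  and is charged to every round to obtain a single product.\<close>

definition for_cost :: "expr \<Rightarrow> nat" where
  "for_cost e = 13 + cost e"

text \<open>The body must establish \<open>I (Suc k)\<close> for the memory after the counter has
  been advanced; thus the invariant may mention the counter register.\<close>

lemma halts_For:
  assumes init: "I 0 (s(adr 0 i := 0))"
    and bound: "\<And>k s. k \<le> n \<Longrightarrow> I k s \<Longrightarrow> eval e s = int n \<and> s (adr 0 i) = int k"
    and body: "\<And>k s. k < n \<Longrightarrow> I k s \<Longrightarrow>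
      halts P t (\<lambda>s'. s' (adr 0 i) = int k \<and> I (Suc k) (s'(adr 0 i := int (Suc k)))) s"
    and fin: "\<And>s'. I n s' \<Longrightarrow> Q s'"
  shows "halts (For i e P) ((n + 1) * (t + for_cost e)) Q s"
proof -
  let ?c = "Sub e (R i)" and ?P = "Seq P (Set i (Add (R i) (Const 1)))"
  let ?J = "\<lambda>x s. \<exists>k\<le>n. x = n - k \<and> I k s"
  have b: "halts ?P (t + 6) (\<lambda>s'. \<exists>y<x. ?J y s') s" if J: "?J x s" and pos: "0 < eval ?c s" for x s
  proof -
    obtain k where k: "k \<le> n" "x = n - k" "I k s" using J by blast
    have "k < n" using bound[OF k(1,3)] pos by simp
    have "halts (Set i (Add (R i) (Const 1))) 6 (\<lambda>s'. \<exists>y<x. ?J y s') s'"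
      if "s' (adr 0 i) = int k \<and> I (Suc k) (s'(adr 0 i := int (Suc k)))" for s'
    proof (rule halts_mono[OF halts_loopfree])
      show "I (Suc k) (result (Set i (Add (R i) (Const 1))) s')" using that by (simp add: add.commute)
      show "\<exists>y<x. ?J y s''" if "I (Suc k) s''" for s''
        using that \<open>k < n\<close> k(2) by (intro exI[of _ "n - Suc k"] conjI exI[of _ "Suc k"]) auto
    qed (simp_all add: R_def)
    then show ?thesis using body[OF \<open>k < n\<close> k(3)] by (rule halts_Seq'[rotated])
  qed
  have f: "Q s" if J: "?J x s" and neg: "eval ?c s \<le> 0" for x s
  proof -
    obtain k where k: "k \<le> n" "I k s" using J by blast
    have "eval e s = int n" "s (adr 0 i) = int k" using bound[OF k] by blast+
    then have "k = n" using neg k(1) by simp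
    then show ?thesis using fin k(2) by blast
  qed
  have z: "?J n (s(adr 0 i := 0))" using init by (intro exI[of _ 0] conjI) simp_all
  have "halts (WhilePos ?c ?P) ((n + 1) * ((t + 6) + cost ?c + 1)) Q (s(adr 0 i := 0))"
    by (rule halts_While[where I = ?J, OF b f z])
  then have "halts (For i e P) (wcost (Set i (Const 0)) + (n + 1) * ((t + 6) + cost ?c + 1)) Q s"
    unfolding For_def by (intro halts_Seq halts_loopfree) simp_all
  then have "halts (For i e P) (3 + (n + 1) * ((t + 6) + cost ?c + 1)) Q s"
    by simp
  then show ?thesis
  proof (rule halts_mono)
    have "3 + (n + 1) * ((t + 6) + cost ?c + 1) \<le> (n + 1) * 3 + (n + 1) * ((t + 6) + cost ?c + 1)"
      by simp
    also have "\<dots> = (n + 1) * (t + for_cost e)"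
      by (simp add: for_cost_def R_def distrib_left[symmetric])
    finally show "3 + (n + 1) * ((t + 6) + cost ?c + 1) \<le> (n + 1) * (t + for_cost e)" .
  qed
qed

section \<open>Writable cells and frame conditions\<close>

definition W :: "int set \<Rightarrow> int set \<Rightarrow> int set" where
  "W rs bs = adr 0 ` rs \<union> {adr c x | c x. c \<in> bs \<and> 0 \<le> x}"

definition agree :: "int set \<Rightarrow> memory \<Rightarrow> memory \<Rightarrow> bool" where
  "agree S s s' \<longleftrightarrow> (\<forall>a. a \<notin> S \<longrightarrow> s' a = s a)"

lemma adr_in_W:
  "0 \<le> c \<Longrightarrow> c < 16 \<Longrightarrow> bs \<subseteq> {1..15} \<Longrightarrow> adr c x \<in> W rs bs \<longleftrightarrow> (c = 0 \<and> x \<in> rs) \<or> (c \<in> bs \<and> 0 \<le> x)"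
proof -
  assume c: "0 \<le> c" "c < 16" and bs: "bs \<subseteq> {1..15}"
  have eq: "adr c x = adr d y \<longleftrightarrow> c = d \<and> x = y" if "d \<in> insert 0 bs" for d y
    using that c bs by (intro adr_eq_iff) auto
  have "adr c x \<in> adr 0 ` rs \<longleftrightarrow> c = 0 \<and> x \<in> rs" using eq[of 0] by (simp add: image_iff)
  moreover have "adr c x \<in> {adr c x | c x. c \<in> bs \<and> 0 \<le> x} \<longleftrightarrow> c \<in> bs \<and> 0 \<le> x"
  proof
    assume "adr c x \<in> {adr c x | c x. c \<in> bs \<and> 0 \<le> x}"
    then obtain d y where d: "adr c x = adr d y" "d \<in> bs" "0 \<le> y" by (elim CollectE exE conjE)
    then have "c = d \<and> x = y" using eq[of d y] by simp
    then show "c \<in> bs \<and> 0 \<le> x" using d by simp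
  next
    assume "c \<in> bs \<and> 0 \<le> x"
    then show "adr c x \<in> {adr c x | c x. c \<in> bs \<and> 0 \<le> x}"
      by (intro CollectI exI[of _ c] exI[of _ x] conjI refl) simp_all
  qed
  ultimately show ?thesis unfolding W_def Un_iff by simp
qed

lemma agree_refl [simp]: "agree S s s"
  by (simp add: agree_def)

lemma agree_trans: "agree S s s' \<Longrightarrow> agree S s' s'' \<Longrightarrow> agree S s s''"
  by (simp add: agree_def)

lemma agree_mono: "agree S s s' \<Longrightarrow> S \<subseteq> S' \<Longrightarrow> agree S' s s'"
  by (auto simp: agree_def)

lemma W_mono: "rs \<subseteq> rs' \<Longrightarrow> bs \<subseteq> bs' \<Longrightarrow> W rs bs \<subseteq> W rs' bs'"
  by (auto simp: W_def)

lemma agree_upd: "agree S s s' \<Longrightarrow> a \<in> S \<Longrightarrow> agree S s (s'(a := v))"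
  by (simp add: agree_def)

lemma agree_adr:
  assumes "agree (W rs bs) s s'" "bs \<subseteq> {1..15}" "0 \<le> c" "c < 16" "c = 0 \<Longrightarrow> x \<notin> rs" "c \<notin> bs"
  shows "s' (adr c x) = s (adr c x)"
  using assms adr_in_W[of c bs x rs] by (auto simp: agree_def)

lemma agree_input:
  assumes "agree (W rs bs) s s'" "bs \<subseteq> {1..15}" "\<forall>i\<in>rs. 0 \<le> i" "0 \<le> a"
  shows "s' a = s a"
proof -
  have "a \<notin> W rs bs"
  proof
    assume "a \<in> W rs bs"
    then consider i where "i \<in> rs" "a = adr 0 i" | c x where "c \<in> bs" "0 \<le> x" "a = adr c x"
      by (auto simp: W_def)
    then show False
    proof cases
      case 1
      then show ?thesis using adr_neg[of 0 i] assms(3,4) by simp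
    next
      case 2
      then have "0 \<le> c" using assms(2) by auto
      then show ?thesis using 2 adr_neg[of c x] assms(4) by simp
    qed
  qed
  then show ?thesis using assms(1) by (simp add: agree_def)
qed

section \<open>Elimination of forgotten vertices\<close>

lemma cost_dbl [simp]: "cost (dbl e) = 2 * cost e + 1"
  by (simp add: dbl_def)

lemma cost_A [simp]: "cost (A c e) = 16 * cost e + 17"
  by (simp add: A_def)

lemma cost_M [simp]: "cost (M c e) = 16 * cost e + 18"
  by (simp add: M_def)

lemma cost_R [simp]: "cost (R i) = 2"
  by (simp add: R_def)

text \<open>
  Banks: 0 registers, 1 offset of the row of a vertex in the adjacency matrix, 2 adjacency matrix,
  3 input address of the bag of a node, 4 number of its labellings, 5 number of its unfinished
  children, 6 and 7 quotient and remainder modulo 5, 8 tables, 9 start of the table of a node,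
  10 stamp \<open>p + 1\<close> if the vertex is known to be in the bag of \<open>p\<close>, 11 and 12 labels of the vertices
  in the child and in the parent.

  Registers: 1 input address of the parents, 2 node, 3 its parent, 4 end of the tables, 5 and 15
  codes of the labellings of child and parent, 6 table entry of the child, 7 and 18 failure flags,
  8 remaining digits, 9 and 11 loop counters, 10 vertex, 12 its neighbor, 13 weight of the neighbors
  of an eliminated vertex, 14 last of these, 16 table entry of the parent, 17 code of the merged
  labelling, 19 index of the traversal, 20 local flag, 21 root.
\<close>

definition elem :: "int \<Rightarrow> int \<Rightarrow> expr" where
  "elem q i = Load (Add (Add (M 3 (R q)) (Const 1)) (R i))"

definition blen :: "int \<Rightarrow> expr" where
  "blen q = Load (M 3 (R q))"

text \<open>Quotient and remainder by 5 are looked up in banks 6 and 7, as the machine cannot divide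
  in unit time.\<close>

definition decode :: "int \<Rightarrow> int \<Rightarrow> int \<Rightarrow> prog" where
  "decode b q x = Seq (Set 8 (R x)) (For 9 (blen q)
     (Seq (Store (A b (elem q 9)) (M 7 (R 8))) (Set 8 (M 6 (R 8)))))"

text \<open>Marks every parent vertex as absent from the child; decoding the child labelling
  afterwards overwrites the shared vertices. The stamp makes membership in the parent bag a
  constant-time test.\<close>

definition set_pass :: prog where
  "set_pass = For 9 (blen 3)
     (Seq (Store (A 11 (elem 3 9)) (Const 5)) (Store (A 10 (elem 3 9)) (Add (R 3) (Const 1))))"

text \<open>One application of \<open>estep\<close>. Labels are integers, so a positive difference
  with 1 means an other vertex, and a positive label that fails this test is a center. Register 14
  holds the predecessor for the adjacency test.\<close>

definition elim_inner :: prog where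
  "elim_inner = Seq (Set 12 (elem 2 11))
     (IfPos (M 2 (Add (M 1 (R 10)) (R 12)))
       (IfPos (M 11 (R 12))
         (IfPos (Sub (M 11 (R 12)) (Const 1))
           (IfPos (Sub (M 11 (R 10)) (Const 1))
             (Seq (IfPos (Sub (M 11 (R 12)) (Const 3)) (Set 7 (Const 1)) Skip)
               (Seq (IfPos (M 2 (Add (M 1 (R 14)) (R 12))) Skip (Set 7 (Const 1)))
                 (Seq (Store (A 11 (R 12)) (Add (M 11 (R 12)) (Const 1)))
                   (Seq (Set 13 (Add (R 13) (Const 1))) (Set 14 (R 12))))))
             (Seq (IfPos (Sub (M 11 (R 12)) (Const 2)) (Set 7 (Const 1)) Skip)
               (Store (A 11 (R 12)) (Add (M 11 (R 12)) (Const 2)))))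
           (IfPos (Sub (M 11 (R 10)) (Const 1)) (Set 13 (Add (R 13) (Const 2))) (Set 7 (Const 1))))
         Skip)
       Skip)"

text \<open>Rejects weight 1 and weights above 2 at an other vertex. Every nonpositive weight
  passes, which is exact because weights are never negative.\<close>

definition elim_check :: prog where
  "elim_check = IfPos (Sub (M 11 (R 10)) (Const 1))
     (IfPos (R 13) (IfPos (Sub (R 13) (Const 2)) (Set 7 (Const 1))
       (IfPos (Sub (Const 2) (R 13)) (Set 7 (Const 1)) Skip)) Skip) Skip"

definition elim_vertex :: prog where
  "elim_vertex = IfPos (M 11 (R 10))
     (Seq (Seq (Set 13 (Sub (M 11 (R 10)) (Const 2))) (Set 14 (R 10)))
       (Seq (For 11 (blen 2) elim_inner) (Seq elim_check (Store (A 11 (R 10)) (Const 0)))))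
     (Seq (Store (A 11 (R 10)) (Const 0)) (Set 6 (Add (R 6) (Const 1))))"

context sgraph
begin

text \<open>
  Consecutive label-2 neighbors are tested for adjacency, with \<open>v\<close> itself as initial predecessor.
  That suffices, as a total weight of at most 2 admits only two of them.
\<close>

definition estep :: "nat \<Rightarrow> (nat \<Rightarrow> int) \<times> int \<times> nat \<times> bool \<Rightarrow> nat \<Rightarrow> (nat \<Rightarrow> int) \<times> int \<times> nat \<times> bool" where
  "estep v = (\<lambda>(lab, s, l, f) u.
     if adj v u \<and> 0 < lab u then
       if 2 \<le> lab u then
         if 2 \<le> lab v then (lab(u := lab u + 1), s + 1, u, f \<and> lab u \<le> 3 \<and> adj l u)
         else (lab(u := lab u + 2), s, l, f \<and> lab u \<le> 2)
       else if 2 \<le> lab v then (lab, s + 2, l, f)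
       else (lab, s, l, False)
     else (lab, s, l, f))"

text \<open>\<open>us\<close> lists the other neighbors in bag order; \<open>s\<close> and
  \<open>l\<close> matter only when \<open>v\<close> is other. As \<open>xs\<close> is distinct,
  each vertex still has its original label when its turn comes.\<close>

lemma estep_foldl:
  assumes "distinct xs" "0 < lab v"
    and "foldl (estep v) (lab, lab v - 2, v, f0) xs = (lab', s, l, f)"
  defines "us \<equiv> filter (\<lambda>u. adj v u \<and> 2 \<le> lab u) xs"
  shows "lab' = (\<lambda>u. if u \<in> live_nbs (set xs) lab v \<and> 2 \<le> lab u then lab u + wt (lab v) else lab u)
    \<and> (2 \<le> lab v \<longrightarrow> s = lab v - 2 + (\<Sum>u\<in>live_nbs (set xs) lab v. wt (lab u)) \<and> l = last (v # us) \<and>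
        (f \<longleftrightarrow> f0 \<and> (\<forall>u\<in>set us. lab u \<le> 3) \<and> successively adj (v # us)))
    \<and> (lab v = 1 \<longrightarrow> (f \<longleftrightarrow> f0 \<and> (\<forall>u\<in>live_nbs (set xs) lab v. lab u = 2)))"
  using assms(1,3) unfolding us_def
proof (induction xs arbitrary: lab' s l f rule: rev_induct)
  case Nil
  then show ?case by (auto simp: live_nbs_def)
next
  case (snoc u xs)
  obtain lab1 s1 l1 f1 where st: "foldl (estep v) (lab, lab v - 2, v, f0) xs = (lab1, s1, l1, f1)"
    by (cases "foldl (estep v) (lab, lab v - 2, v, f0) xs")
  let ?us = "filter (\<lambda>u. adj v u \<and> 2 \<le> lab u) xs"
  have d: "distinct xs" "u \<notin> set xs" using snoc.prems(1) by auto
  have e: "estep v (lab1, s1, l1, f1) u = (lab', s, l, f)" using snoc.prems(2) st by simp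
  note IH = snoc.IH[OF d(1) st]
  have lab1: "lab1 = (\<lambda>u. if u \<in> live_nbs (set xs) lab v \<and> 2 \<le> lab u then lab u + wt (lab v) else lab u)"
    using IH by blast
  have u1: "lab1 u = lab u" "lab1 v = lab v"
    using d(2) adj_irrefl by (simp_all add: lab1 live_nbs_def)
  have ns: "live_nbs (set (xs @ [u])) lab v =
    (if adj v u \<and> 0 < lab u then insert u (live_nbs (set xs) lab v) else live_nbs (set xs) lab v)"
    by (auto simp: live_nbs_def)
  have uns: "u \<notin> live_nbs (set xs) lab v" "finite (live_nbs (set xs) lab v)" using d(2) by (auto simp: live_nbs_def)
  have succ: "successively adj (v # ?us @ [u]) \<longleftrightarrow> successively adj (v # ?us) \<and> adj (last (v # ?us)) u"
    using successively_append_iff[of adj "v # ?us" "[u]"] by simp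
  consider "\<not> (adj v u \<and> 0 < lab u)" | "adj v u" "lab u = 1" | "adj v u" "2 \<le> lab u" by linarith
  then show ?case
  proof cases
    case 1
    have ns1: "live_nbs (set (xs @ [u])) lab v = live_nbs (set xs) lab v" using ns 1 by simp
    have us1: "filter (\<lambda>u. adj v u \<and> 2 \<le> lab u) (xs @ [u]) = ?us" using 1 by auto
    have eq: "lab' = lab1" "s = s1" "l = l1" "f = f1" using e 1 u1 by (auto simp: estep_def)
    show ?thesis unfolding ns1 us1 eq by (rule IH)
  next
    case 2
    have ns1: "live_nbs (set (xs @ [u])) lab v = insert u (live_nbs (set xs) lab v)" using ns 2 by simp
    have us1: "filter (\<lambda>u. adj v u \<and> 2 \<le> lab u) (xs @ [u]) = ?us" using 2 by auto
    have labeq: "lab' = lab1" using e 2 u1 by (simp add: estep_def split: if_splits)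
    have 1: "lab' = (\<lambda>w. if w \<in> live_nbs (set (xs @ [u])) lab v \<and> 2 \<le> lab w then lab w + wt (lab v) else lab w)"
      unfolding labeq lab1 ns1 using 2 by (auto simp: fun_eq_iff)
    show ?thesis
    proof (cases "2 \<le> lab v")
      case True
      then have "s = s1 + 2" "l = l1" "f = f1" using e 2 u1 by (auto simp: estep_def)
      moreover have "(\<Sum>u\<in>insert u (live_nbs (set xs) lab v). wt (lab u)) = 2 + (\<Sum>u\<in>live_nbs (set xs) lab v. wt (lab u))"
        using uns 2 by (simp add: wt_def)
      ultimately show ?thesis using 1 True IH unfolding ns1 us1 by auto
    next
      case False
      then have "f = False" "lab v = 1" using e 2 u1 assms(2) by (auto simp: estep_def)
      then show ?thesis using 1 False 2 unfolding ns1 by simp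
    qed
  next
    case 3
    have ns1: "live_nbs (set (xs @ [u])) lab v = insert u (live_nbs (set xs) lab v)" using ns 3 by simp
    have us1: "filter (\<lambda>u. adj v u \<and> 2 \<le> lab u) (xs @ [u]) = ?us @ [u]" using 3 by simp
    show ?thesis
    proof (cases "2 \<le> lab v")
      case True
      then have eq: "lab' = lab1(u := lab u + 1)" "s = s1 + 1" "l = u" "f \<longleftrightarrow> f1 \<and> lab u \<le> 3 \<and> adj l1 u"
        using e 3 u1 by (auto simp: estep_def)
      have 1: "lab' = (\<lambda>w. if w \<in> live_nbs (set (xs @ [u])) lab v \<and> 2 \<le> lab w then lab w + wt (lab v) else lab w)"
        unfolding eq(1) lab1 ns1 using 3 True by (auto simp: fun_eq_iff wt_def)
      have sum: "(\<Sum>u\<in>insert u (live_nbs (set xs) lab v). wt (lab u)) = 1 + (\<Sum>u\<in>live_nbs (set xs) lab v. wt (lab u))"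
        using uns 3 by (simp add: wt_def)
      have IH': "s1 = lab v - 2 + (\<Sum>u\<in>live_nbs (set xs) lab v. wt (lab u))" "l1 = last (v # ?us)"
        "f1 \<longleftrightarrow> f0 \<and> (\<forall>u\<in>set ?us. lab u \<le> 3) \<and> successively adj (v # ?us)" using IH True by blast+
      have "f \<longleftrightarrow> f0 \<and> (\<forall>u\<in>set (?us @ [u]). lab u \<le> 3) \<and> successively adj (v # ?us @ [u])"
        unfolding eq(4) IH'(3) succ IH'(2) by auto
      moreover have "s = lab v - 2 + (\<Sum>u\<in>insert u (live_nbs (set xs) lab v). wt (lab u))"
        unfolding sum eq(2) IH'(1) by simp
      moreover have "lab v \<noteq> 1" "l = last (v # ?us @ [u])" using True eq(3) by auto
      ultimately show ?thesis using 1 unfolding ns1 us1 by blast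
    next
      case False
      then have v1: "lab v = 1" using assms(2) by simp
      then have eq: "lab' = lab1(u := lab u + 2)" "f \<longleftrightarrow> f1 \<and> lab u \<le> 2"
        using e 3 u1 by (auto simp: estep_def)
      have "lab' = (\<lambda>w. if w \<in> live_nbs (set (xs @ [u])) lab v \<and> 2 \<le> lab w then lab w + wt (lab v) else lab w)"
        unfolding eq(1) lab1 ns1 using 3 v1 by (auto simp: fun_eq_iff wt_def)
      moreover have "f \<longleftrightarrow> f0 \<and> (\<forall>u\<in>insert u (live_nbs (set xs) lab v). lab u = 2)"
        unfolding eq(2) using IH v1 3 by auto
      ultimately show ?thesis using v1 unfolding ns1 by simp
    qed
  qed
qed

lemma estep_elim:
  assumes "distinct xs" "0 < lab v"
    and "foldl (estep v) (lab, lab v - 2, v, f0) xs = (lab', s, l, f)"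
  shows "lab'(v := 0) = elim_lab (set xs) lab v"
    "f \<and> (2 \<le> lab v \<longrightarrow> s = 0 \<or> s = 2) \<longleftrightarrow> f0 \<and> elim_ok (set xs) lab v"
    "lab' v = lab v"
proof -
  define us where "us = filter (\<lambda>u. adj v u \<and> 2 \<le> lab u) xs"
  note est = estep_foldl[OF assms, folded us_def]
  let ?ns = "live_nbs (set xs) lab v"
  have vns: "v \<notin> ?ns" using adj_irrefl by (simp add: live_nbs_def)
  show "lab'(v := 0) = elim_lab (set xs) lab v"
    using est assms(2) by (auto simp: elim_lab_def fun_eq_iff)
  show "lab' v = lab v" using est vns by simp
  have us: "set us = {u \<in> ?ns. 2 \<le> lab u}" "distinct us"
    using assms(1) by (auto simp: us_def live_nbs_def)
  show "f \<and> (2 \<le> lab v \<longrightarrow> s = 0 \<or> s = 2) \<longleftrightarrow> f0 \<and> elim_ok (set xs) lab v"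
  proof (cases "2 \<le> lab v")
    case False
    then have "lab v = 1" using assms(2) by simp
    then show ?thesis using est by (simp add: elim_ok_def)
  next
    case True
    have s: "s = lab v - 2 + (\<Sum>u\<in>?ns. wt (lab u))"
      and f: "f \<longleftrightarrow> f0 \<and> (\<forall>u\<in>set us. lab u \<le> 3) \<and> successively adj (v # us)"
      using est True by auto
    have le3: "(\<forall>u\<in>set us. lab u \<le> 3) \<longleftrightarrow> (\<forall>u\<in>?ns. lab u \<le> 3)" unfolding us by force
    have fin: "finite ?ns" by (simp add: live_nbs_def)
    have "int (length us) = (\<Sum>u\<in>set us. 1)" using us(2) by (simp add: distinct_card)
    also have "\<dots> \<le> (\<Sum>u\<in>set us. wt (lab u))" by (intro sum_mono) (simp add: wt_def)
    also have "\<dots> \<le> (\<Sum>u\<in>?ns. wt (lab u))" using fin unfolding us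
      by (intro sum_mono2) (auto simp: wt_def)
    finally have len: "int (length us) \<le> s" using s True by simp
    have adjv: "u \<in> set us \<Longrightarrow> adj v u" for u by (simp add: us_def)
    \<comment> \<open>By \<open>len\<close> a total weight of at most 2 admits at most two others.
      For these, consecutive adjacency is pairwise adjacency, and the initial \<open>v\<close> is
      adjacent to all of them by \<open>adjv\<close>.\<close>
    have pairs: "successively adj (v # us) \<longleftrightarrow>
      (\<forall>a\<in>?ns. \<forall>b\<in>?ns. 2 \<le> lab a \<and> 2 \<le> lab b \<and> a \<noteq> b \<longrightarrow> adj a b)" if "s = 0 \<or> s = 2"
    proof -
      have "(\<forall>a\<in>?ns. \<forall>b\<in>?ns. 2 \<le> lab a \<and> 2 \<le> lab b \<and> a \<noteq> b \<longrightarrow> adj a b) \<longleftrightarrow>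
        (\<forall>a\<in>set us. \<forall>b\<in>set us. a \<noteq> b \<longrightarrow> adj a b)" unfolding us by auto
      moreover have "length us \<le> 2" using len that by auto
      then consider "us = []" | a where "us = [a]" | a b where "us = [a, b]"
        by (cases us; cases "tl us"; cases "tl (tl us)") auto
      then have "successively adj (v # us) \<longleftrightarrow> (\<forall>a\<in>set us. \<forall>b\<in>set us. a \<noteq> b \<longrightarrow> adj a b)"
        by cases (use adjv us(2) adj_comm in auto)
      ultimately show ?thesis by simp
    qed
    show ?thesis unfolding f elim_ok_def using True le3 pairs s by auto
  qed
qed

end

text \<open>Abstracts from the list encoding: only the addresses of the parents (\<open>pb\<close>)
  and of the bags (\<open>off\<close>) matter. \<open>F\<close> bounds the sizes of the tables,
  \<open>B\<close> the sizes of the bags.\<close>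

locale instance_memory = sgraph "{0..<n}" adj for n :: nat and adj :: "nat \<Rightarrow> nat \<Rightarrow> bool" +
  fixes m :: nat and par :: "nat list" and bags :: "nat list list"
    and pb :: int and off :: "nat \<Rightarrow> int" and F B :: nat and inp :: memory
  assumes par: "t < m \<Longrightarrow> par ! t < m"
    and bag_V: "t < m \<Longrightarrow> set (bags ! t) \<subseteq> {0..<n}"
    and bag_distinct: "t < m \<Longrightarrow> distinct (bags ! t)"
    and pb: "0 \<le> pb" and off: "t < m \<Longrightarrow> 0 \<le> off t"
    and inp_m: "inp 3 = int m"
    and inp_par: "t < m \<Longrightarrow> inp (pb + int t) = int (par ! t)"
    and inp_len: "t < m \<Longrightarrow> inp (off t) = int (length (bags ! t))"
    and inp_bag: "t < m \<Longrightarrow> i < length (bags ! t) \<Longrightarrow> inp (off t + 1 + int i) = int (bags ! t ! i)"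
    and F: "t < m \<Longrightarrow> 5 ^ length (bags ! t) \<le> F"
    and B: "t < m \<Longrightarrow> length (bags ! t) \<le> B"
begin

text \<open>Everything that stays constant once the input has been read: the input itself, the
  address of the parents, node data, adjacency matrix and digit tables.\<close>

definition Env :: "memory \<Rightarrow> bool" where
  "Env s \<longleftrightarrow> (\<forall>a\<ge>0. s a = inp a) \<and> s (adr 0 1) = pb \<and>
     (\<forall>t<m. s (adr 3 (int t)) = off t \<and> s (adr 4 (int t)) = 5 ^ length (bags ! t)) \<and>
     (\<forall>u<n. s (adr 1 (int u)) = int u * int n) \<and>
     (\<forall>u<n. \<forall>v<n. s (adr 2 (int u * int n + int v)) = (if adj u v then 1 else 0)) \<and>
     (\<forall>c<F. s (adr 6 (int c)) = int (c div 5) \<and> s (adr 7 (int c)) = int (c mod 5))"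

lemma Env_agree:
  assumes "Env s" "agree (W rs bs) s s'" "bs \<subseteq> {5, 8, 9, 10, 11, 12}" "\<forall>i\<in>rs. 2 \<le> i"
  shows "Env s'"
proof -
  have bs: "bs \<subseteq> {1..15}" using assms(3) by auto
  have a: "s' a = s a" if "0 \<le> a" for a
    using agree_input[OF assms(2) bs _ that] assms(4) by force
  have b: "s' (adr c x) = s (adr c x)" if "c \<in> {1, 2, 3, 4, 6, 7}" for c x
    using that assms(3) by (intro agree_adr[OF assms(2) bs]) auto
  have "s' (adr 0 1) = s (adr 0 1)"
    using assms(3,4) by (intro agree_adr[OF assms(2) bs]) auto
  then show ?thesis using assms(1) a b unfolding Env_def by simp
qed

lemma Env_len: "Env s \<Longrightarrow> t < m \<Longrightarrow> s (adr 0 q) = int t \<Longrightarrow> eval (blen q) s = int (length (bags ! t))"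
  using off[of t] inp_len[of t] by (simp add: Env_def blen_def)

lemma Env_elem:
  "Env s \<Longrightarrow> t < m \<Longrightarrow> s (adr 0 q) = int t \<Longrightarrow> s (adr 0 i) = int j \<Longrightarrow> j < length (bags ! t) \<Longrightarrow>
    eval (elem q i) s = int (bags ! t ! j)"
  using off[of t] inp_bag[of t j] by (simp add: Env_def elem_def)

lemma Env_digits: "Env s \<Longrightarrow> c < F \<Longrightarrow> s (adr 6 (int c)) = int (c div 5) \<and> s (adr 7 (int c)) = int (c mod 5)"
  by (simp add: Env_def)

lemma Env_adj: "Env s \<Longrightarrow> u < n \<Longrightarrow> v < n \<Longrightarrow>
    s (adr 2 (s (adr 1 (int u)) + int v)) = (if adj u v then 1 else 0)"
  by (simp add: Env_def)

lemma halts_decode: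
  assumes env: "Env s" and t: "t < m" "s (adr 0 q) = int t" and c: "s (adr 0 x) = int c" "c < F"
    and q: "q \<notin> {8, 9}" and b: "b \<in> {11, 12}"
  shows "halts (decode b q x) ((B + 1) * 2000) (\<lambda>s'. agree (W {8, 9} {b}) s s' \<and>
    (\<forall>v. s' (adr b (int v)) = (if v \<in> set (bags ! t) then digit_label (bags ! t) c v else s (adr b (int v))))) s"
proof -
  let ?xs = "bags ! t"
  let ?W = "W {8, 9} {b}"
  define I where "I = (\<lambda>i s'. agree ?W s s' \<and> s' (adr 0 9) = int i \<and> s' (adr 0 8) = int (c div 5 ^ i) \<and>
    (\<forall>v. s' (adr b (int v)) = (if v \<in> set (take i ?xs) then digit_label ?xs c v else s (adr b (int v)))))"
  have b': "0 \<le> b" "b < 16" "b \<noteq> 0" "{b} \<subseteq> {1..15}" "b \<noteq> 7" "b \<noteq> 6" using b by auto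
  have envI: "Env s'" "s' (adr 0 q) = int t" if "I i s'" for i s'
  proof -
    have a: "agree ?W s s'" using that by (simp add: I_def)
    show "Env s'" using b by (intro Env_agree[OF env a]) auto
    show "s' (adr 0 q) = int t" using agree_adr[OF a b'(4), of 0 q] q b' t by simp
  qed
  have inW: "adr 0 8 \<in> ?W" "adr 0 9 \<in> ?W" "adr b (int v) \<in> ?W" for v
    using adr_in_W[of 0 "{b}"] adr_in_W[of b "{b}"] b' by simp_all
  have ne: "adr b z \<noteq> adr 0 y" "adr 0 y \<noteq> adr b z" for z y
    using adr_eq_iff[of b 0 z y] adr_eq_iff[of 0 b y z] b' by auto
  have ne7: "adr 7 y \<noteq> adr b z" "adr 6 y \<noteq> adr b z" for z y
    using adr_eq_iff[of 7 b y z] adr_eq_iff[of 6 b y z] b' by auto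
  have loop: "halts (For 9 (blen q) (Seq (Store (A b (elem q 9)) (M 7 (R 8))) (Set 8 (M 6 (R 8)))))
    ((length ?xs + 1) * (1500 + for_cost (blen q))) (I (length ?xs)) (s(adr 0 8 := int c))"
  proof (rule halts_For[where I = I])
    show "I 0 (s(adr 0 8 := int c, adr 0 9 := 0))"
      using inW ne by (simp add: I_def agree_upd adr_eq_iff)
    show "eval (blen q) s' = int (length ?xs) \<and> s' (adr 0 9) = int k" if "I k s'" for k s'
      using Env_len[OF envI(1)[OF that] t(1) envI(2)[OF that]] that by (simp add: I_def)
    show "halts (Seq (Store (A b (elem q 9)) (M 7 (R 8))) (Set 8 (M 6 (R 8)))) 1500
       (\<lambda>s'. s' (adr 0 9) = int k \<and> I (Suc k) (s'(adr 0 9 := int (Suc k)))) s'"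
      if k: "k < length ?xs" and I: "I k s'" for k s'
    proof (rule halts_straight)
      let ?r = "result (Seq (Store (A b (elem q 9)) (M 7 (R 8))) (Set 8 (M 6 (R 8)))) s'"
      have el: "eval (elem q 9) s' = int (?xs ! k)"
        using I by (intro Env_elem[OF envI(1)[OF I] t(1) envI(2)[OF I] _ k]) (simp add: I_def)
      have "c div 5 ^ k < F" using c(2) by (meson div_le_dividend le_less_trans)
      then have d: "s' (adr 6 (int (c div 5 ^ k))) = int (c div 5 ^ k div 5)"
        "s' (adr 7 (int (c div 5 ^ k))) = int (c div 5 ^ k mod 5)"
        using Env_digits[OF envI(1)[OF I]] by blast+
      have 8: "s' (adr 0 8) = int (c div 5 ^ k)" and 9: "s' (adr 0 9) = int k"
        and ag: "agree ?W s s'" using I by (auto simp: I_def)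
      have dS: "c div 5 ^ Suc k = c div 5 ^ k div 5" by (simp only: power_Suc2 div_mult2_eq)
      have r: "?r = s'(adr b (int (?xs ! k)) := int (c div 5 ^ k mod 5), adr 0 8 := int (c div 5 ^ Suc k))"
        unfolding dS using el d 8 ne ne7 by simp
      have tk: "take (Suc k) ?xs = take k ?xs @ [?xs ! k]" using k by (rule take_Suc_conv_app_nth)
      have dl: "digit_label ?xs c (?xs ! k) = int (c div 5 ^ k mod 5)"
        using digit_label_nth[OF bag_distinct[OF t(1)] k] .
      have "I (Suc k) (?r(adr 0 9 := int (Suc k)))"
        unfolding I_def r tk using ag inW ne I dl
        by (auto simp: agree_upd adr_eq_iff I_def)
      moreover have "?r (adr 0 9) = int k" unfolding r using 9 ne by (simp add: adr_eq_iff)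
      ultimately show "?r (adr 0 9) = int k \<and> I (Suc k) (?r(adr 0 9 := int (Suc k)))" by simp
    qed (simp_all add: elem_def)
  qed
  have "halts (decode b q x) (wcost (Set 8 (R x)) + (length ?xs + 1) * (1500 + for_cost (blen q))) (I (length ?xs)) s"
    unfolding decode_def by (intro halts_Seq halts_loopfree) (use loop c in simp_all)
  then show ?thesis
  proof (rule halts_mono)
    have "(length ?xs + 1) * (1500 + for_cost (blen q)) \<le> (B + 1) * (1500 + for_cost (blen q))"
      using B[OF t(1)] by (intro mult_le_mono1) simp
    then show "wcost (Set 8 (R x)) + (length ?xs + 1) * (1500 + for_cost (blen q)) \<le> (B + 1) * 2000"
      by (simp add: for_cost_def blen_def)
  qed (simp add: I_def)
qed

end

section \<open>Processing a pair of labellings\<close>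

definition elim_all :: prog where
  "elim_all = For 9 (blen 2)
     (Seq (Seq (Set 10 (elem 2 9)) (Seq (Set 20 (Const 1))
            (IfPos (Sub (M 10 (R 10)) (Add (R 3) (Const 1))) Skip
              (IfPos (Sub (Add (R 3) (Const 1)) (M 10 (R 10))) Skip (Set 20 (Const 0))))))
          (IfPos (R 20) elim_vertex Skip))"

text \<open>Horner's rule needs the most significant digit first, so the bag is traversed from its
  end: round \<open>i\<close> reads the cell at offset \<open>length - i\<close>, where offset 0 is
  the length field. The factor 5 is two doublings and an addition.\<close>

definition merge_step :: prog where
  "merge_step = Seq (Set 10 (Load (Sub (Add (M 3 (R 3)) (blen 3)) (R 9))))
     (Seq (Set 17 (Add (R 17) (dbl (dbl (R 17)))))
       (IfPos (Sub (M 11 (R 10)) (Const 4))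
         (Set 17 (Add (R 17) (M 12 (R 10))))
         (IfPos (Sub (M 11 (R 10)) (Const 1))
           (Seq (Set 17 (Sub (Add (R 17) (Add (M 11 (R 10)) (M 12 (R 10)))) (Const 2)))
             (IfPos (Sub (M 12 (R 10)) (Const 1))
               (IfPos (Sub (Add (M 11 (R 10)) (M 12 (R 10))) (Const 6)) (Set 18 (Const 1)) Skip)
               (Set 18 (Const 1))))
           (Seq (Set 17 (Add (R 17) (M 11 (R 10))))
             (IfPos (Sub (M 11 (R 10)) (M 12 (R 10))) (Set 18 (Const 1))
               (IfPos (Sub (M 12 (R 10)) (M 11 (R 10))) (Set 18 (Const 1)) Skip))))))"

definition merge :: prog where
  "merge = Seq (Seq (Set 17 (Const 0)) (Set 18 (Const 0))) (For 9 (blen 3) merge_step)"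

lemma for_cost_blen [simp]: "for_cost (blen q) = 64"
  by (simp add: for_cost_def blen_def)

context instance_memory
begin

lemma bag_nth: "t < m \<Longrightarrow> i < length (bags ! t) \<Longrightarrow> bags ! t ! i < n"
  using subsetD[OF bag_V[of t] nth_mem[of i "bags ! t"]] by simp

lemma halts_set_pass:
  assumes env: "Env s" and p: "p < m" "s (adr 0 3) = int p"
  shows "halts set_pass ((B + 1) * 3000) (\<lambda>s'. agree (W {9} {10, 11}) s s' \<and>
    (\<forall>v. s' (adr 11 (int v)) = (if v \<in> set (bags ! p) then 5 else s (adr 11 (int v)))) \<and>
    (\<forall>v. s' (adr 10 (int v)) = (if v \<in> set (bags ! p) then int p + 1 else s (adr 10 (int v))))) s"
proof -
  let ?xs = "bags ! p" and ?W = "W {9} {10, 11}"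
  define I where "I = (\<lambda>i s'. agree ?W s s' \<and> s' (adr 0 9) = int i \<and>
    (\<forall>v. s' (adr 11 (int v)) = (if v \<in> set (take i ?xs) then 5 else s (adr 11 (int v)))) \<and>
    (\<forall>v. s' (adr 10 (int v)) = (if v \<in> set (take i ?xs) then int p + 1 else s (adr 10 (int v)))))"
  have envI: "Env s'" "s' (adr 0 3) = int p" if "I i s'" for i s'
  proof -
    have a: "agree ?W s s'" using that by (simp add: I_def)
    show "Env s'" by (intro Env_agree[OF env a]) auto
    show "s' (adr 0 3) = int p" using agree_adr[OF a, of 0 3] p by simp
  qed
  have inW: "adr 0 9 \<in> ?W" "adr 10 (int v) \<in> ?W" "adr 11 (int v) \<in> ?W" for v
    by (simp_all add: adr_in_W)
  have "halts set_pass ((length ?xs + 1) * (2000 + for_cost (blen 3))) (I (length ?xs)) s"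
    unfolding set_pass_def
  proof (rule halts_For[where I = I])
    show "I 0 (s(adr 0 9 := 0))" using inW by (simp add: I_def agree_upd adr_eq_iff)
    show "eval (blen 3) s' = int (length ?xs) \<and> s' (adr 0 9) = int k" if "I k s'" for k s'
      using Env_len[OF envI(1)[OF that] p(1) envI(2)[OF that]] that by (simp add: I_def)
    fix k s' assume k: "k < length ?xs" and I: "I k s'"
    have el: "eval (elem 3 9) s' = int (?xs ! k)"
      using I by (intro Env_elem[OF envI(1)[OF I] p(1) envI(2)[OF I] _ k]) (simp add: I_def)
    have el2: "eval (elem 3 9) (s'(adr 11 (int (?xs ! k)) := 5)) = int (?xs ! k)"
    proof -
      have "agree ?W s (s'(adr 11 (int (?xs ! k)) := 5))" using I inW by (auto simp: I_def agree_upd)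
      then have "Env (s'(adr 11 (int (?xs ! k)) := 5))" by (intro Env_agree[OF env]) auto
      then show ?thesis using I envI(2)[OF I]
        by (intro Env_elem[OF _ p(1) _ _ k]) (simp_all add: I_def adr_eq_iff)
    qed
    have tk: "take (Suc k) ?xs = take k ?xs @ [?xs ! k]" using k by (rule take_Suc_conv_app_nth)
    show "halts (Seq (Store (A 11 (elem 3 9)) (Const 5)) (Store (A 10 (elem 3 9)) (Add (R 3) (Const 1)))) 2000
       (\<lambda>s'. s' (adr 0 9) = int k \<and> I (Suc k) (s'(adr 0 9 := int (Suc k)))) s'"
    proof (rule halts_straight)
      let ?r = "result (Seq (Store (A 11 (elem 3 9)) (Const 5)) (Store (A 10 (elem 3 9)) (Add (R 3) (Const 1)))) s'"
      have r: "?r = s'(adr 11 (int (?xs ! k)) := 5, adr 10 (int (?xs ! k)) := int p + 1)"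
        using el el2 envI(2)[OF I] by (simp add: adr_eq_iff)
      have "agree ?W s s'" using I by (simp add: I_def)
      then have "agree ?W s (?r(adr 0 9 := int (Suc k)))" unfolding r using inW by (simp add: agree_upd)
      then show "?r (adr 0 9) = int k \<and> I (Suc k) (?r(adr 0 9 := int (Suc k)))"
        unfolding I_def tk r using I by (auto simp: adr_eq_iff I_def)
    qed (simp_all add: elem_def)
  qed
  then show ?thesis
  proof (rule halts_mono)
    have "(length ?xs + 1) * (2000 + for_cost (blen 3)) \<le> (B + 1) * (2000 + for_cost (blen 3))"
      using B[OF p(1)] by (intro mult_le_mono1) simp
    then show "(length ?xs + 1) * (2000 + for_cost (blen 3)) \<le> (B + 1) * 3000" by simp
  qed (simp add: I_def)
qed

lemma halts_elim_inner:
  assumes env: "Env s" and t: "t < m" "s (adr 0 2) = int t"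
    and v: "v \<in> set (bags ! t)" "s (adr 0 10) = int v"
    and lab: "\<And>w. s (adr 11 (int w)) = lab w" and pos: "0 < lab v"
    and s13: "s (adr 0 13) = lab v - 2" and s14: "s (adr 0 14) = int v"
    and s7: "0 \<le> s (adr 0 7)"
  shows "halts (For 11 (blen 2) elim_inner) ((B + 1) * 10000) (\<lambda>s'. agree (W {7, 11, 12, 13, 14} {11}) s s' \<and>
    0 \<le> s' (adr 0 7) \<and> (\<exists>lab' x l f.
      foldl (estep v) (lab, lab v - 2, v, s (adr 0 7) = 0) (bags ! t) = (lab', x, l, f) \<and>
      (\<forall>w. s' (adr 11 (int w)) = lab' w) \<and> s' (adr 0 13) = x \<and> (s' (adr 0 7) = 0 \<longleftrightarrow> f))) s"
proof -
  let ?xs = "bags ! t" and ?W = "W {7, 11, 12, 13, 14} {11}"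
  let ?fold = "\<lambda>i. foldl (estep v) (lab, lab v - 2, v, s (adr 0 7) = 0) (take i ?xs)"
  define I where "I = (\<lambda>i s'. agree ?W s s' \<and> s' (adr 0 11) = int i \<and> 0 \<le> s' (adr 0 7) \<and>
    (\<exists>lab' x l f. ?fold i = (lab', x, l, f) \<and> (\<forall>w. s' (adr 11 (int w)) = lab' w) \<and>
      s' (adr 0 13) = x \<and> s' (adr 0 14) = int l \<and> l < n \<and> (s' (adr 0 7) = 0 \<longleftrightarrow> f)))"
  have vn: "v < n" using v(1) bag_V[OF t(1)] by auto
  have envI: "Env s'" "s' (adr 0 2) = int t" "s' (adr 0 10) = int v" if "I i s'" for i s'
  proof -
    have a: "agree ?W s s'" using that by (simp add: I_def)
    show "Env s'" by (intro Env_agree[OF env a]) auto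
    show "s' (adr 0 2) = int t" using agree_adr[OF a, of 0 2] t by simp
    show "s' (adr 0 10) = int v" using agree_adr[OF a, of 0 10] v by simp
  qed
  have inW: "adr 0 7 \<in> ?W" "adr 0 11 \<in> ?W" "adr 0 12 \<in> ?W" "adr 0 13 \<in> ?W" "adr 0 14 \<in> ?W" "adr 11 (int w) \<in> ?W" for w
    by (simp_all add: adr_in_W)
  have "halts (For 11 (blen 2) elim_inner) ((length ?xs + 1) * (9000 + for_cost (blen 2))) (I (length ?xs)) s"
  proof (rule halts_For[where I = I])
    show "I 0 (s(adr 0 11 := 0))" using inW lab s13 s14 vn s7
      by (simp add: I_def agree_upd adr_eq_iff)
    show "eval (blen 2) s' = int (length ?xs) \<and> s' (adr 0 11) = int k" if "I k s'" for k s'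
      using Env_len[OF envI(1)[OF that] t(1) envI(2)[OF that]] that by (simp add: I_def)
    fix k s' assume k: "k < length ?xs" and I: "I k s'"
    let ?u = "?xs ! k"
    have un: "?u < n" using bag_nth[OF t(1) k] .
    obtain lab1 x1 l1 f1 where fo: "?fold k = (lab1, x1, l1, f1)"
      and l1: "\<forall>w. s' (adr 11 (int w)) = lab1 w" and r13: "s' (adr 0 13) = x1"
      and r14: "s' (adr 0 14) = int l1" and ln: "l1 < n" and r7: "s' (adr 0 7) = 0 \<longleftrightarrow> f1"
      and r7': "0 \<le> s' (adr 0 7)" and ag: "agree ?W s s'" and r11: "s' (adr 0 11) = int k"
      using I unfolding I_def by (elim exE conjE)
    have el: "eval (elem 2 11) s' = int ?u"
      by (intro Env_elem[OF envI(1)[OF I] t(1) envI(2)[OF I] r11 k])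
    have ad: "s' (adr 2 (s' (adr 1 (int v)) + int ?u)) = (if adj v ?u then 1 else 0)"
      "s' (adr 2 (s' (adr 1 (int l1)) + int ?u)) = (if adj l1 ?u then 1 else 0)"
      using Env_adj[OF envI(1)[OF I]] vn un ln by simp_all
    have dist: "distinct (take k ?xs)" using bag_distinct[OF t(1)] by simp
    have v1: "lab1 v = lab v" using estep_elim(3)[OF dist pos fo] .
    have tk: "take (Suc k) ?xs = take k ?xs @ [?u]" using k by (rule take_Suc_conv_app_nth)
    obtain lab2 x2 l2 f2 where es: "estep v (lab1, x1, l1, f1) ?u = (lab2, x2, l2, f2)"
      by (cases "estep v (lab1, x1, l1, f1) ?u")
    have fo2: "?fold (Suc k) = (lab2, x2, l2, f2)" unfolding tk using fo es by simp
    show "halts elim_inner 9000 (\<lambda>s'. s' (adr 0 11) = int k \<and> I (Suc k) (s'(adr 0 11 := int (Suc k)))) s'"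
    proof (rule halts_straight)
      let ?r = "result elim_inner s'"
      note ev = el ad l1 r13 r14 envI(3)[OF I]
      have r: "agree ?W s ?r \<and> ?r (adr 0 11) = int k \<and> 0 \<le> ?r (adr 0 7) \<and>
        (\<forall>w. ?r (adr 11 (int w)) = lab2 w) \<and> ?r (adr 0 13) = x2 \<and> ?r (adr 0 14) = int l2 \<and> l2 < n \<and>
        (?r (adr 0 7) = 0 \<longleftrightarrow> f2)"
        using es ag inW ev r7 r7' r11 un ln v1 pos
        by (simp add: estep_def elim_inner_def adr_eq_iff agree_upd split: if_splits) auto
      then show "?r (adr 0 11) = int k \<and> I (Suc k) (?r(adr 0 11 := int (Suc k)))"
        unfolding I_def fo2 using inW by (auto simp: adr_eq_iff agree_upd)
    qed (simp_all add: elim_inner_def elem_def)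
  qed
  then show ?thesis
  proof (rule halts_mono)
    have "(length ?xs + 1) * (9000 + for_cost (blen 2)) \<le> (B + 1) * (9000 + for_cost (blen 2))"
      using B[OF t(1)] by (intro mult_le_mono1) simp
    then show "(length ?xs + 1) * (9000 + for_cost (blen 2)) \<le> (B + 1) * 10000" by simp
  qed (auto simp: I_def)
qed

end

context instance_memory
begin

lemma halts_elim_vertex:
  assumes env: "Env s" and t: "t < m" "s (adr 0 2) = int t"
    and v: "v \<in> set (bags ! t)" "s (adr 0 10) = int v"
    and lab: "\<And>w. s (adr 11 (int w)) = lab w" and s7: "0 \<le> s (adr 0 7)"
  shows "halts elim_vertex ((B + 1) * 12000) (\<lambda>s'. agree (W {6, 7, 11, 12, 13, 14} {11}) s s' \<and>
    (\<forall>w. s' (adr 11 (int w)) = elim_lab (set (bags ! t)) lab v w) \<and>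
    s' (adr 0 6) = s (adr 0 6) + (if lab v \<le> 0 then 1 else 0) \<and> 0 \<le> s' (adr 0 7) \<and>
    (s' (adr 0 7) = 0 \<longleftrightarrow> s (adr 0 7) = 0 \<and> elim_ok (set (bags ! t)) lab v)) s"
    (is "halts _ _ ?Q s")
proof -
  let ?W = "W {6, 7, 11, 12, 13, 14} {11}"
  have inW: "adr 0 6 \<in> ?W" "adr 0 7 \<in> ?W" "adr 0 13 \<in> ?W" "adr 0 14 \<in> ?W" "adr 11 (int w) \<in> ?W" for w
    by (simp_all add: adr_in_W)
  let ?P1 = "Seq (Set 13 (Sub (M 11 (R 10)) (Const 2))) (Set 14 (R 10))"
  let ?P3 = "Seq elim_check (Store (A 11 (R 10)) (Const 0))"
  let ?P4 = "Seq (Store (A 11 (R 10)) (Const 0)) (Set 6 (Add (R 6) (Const 1)))"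
  have alive: "halts (Seq ?P1 (Seq (For 11 (blen 2) elim_inner) ?P3)) (200 + ((B + 1) * 10000 + 500)) ?Q s"
    if pos: "0 < lab v"
  proof (rule halts_Seq[OF halts_straight])
    let ?s1 = "result ?P1 s"
    have s1: "?s1 = s(adr 0 13 := lab v - 2, adr 0 14 := int v)"
      using v lab by (simp add: adr_eq_iff)
    have ag1: "agree (W {13, 14} {}) s ?s1" unfolding s1 by (simp add: agree_upd adr_in_W)
    have ag1': "agree ?W s ?s1" unfolding s1 using inW by (simp add: agree_upd)
    have env1: "Env ?s1" by (intro Env_agree[OF env ag1]) auto
    show "halts (Seq (For 11 (blen 2) elim_inner) ?P3) ((B + 1) * 10000 + 500) ?Q ?s1"
    proof (rule halts_Seq'[OF halts_elim_inner[OF env1 t(1) _ v(1), where lab = lab]])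
      show "?s1 (adr 0 2) = int t" "?s1 (adr 0 10) = int v" "?s1 (adr 11 (int w)) = lab w"
        "0 < lab v" "?s1 (adr 0 13) = lab v - 2" "?s1 (adr 0 14) = int v" "0 \<le> ?s1 (adr 0 7)" for w
        unfolding s1 using t v lab pos s7 by (simp_all add: adr_eq_iff)
      fix s2 assume "agree (W {7, 11, 12, 13, 14} {11}) ?s1 s2 \<and>
        0 \<le> s2 (adr 0 7) \<and> (\<exists>lab' x l f.
        foldl (estep v) (lab, lab v - 2, v, ?s1 (adr 0 7) = 0) (bags ! t) = (lab', x, l, f) \<and>
        (\<forall>w. s2 (adr 11 (int w)) = lab' w) \<and> s2 (adr 0 13) = x \<and> (s2 (adr 0 7) = 0 \<longleftrightarrow> f))"
      then obtain lab' x l f where ag2: "agree (W {7, 11, 12, 13, 14} {11}) ?s1 s2" and s27: "0 \<le> s2 (adr 0 7)"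
        and fo: "foldl (estep v) (lab, lab v - 2, v, ?s1 (adr 0 7) = 0) (bags ! t) = (lab', x, l, f)"
        and lab': "\<forall>w. s2 (adr 11 (int w)) = lab' w" and x: "s2 (adr 0 13) = x" and f: "s2 (adr 0 7) = 0 \<longleftrightarrow> f"
        by (elim exE conjE)
      note el = estep_elim[OF bag_distinct[OF t(1)] pos fo]
      have "agree ?W ?s1 s2" by (rule agree_mono[OF ag2 W_mono]) auto
      then have ag: "agree ?W s s2" using ag1' agree_trans by blast
      have r10: "s2 (adr 0 10) = int v" "s2 (adr 0 6) = s (adr 0 6)"
        using agree_adr[OF ag2, of 0 10] agree_adr[OF ag2, of 0 6] v unfolding s1 by (simp_all add: adr_eq_iff)
      have el1: "lab' w = elim_lab (set (bags ! t)) lab v w" if "w \<noteq> v" for w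
        using fun_cong[OF el(1), of w] that by simp
      have el0: "elim_lab (set (bags ! t)) lab v v = 0" by (simp add: elim_lab_def)
      have f0: "?s1 (adr 0 7) = s (adr 0 7)" unfolding s1 by (simp add: adr_eq_iff)
      have ok: "f \<and> (2 \<le> lab v \<longrightarrow> x = 0 \<or> x = 2) \<longleftrightarrow> s (adr 0 7) = 0 \<and> elim_ok (set (bags ! t)) lab v"
        using el(2) unfolding f0 .
      \<comment> \<open>Needed because \<open>elim_check\<close> lets every nonpositive weight
        pass.\<close>
      have xn: "0 \<le> x" if "2 \<le> lab v"
      proof -
        have "x = lab v - 2 + (\<Sum>u\<in>live_nbs (set (bags ! t)) lab v. wt (lab u))"
          using estep_foldl[OF bag_distinct[OF t(1)] pos fo] that by blast
        moreover have "0 \<le> (\<Sum>u\<in>live_nbs (set (bags ! t)) lab v. wt (lab u))"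
          by (intro sum_nonneg) (simp add: wt_def)
        ultimately show ?thesis using that by simp
      qed
      show "halts ?P3 500 ?Q s2"
      proof (rule halts_straight)
        let ?r = "result ?P3 s2"
        have "agree ?W s ?r" using ag inW by (simp add: elim_check_def agree_upd r10)
        moreover have "?r (adr 11 (int w)) = elim_lab (set (bags ! t)) lab v w" for w
          using el0 el1 lab' by (simp add: elim_check_def r10 adr_eq_iff)
        moreover have "?r (adr 0 6) = s (adr 0 6)"
          by (simp add: elim_check_def r10 adr_eq_iff)
        moreover have "0 \<le> ?r (adr 0 7)" using s27
          by (simp add: elim_check_def r10 adr_eq_iff)
        moreover have "?r (adr 0 7) = 0 \<longleftrightarrow> f \<and> (2 \<le> lab v \<longrightarrow> x = 0 \<or> x = 2)"
          using lab' el(3) x f xn by (auto simp: elim_check_def r10 adr_eq_iff)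
        ultimately show "?Q ?r" using ok pos by simp
      qed (simp_all add: elim_check_def)
    qed
  qed simp_all
  have dead: "halts ?P4 (200 + ((B + 1) * 10000 + 500)) ?Q s" if np: "\<not> 0 < lab v"
  proof (rule halts_straight)
    let ?r = "result ?P4 s"
    have r: "?r = s(adr 11 (int v) := 0, adr 0 6 := s (adr 0 6) + 1)"
      using v by (simp add: adr_eq_iff)
    have "elim_ok (set (bags ! t)) lab v" using np by (simp add: elim_ok_def)
    moreover have "?r (adr 11 (int w)) = elim_lab (set (bags ! t)) lab v w" for w
      unfolding r using lab np by (simp add: elim_lab_def adr_eq_iff)
    moreover have "agree ?W s ?r" unfolding r using inW by (simp add: agree_upd)
    ultimately show "?Q ?r" using np s7 unfolding r by (simp add: adr_eq_iff)
  qed simp_all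
  have "halts elim_vertex (cost (M 11 (R 10)) + 1 + (200 + ((B + 1) * 10000 + 500))) ?Q s"
    unfolding elim_vertex_def
    by (rule halts_IfPos) (use alive dead lab v in simp_all)
  then show ?thesis by (rule halts_mono) simp_all
qed

text \<open>Every eliminated vertex scans the whole child bag, whence the square of
  \<open>B + 1\<close>. This happens once per child labelling and not once per pair.\<close>

lemma halts_elim_all:
  assumes env: "Env s" and t: "t < m" "s (adr 0 2) = int t" and p: "p < m" "s (adr 0 3) = int p"
    and stamp: "\<And>v. v \<in> set (bags ! t) \<Longrightarrow> s (adr 10 (int v)) = int p + 1 \<longleftrightarrow> v \<in> set (bags ! p)"
    and lab: "\<And>w. s (adr 11 (int w)) = lab w" and s7: "s (adr 0 7) = 0"
  shows "halts elim_all ((B + 1) * ((B + 1) * 14000)) (\<lambda>s'.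
    agree (W {6, 7, 9, 10, 11, 12, 13, 14, 20} {11}) s s' \<and> 0 \<le> s' (adr 0 7) \<and>
    (\<exists>lab' c f. elim_seq (set (bags ! t)) (filter (\<lambda>v. v \<notin> set (bags ! p)) (bags ! t)) lab = (lab', c, f) \<and>
      (\<forall>w. s' (adr 11 (int w)) = lab' w) \<and> s' (adr 0 6) = s (adr 0 6) + int c \<and>
      (s' (adr 0 7) = 0 \<longleftrightarrow> f))) s"
proof -
  let ?xs = "bags ! t" and ?W = "W {6, 7, 9, 10, 11, 12, 13, 14, 20} {11}"
  let ?seq = "\<lambda>i. elim_seq (set ?xs) (filter (\<lambda>v. v \<notin> set (bags ! p)) (take i ?xs)) lab"
  define I where "I = (\<lambda>i s'. agree ?W s s' \<and> s' (adr 0 9) = int i \<and> 0 \<le> s' (adr 0 7) \<and>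
    (\<exists>lab' c f. ?seq i = (lab', c, f) \<and> (\<forall>w. s' (adr 11 (int w)) = lab' w) \<and>
      s' (adr 0 6) = s (adr 0 6) + int c \<and> (s' (adr 0 7) = 0 \<longleftrightarrow> f)))"
  have envI: "Env s'" "s' (adr 0 2) = int t" "s' (adr 0 3) = int p" "s' (adr 10 x) = s (adr 10 x)"
    if a: "agree ?W s s'" for s' x
  proof -
    show "Env s'" by (intro Env_agree[OF env a]) auto
    show "s' (adr 0 2) = int t" using agree_adr[OF a, of 0 2] t by simp
    show "s' (adr 0 3) = int p" using agree_adr[OF a, of 0 3] p by simp
    show "s' (adr 10 x) = s (adr 10 x)" using agree_adr[OF a, of 10 x] by simp
  qed
  have inW: "adr 0 9 \<in> ?W" "adr 0 10 \<in> ?W" "adr 0 20 \<in> ?W" by (simp_all add: adr_in_W)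
  let ?P1 = "Seq (Set 10 (elem 2 9)) (Seq (Set 20 (Const 1))
            (IfPos (Sub (M 10 (R 10)) (Add (R 3) (Const 1))) Skip
              (IfPos (Sub (Add (R 3) (Const 1)) (M 10 (R 10))) Skip (Set 20 (Const 0)))))"
  have "halts elim_all ((length ?xs + 1) * ((B + 1) * 13900 + for_cost (blen 2))) (I (length ?xs)) s"
    unfolding elim_all_def
  proof (rule halts_For[where I = I])
    show "I 0 (s(adr 0 9 := 0))" using inW lab s7 by (simp add: I_def agree_upd adr_eq_iff)
    show "eval (blen 2) s' = int (length ?xs) \<and> s' (adr 0 9) = int k" if "I k s'" for k s'
    proof -
      have a: "agree ?W s s'" using that by (simp add: I_def)
      show ?thesis using Env_len[OF envI(1)[OF a] t(1) envI(2)[OF a]] that by (simp add: I_def)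
    qed
    fix k s' assume k: "k < length ?xs" and I: "I k s'"
    let ?v = "?xs ! k"
    obtain lab1 c1 f1 where sq: "?seq k = (lab1, c1, f1)"
      and l1: "\<forall>w. s' (adr 11 (int w)) = lab1 w" and r6: "s' (adr 0 6) = s (adr 0 6) + int c1"
      and r7: "s' (adr 0 7) = 0 \<longleftrightarrow> f1"
      and r7': "0 \<le> s' (adr 0 7)" and ag: "agree ?W s s'" and r9: "s' (adr 0 9) = int k"
      using I unfolding I_def by (elim exE conjE)
    have el: "eval (elem 2 9) s' = int ?v"
      by (intro Env_elem[OF envI(1)[OF ag] t(1) envI(2)[OF ag] r9 k])
    have tk: "take (Suc k) ?xs = take k ?xs @ [?v]" using k by (rule take_Suc_conv_app_nth)
    have vin: "?v \<in> set ?xs" using k by simp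
    let ?s1 = "result ?P1 s'"
    have s1: "?s1 = s'(adr 0 10 := int ?v, adr 0 20 := (if ?v \<in> set (bags ! p) then 0 else 1))"
      using el envI(3)[OF ag] envI(4)[OF ag, of "int ?v"] stamp[OF vin] by (auto simp: adr_eq_iff)
    have ag1: "agree ?W s ?s1" unfolding s1 using ag inW by (simp add: agree_upd)
    let ?Q = "\<lambda>s'. s' (adr 0 9) = int k \<and> I (Suc k) (s'(adr 0 9 := int (Suc k)))"
    show "halts (Seq ?P1 (IfPos (R 20) elim_vertex Skip)) ((B + 1) * 13900) ?Q s'"
    proof (rule halts_mono[OF halts_Seq[OF halts_straight]])
      show "halts (IfPos (R 20) elim_vertex Skip) (cost (R 20) + 1 + (B + 1) * 12000) ?Q ?s1"
      proof (rule halts_IfPos)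
        assume "0 < eval (R 20) ?s1"
        then have vp: "?v \<notin> set (bags ! p)" unfolding s1 by (simp split: if_splits)
        obtain lab2 c2 f2 where sq2: "?seq (Suc k) = (lab2, c2, f2)" by (cases "?seq (Suc k)")
        then have new: "lab2 = elim_lab (set ?xs) lab1 ?v" "c2 = c1 + (if lab1 ?v \<le> 0 then 1 else 0)"
          "f2 \<longleftrightarrow> f1 \<and> elim_ok (set ?xs) lab1 ?v"
          using vp sq unfolding tk by (simp_all add: elim_seq_snoc)
        have pre: "?s1 (adr 0 10) = int ?v" "\<And>w. ?s1 (adr 11 (int w)) = lab1 w" "0 \<le> ?s1 (adr 0 7)"
          "?s1 (adr 0 6) = s (adr 0 6) + int c1" "?s1 (adr 0 7) = s' (adr 0 7)" "?s1 (adr 0 9) = int k"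
          unfolding s1 using l1 r7' r6 r9 by (simp_all add: adr_eq_iff)
        show "halts elim_vertex ((B + 1) * 12000) ?Q ?s1"
        proof (rule halts_mono[OF halts_elim_vertex[OF envI(1)[OF ag1] t(1) envI(2)[OF ag1] vin pre(1-3)]])
          fix s2 assume s2: "agree (W {6, 7, 11, 12, 13, 14} {11}) ?s1 s2 \<and>
            (\<forall>w. s2 (adr 11 (int w)) = elim_lab (set ?xs) lab1 ?v w) \<and>
            s2 (adr 0 6) = ?s1 (adr 0 6) + (if lab1 ?v \<le> 0 then 1 else 0) \<and> 0 \<le> s2 (adr 0 7) \<and>
            (s2 (adr 0 7) = 0 \<longleftrightarrow> ?s1 (adr 0 7) = 0 \<and> elim_ok (set ?xs) lab1 ?v)"
          then have a2: "agree (W {6, 7, 11, 12, 13, 14} {11}) ?s1 s2" by blast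
          have "agree ?W ?s1 s2" by (rule agree_mono[OF a2 W_mono]) auto
          then have "agree ?W s s2" using ag1 agree_trans by blast
          moreover have "s2 (adr 0 9) = int k" using agree_adr[OF a2, of 0 9] pre(6) by simp
          ultimately show "?Q s2" unfolding I_def sq2 using s2 new r7 pre(4,5) inW
            by (auto simp: adr_eq_iff agree_upd)
        qed simp
      next
        assume "eval (R 20) ?s1 \<le> 0"
        then have vp: "?v \<in> set (bags ! p)" unfolding s1 by (simp split: if_splits)
        then have sq2: "?seq (Suc k) = (lab1, c1, f1)" using sq unfolding tk by simp
        show "halts Skip ((B + 1) * 12000) ?Q ?s1"
        proof (rule halts_straight)
          have "agree ?W s (?s1(adr 0 9 := int (Suc k)))" using ag1 inW by (simp add: agree_upd)
          then show "?Q (result Skip ?s1)" unfolding I_def sq2 s1 using l1 r6 r7 r7' r9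
            by (simp add: adr_eq_iff)
        qed simp_all
      qed
      show "wcost ?P1 \<le> 1800" by (simp add: elem_def)
      show "1800 + (cost (R 20) + 1 + (B + 1) * 12000) \<le> (B + 1) * 13900" by simp
    qed simp_all
  qed
  then show ?thesis
  proof (rule halts_mono)
    have "(length ?xs + 1) * ((B + 1) * 13900 + for_cost (blen 2)) \<le> (B + 1) * ((B + 1) * 13900 + for_cost (blen 2))"
      using B[OF t(1)] by (intro mult_le_mono1) simp
    also have "\<dots> \<le> (B + 1) * ((B + 1) * 14000)" by (intro mult_le_mono2) simp
    finally show "(length ?xs + 1) * ((B + 1) * 13900 + for_cost (blen 2)) \<le> (B + 1) * ((B + 1) * 14000)" .
  qed (simp add: I_def)
qed

lemma halts_merge:
  assumes env: "Env s" and p: "p < m" "s (adr 0 3) = int p"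
    and la: "\<And>w. s (adr 11 (int w)) = la w" and lb: "\<And>w. s (adr 12 (int w)) = lb w"
  shows "halts merge ((B + 1) * 6000) (\<lambda>s'. agree (W {9, 10, 17, 18} {}) s s' \<and>
    s' (adr 0 17) = code (map (\<lambda>u. merge_label (la u) (lb u)) (bags ! p)) \<and> 0 \<le> s' (adr 0 18) \<and>
    (s' (adr 0 18) = 0 \<longleftrightarrow> (\<forall>u\<in>set (bags ! p). merge_ok (la u) (lb u)))) s"
proof -
  let ?xs = "bags ! p" and ?W = "W {9, 10, 17, 18} {}"
  let ?n = "length ?xs"
  define I where "I = (\<lambda>i s'. agree ?W s s' \<and> s' (adr 0 9) = int i \<and> 0 \<le> s' (adr 0 18) \<and>
    s' (adr 0 17) = code (map (\<lambda>u. merge_label (la u) (lb u)) (drop (?n - i) ?xs)) \<and>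
    (s' (adr 0 18) = 0 \<longleftrightarrow> (\<forall>u\<in>set (drop (?n - i) ?xs). merge_ok (la u) (lb u))))"
  have envI: "Env s'" "s' (adr 0 3) = int p" "s' (adr 11 (int w)) = la w" "s' (adr 12 (int w)) = lb w"
    if a: "agree ?W s s'" for s' w
  proof -
    show "Env s'" by (intro Env_agree[OF env a]) auto
    show "s' (adr 0 3) = int p" using agree_adr[OF a, of 0 3] p by simp
    show "s' (adr 11 (int w)) = la w" using agree_adr[OF a, of 11 "int w"] la by simp
    show "s' (adr 12 (int w)) = lb w" using agree_adr[OF a, of 12 "int w"] lb by simp
  qed
  have inW: "adr 0 9 \<in> ?W" "adr 0 10 \<in> ?W" "adr 0 17 \<in> ?W" "adr 0 18 \<in> ?W" by (simp_all add: adr_in_W)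
  let ?s0 = "s(adr 0 17 := 0, adr 0 18 := 0)"
  have "halts (For 9 (blen 3) merge_step) ((?n + 1) * (5000 + for_cost (blen 3))) (I ?n) ?s0"
  proof (rule halts_For[where I = I])
    show "I 0 (?s0(adr 0 9 := 0))" using inW by (simp add: I_def agree_upd adr_eq_iff)
    show "eval (blen 3) s' = int ?n \<and> s' (adr 0 9) = int k" if "I k s'" for k s'
    proof -
      have a: "agree ?W s s'" using that by (simp add: I_def)
      show ?thesis using Env_len[OF envI(1)[OF a] p(1) envI(2)[OF a]] that by (simp add: I_def)
    qed
    fix k s' assume k: "k < ?n" and I: "I k s'"
    have ag: "agree ?W s s'" and r9: "s' (adr 0 9) = int k" and r18: "0 \<le> s' (adr 0 18)"
      and r17: "s' (adr 0 17) = code (map (\<lambda>u. merge_label (la u) (lb u)) (drop (?n - k) ?xs))"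
      and f: "s' (adr 0 18) = 0 \<longleftrightarrow> (\<forall>u\<in>set (drop (?n - k) ?xs). merge_ok (la u) (lb u))"
      using I by (auto simp: I_def)
    let ?j = "?n - Suc k"
    let ?u = "?xs ! ?j"
    have j: "?j < ?n" "Suc ?j = ?n - k" using k by auto
    have dr: "drop ?j ?xs = ?u # drop (?n - k) ?xs"
      using Cons_nth_drop_Suc[OF j(1)] j(2) by simp
    have el: "eval (Load (Sub (Add (M 3 (R 3)) (blen 3)) (R 9))) s' = int ?u"
    proof -
      have e: "off p + 1 + int ?j = off p + int ?n - int k" using k by (simp add: of_nat_diff)
      have "inp (off p + int ?n - int k) = int ?u" using inp_bag[OF p(1) j(1)] unfolding e .
      moreover have "s' (adr 3 (int p)) = off p" using envI(1)[OF ag] p by (simp add: Env_def)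
      moreover have "eval (blen 3) s' = int ?n" using Env_len[OF envI(1)[OF ag] p(1) envI(2)[OF ag]] .
      moreover have "s' (off p + int ?n - int k) = inp (off p + int ?n - int k)"
        using envI(1)[OF ag] off[OF p(1)] k by (simp add: Env_def)
      ultimately show ?thesis using envI(2)[OF ag] r9 by simp
    qed
    show "halts merge_step 5000 (\<lambda>s'. s' (adr 0 9) = int k \<and> I (Suc k) (s'(adr 0 9 := int (Suc k)))) s'"
    proof (rule halts_straight)
      let ?r = "result merge_step s'"
      note ev = el envI(3)[OF ag, of ?u] envI(4)[OF ag, of ?u]
      have r: "agree ?W s ?r \<and> ?r (adr 0 9) = int k \<and> 0 \<le> ?r (adr 0 18) \<and>
        ?r (adr 0 17) = merge_label (la ?u) (lb ?u) + 5 * s' (adr 0 17) \<and>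
        (?r (adr 0 18) = 0 \<longleftrightarrow> s' (adr 0 18) = 0 \<and> merge_ok (la ?u) (lb ?u))"
        using ag inW ev r9 r18
        by (auto simp: merge_step_def merge_label_def merge_ok_def adr_eq_iff agree_upd dbl_def simp del: eval.simps(2))
      have "I (Suc k) (?r(adr 0 9 := int (Suc k)))"
        unfolding I_def dr using r r17 f inW by (simp add: adr_eq_iff agree_upd) auto
      then show "?r (adr 0 9) = int k \<and> I (Suc k) (?r(adr 0 9 := int (Suc k)))" using r by simp
    qed (simp_all add: merge_step_def blen_def)
  qed
  then have "halts merge (wcost (Seq (Set 17 (Const 0)) (Set 18 (Const 0))) + (?n + 1) * (5000 + for_cost (blen 3))) (I ?n) s"
    unfolding merge_def by (intro halts_Seq halts_loopfree) simp_all
  then show ?thesis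
  proof (rule halts_mono)
    have "(?n + 1) * (5000 + for_cost (blen 3)) \<le> (B + 1) * (5000 + for_cost (blen 3))"
      using B[OF p(1)] by (intro mult_le_mono1) simp
    then show "wcost (Seq (Set 17 (Const 0)) (Set 18 (Const 0))) + (?n + 1) * (5000 + for_cost (blen 3)) \<le> (B + 1) * 6000"
      by simp
  qed (simp add: I_def)
qed

end

section \<open>Moving a table from a child to its parent\<close>

text \<open>Register 6 is the child entry plus the deletions of the elimination; the
  \<open>- 1\<close> compensates for the shift present in both entries. An empty cell is overwritten
  unconditionally.\<close>

definition table_min :: prog where
  "table_min = Seq (Set 16 (Sub (Add (R 6) (R 16)) (Const 1)))
     (IfPos (M 8 (Add (R 4) (R 17)))
       (IfPos (Sub (M 8 (Add (R 4) (R 17))) (R 16)) (Store (A 8 (Add (R 4) (R 17))) (R 16)) Skip)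
       (Store (A 8 (Add (R 4) (R 17))) (R 16)))"

definition parent_body :: prog where
  "parent_body = Seq (Set 16 (M 8 (Add (M 9 (R 3)) (R 15))))
     (IfPos (R 16) (Seq (decode 12 3 15) (Seq merge (IfPos (R 18) Skip table_min))) Skip)"

definition child_body :: prog where
  "child_body = Seq (Seq (Set 6 (M 8 (Add (M 9 (R 2)) (R 5)))) (Set 7 (Const 0)))
     (IfPos (R 6) (Seq set_pass (Seq (decode 11 2 5) (Seq elim_all
       (IfPos (R 7) Skip (For 15 (M 4 (R 3)) parent_body))))) Skip)"

text \<open>The new table goes to the free end of bank 8 and not over the parent table, since the
  old parent entries are read again for each child labelling. The fresh cells are 0, the minimum
  over no costs.\<close>

definition push :: prog where
  "push = Seq (Set 3 (Load (Add (R 1) (R 2)))) (Seq (For 5 (M 4 (R 2)) child_body)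
     (Seq (Store (A 9 (R 3)) (R 4)) (Set 4 (Add (R 4) (M 4 (R 3))))))"

lemma for_cost_M [simp]: "for_cost (M 4 (R q)) = 63"
  by (simp add: for_cost_def)

lemma minval_nonneg: "minval x S \<Longrightarrow> 0 \<le> x"
  unfolding minval_def by (elim conjE disjE) (simp, rule less_imp_le, blast)

lemma merge_label_range: "merge_ok a b \<Longrightarrow> b \<in> {0..4} \<Longrightarrow> merge_label a b \<in> {0..4}"
  by (auto simp: merge_ok_def merge_label_def)

lemma merge_code_range:
  assumes "\<forall>u\<in>set xp. merge_ok (lab u) (digit_label xp cb u)"
  shows "0 \<le> code (map (\<lambda>u. merge_label (lab u) (digit_label xp cb u)) xp)"
    "code (map (\<lambda>u. merge_label (lab u) (digit_label xp cb u)) xp) < 5 ^ length xp"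
proof -
  have *: "merge_label (lab u) (digit_label xp cb u) \<in> {0..4}" if "u \<in> set xp" for u
    using assms that digit_label_range[OF that] by (intro merge_label_range) auto
  show "0 \<le> code (map (\<lambda>u. merge_label (lab u) (digit_label xp cb u)) xp)"
    "code (map (\<lambda>u. merge_label (lab u) (digit_label xp cb u)) xp) < 5 ^ length xp"
    using code_map_range[of xp "\<lambda>u. merge_label (lab u) (digit_label xp cb u)", OF *] by simp_all
qed

text \<open>A part of \<open>all_push_costs\<close> for loop invariants: the child labelling is
  fixed, its cost is \<open>a\<close>, and the first \<open>k\<close> parent labellings have been
  tried.\<close>

definition merge_costs :: "nat list \<Rightarrow> (int \<Rightarrow> int) \<Rightarrow> int \<Rightarrow> (nat \<Rightarrow> int) \<Rightarrow> nat \<Rightarrow> int \<Rightarrow> int set" where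
  "merge_costs xp Tp a lab k g = {a + Tp (int cb) - 1 | cb. cb < k \<and> 0 < Tp (int cb) \<and>
     (\<forall>u\<in>set xp. merge_ok (lab u) (digit_label xp cb u)) \<and>
     g = code (map (\<lambda>u. merge_label (lab u) (digit_label xp cb u)) xp)}"

lemma merge_costs_Suc:
  "merge_costs xp Tp a lab (Suc k) g = (if 0 < Tp (int k) \<and> (\<forall>u\<in>set xp. merge_ok (lab u) (digit_label xp k u)) \<and>
     g = code (map (\<lambda>u. merge_label (lab u) (digit_label xp k u)) xp)
   then insert (a + Tp (int k) - 1) (merge_costs xp Tp a lab k g) else merge_costs xp Tp a lab k g)"
  unfolding merge_costs_def less_Suc_eq by (cases "0 < Tp (int k)") auto

lemma merge_costs_0 [simp]: "merge_costs xp Tp a lab 0 g = {}"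
  by (simp add: merge_costs_def)

context instance_memory
begin

text \<open>\<open>S\<close> is what earlier child labellings have contributed to the new table. The
  parent table ends at or before \<open>nx\<close>, so the writes do not disturb the reads.\<close>

lemma halts_parent_loop:
  assumes env: "Env s" and p: "p < m" "s (adr 0 3) = int p"
    and la: "\<And>u. u \<in> set (bags ! p) \<Longrightarrow> s (adr 11 (int u)) = lab u"
    and a: "s (adr 0 6) = a" "0 < a" and nx: "s (adr 0 4) = nx" and cp: "s (adr 9 (int p)) = cp"
    and cp0: "0 \<le> cp" "cp + 5 ^ length (bags ! p) \<le> nx"
    and S: "\<And>g. 0 \<le> g \<Longrightarrow> g < 5 ^ length (bags ! p) \<Longrightarrow> minval (s (adr 8 (nx + g))) (S g)"
  shows "halts (For 15 (M 4 (R 3)) parent_body) (5 ^ B * ((B + 1) * 30000)) (\<lambda>s'.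
    agree (W {8, 9, 10, 15, 16, 17, 18} {8, 12}) s s' \<and>
    (\<forall>x. x < nx \<or> nx + 5 ^ length (bags ! p) \<le> x \<longrightarrow> s' (adr 8 x) = s (adr 8 x)) \<and>
    (\<forall>g. 0 \<le> g \<and> g < 5 ^ length (bags ! p) \<longrightarrow> minval (s' (adr 8 (nx + g)))
      (S g \<union> merge_costs (bags ! p) (\<lambda>c. s (adr 8 (cp + c))) a lab (5 ^ length (bags ! p)) g))) s"
proof -
  let ?xp = "bags ! p" and ?W = "W {8, 9, 10, 15, 16, 17, 18} {8, 12}"
  let ?N = "5 ^ length ?xp :: nat" and ?Tp = "\<lambda>c. s (adr 8 (cp + c))"
  have NI: "5 ^ length ?xp = int ?N" by simp
  define I where "I = (\<lambda>k s'. agree ?W s s' \<and> s' (adr 0 15) = int k \<and>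
    (\<forall>x. x < nx \<or> nx + int ?N \<le> x \<longrightarrow> s' (adr 8 x) = s (adr 8 x)) \<and>
    (\<forall>g. 0 \<le> g \<and> g < int ?N \<longrightarrow> minval (s' (adr 8 (nx + g))) (S g \<union> merge_costs ?xp ?Tp a lab k g)))"
  have frame: "Env s'" "s' (adr 0 3) = int p" "s' (adr 0 6) = a" "s' (adr 0 4) = nx" "s' (adr 9 x) = s (adr 9 x)"
    "s' (adr 11 x) = s (adr 11 x)"
    if ag: "agree ?W s s'" for s' x
  proof -
    show "Env s'" by (intro Env_agree[OF env ag]) auto
    show "s' (adr 0 3) = int p" using agree_adr[OF ag, of 0 3] p by simp
    show "s' (adr 0 6) = a" using agree_adr[OF ag, of 0 6] a by simp
    show "s' (adr 0 4) = nx" using agree_adr[OF ag, of 0 4] nx by simp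
    show "s' (adr 9 x) = s (adr 9 x)" using agree_adr[OF ag, of 9 x] by simp
    show "s' (adr 11 x) = s (adr 11 x)" using agree_adr[OF ag, of 11 x] by simp
  qed
  have nx0: "0 \<le> nx" using cp0 zero_le_power[of "5::int" "length ?xp"] by linarith
  have inW: "adr 0 15 \<in> ?W" "adr 0 16 \<in> ?W" "0 \<le> x \<Longrightarrow> adr 8 x \<in> ?W" for x
    by (simp_all add: adr_in_W)
  have "halts (For 15 (M 4 (R 3)) parent_body) ((?N + 1) * ((B + 1) * 14000 + for_cost (M 4 (R 3)))) (I ?N) s"
  proof (rule halts_For[where I = I])
    show "I 0 (s(adr 0 15 := 0))" using inW S by (simp add: I_def agree_upd adr_eq_iff)
    show "eval (M 4 (R 3)) s' = int ?N \<and> s' (adr 0 15) = int k" if "I k s'" for k s'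
    proof -
      have ag: "agree ?W s s'" using that by (simp add: I_def)
      show ?thesis using frame[OF ag] p(1) that by (simp add: I_def Env_def)
    qed
    fix k s' assume k: "k < ?N" and I: "I k s'"
    have ag: "agree ?W s s'" and r15: "s' (adr 0 15) = int k"
      and low: "\<forall>x. x < nx \<or> nx + int ?N \<le> x \<longrightarrow> s' (adr 8 x) = s (adr 8 x)"
      and mv: "\<forall>g. 0 \<le> g \<and> g < int ?N \<longrightarrow> minval (s' (adr 8 (nx + g))) (S g \<union> merge_costs ?xp ?Tp a lab k g)"
      using I unfolding I_def by blast+
    let ?Q = "\<lambda>s'. s' (adr 0 15) = int k \<and> I (Suc k) (s'(adr 0 15 := int (Suc k)))"
    have fin: "?Q s2" if ag2: "agree ?W s s2" and r: "s2 (adr 0 15) = int k"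
      and low2: "\<And>x. x < nx \<or> nx + int ?N \<le> x \<Longrightarrow> s2 (adr 8 x) = s (adr 8 x)"
      and mv2: "\<And>g. 0 \<le> g \<Longrightarrow> g < int ?N \<Longrightarrow> minval (s2 (adr 8 (nx + g))) (S g \<union> merge_costs ?xp ?Tp a lab (Suc k) g)" for s2
      unfolding I_def using ag2 r low2 mv2 inW by (simp add: agree_upd adr_eq_iff)
    let ?b = "?Tp (int k)"
    let ?s1 = "result (Set 16 (M 8 (Add (M 9 (R 3)) (R 15)))) s'"
    have "int k < int ?N" using k by (rule of_nat_less_iff[THEN iffD2])
    then have "cp + int k < nx" using cp0(2) unfolding NI by linarith
    then have "s' (adr 8 (cp + int k)) = ?b" using low by blast
    then have s1: "?s1 = s'(adr 0 16 := ?b)"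
      using frame(2)[OF ag] frame(5)[OF ag] cp r15 by simp
    have ag1: "agree ?W s ?s1" unfolding s1 using ag inW by (simp add: agree_upd)
    have pre: "?s1 (adr 0 15) = int k" "?s1 (adr 0 16) = ?b" "?s1 (adr 8 x) = s' (adr 8 x)" for x
      unfolding s1 using r15 by (simp_all add: adr_eq_iff)
    have kF: "k < F" using k F[OF p(1)] by simp
    show "halts parent_body ((B + 1) * 14000) ?Q s'"
      unfolding parent_body_def
    proof (rule halts_mono[OF halts_Seq[OF halts_straight]])
      let ?P = "Seq (decode 12 3 15) (Seq merge (IfPos (R 18) Skip table_min))"
      show "halts (IfPos (R 16) ?P Skip) (cost (R 16) + 1 + ((B + 1) * 2000 + ((B + 1) * 6000 + (cost (R 18) + 1 + 2500)))) ?Q ?s1"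
      proof (rule halts_IfPos)
        assume "0 < eval (R 16) ?s1"
        then have bpos: "0 < ?b" using pre(2) by simp
        show "halts ?P ((B + 1) * 2000 + ((B + 1) * 6000 + (cost (R 18) + 1 + 2500))) ?Q ?s1"
        proof (rule halts_Seq'[OF halts_decode[OF frame(1)[OF ag1] p(1) frame(2)[OF ag1] pre(1) kF]])
          fix s2 assume s2: "agree (W {8, 9} {12}) ?s1 s2 \<and>
            (\<forall>v. s2 (adr 12 (int v)) = (if v \<in> set ?xp then digit_label ?xp k v else ?s1 (adr 12 (int v))))"
          then have a2: "agree (W {8, 9} {12}) ?s1 s2" by blast
          have "agree ?W ?s1 s2" by (rule agree_mono[OF a2 W_mono]) auto
          then have ag2: "agree ?W s s2" using ag1 agree_trans by blast
          show "halts (Seq merge (IfPos (R 18) Skip table_min)) ((B + 1) * 6000 + (cost (R 18) + 1 + 2500)) ?Q s2"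
          proof (rule halts_Seq'[OF halts_merge[OF frame(1)[OF ag2] p(1) frame(2)[OF ag2],
                where la = "\<lambda>w. s2 (adr 11 (int w))" and lb = "\<lambda>w. s2 (adr 12 (int w))"]])
            fix s3 assume s3: "agree (W {9, 10, 17, 18} {}) s2 s3 \<and>
              s3 (adr 0 17) = code (map (\<lambda>u. merge_label (s2 (adr 11 (int u))) (s2 (adr 12 (int u)))) ?xp) \<and> 0 \<le> s3 (adr 0 18) \<and>
              (s3 (adr 0 18) = 0 \<longleftrightarrow> (\<forall>u\<in>set ?xp. merge_ok (s2 (adr 11 (int u))) (s2 (adr 12 (int u)))))"
            then have a3: "agree (W {9, 10, 17, 18} {}) s2 s3" by blast
            have "agree ?W s2 s3" by (rule agree_mono[OF a3 W_mono]) auto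
            then have ag3: "agree ?W s s3" using ag2 agree_trans by blast
            have u: "s2 (adr 11 (int u)) = lab u" "s2 (adr 12 (int u)) = digit_label ?xp k u" if "u \<in> set ?xp" for u
              using frame(6)[OF ag2] la[OF that] s2 that by simp_all
            let ?g = "code (map (\<lambda>u. merge_label (lab u) (digit_label ?xp k u)) ?xp)"
            let ?ok = "\<forall>u\<in>set ?xp. merge_ok (lab u) (digit_label ?xp k u)"
            have "map (\<lambda>u. merge_label (s2 (adr 11 (int u))) (s2 (adr 12 (int u)))) ?xp = map (\<lambda>u. merge_label (lab u) (digit_label ?xp k u)) ?xp"
              using u by simp
            then have g: "s3 (adr 0 17) = ?g" using s3 by metis
            have ok: "s3 (adr 0 18) = 0 \<longleftrightarrow> ?ok" "0 \<le> s3 (adr 0 18)" using s3 u by auto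
            have r3: "s3 (adr 0 15) = int k" "s3 (adr 0 16) = ?b" "s3 (adr 8 x) = s' (adr 8 x)" for x
              using agree_adr[OF a3, of 0 15] agree_adr[OF a2, of 0 15]
                agree_adr[OF a3, of 0 16] agree_adr[OF a2, of 0 16]
                agree_adr[OF a3, of 8 x] agree_adr[OF a2, of 8 x] pre by (simp_all add: adr_eq_iff)
            show "halts (IfPos (R 18) Skip table_min) (cost (R 18) + 1 + 2500) ?Q s3"
            proof (rule halts_IfPos)
              assume "0 < eval (R 18) s3"
              then have "\<not> ?ok" using ok by simp
              then have eq: "merge_costs ?xp ?Tp a lab (Suc k) g = merge_costs ?xp ?Tp a lab k g" for g
                unfolding merge_costs_Suc by auto
              show "halts Skip 2500 ?Q s3"
                by (rule halts_straight) (use fin[OF ag3 r3(1)] low mv eq r3(3) in simp_all)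
            next
              assume "eval (R 18) s3 \<le> 0"
              then have isok: "?ok" using ok by simp
              note gr = merge_code_range[OF isok]
              let ?y = "a + ?b - 1"
              have ypos: "0 < ?y" using a(2) bpos by simp
              let ?x = "s' (adr 8 (nx + ?g))"
              have eq: "merge_costs ?xp ?Tp a lab (Suc k) g =
                (if g = ?g then insert ?y (merge_costs ?xp ?Tp a lab k g) else merge_costs ?xp ?Tp a lab k g)" for g
                using isok bpos by (simp add: merge_costs_Suc)
              have mvx: "minval ?x (S ?g \<union> merge_costs ?xp ?Tp a lab k ?g)" using mv gr by simp
              have x0: "0 \<le> ?x" using mvx by (rule minval_nonneg)
              show "halts table_min 2500 ?Q s3"
              proof (rule halts_straight)
                let ?r = "result table_min s3"
                have rr: "?r = s3(adr 0 16 := ?y, adr 8 (nx + ?g) := (if ?x = 0 \<or> ?y < ?x then ?y else ?x))"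
                proof -
                  \<comment> \<open>Writing the old value back into its cell gives all branches of
                    \<open>table_min\<close> the same form.\<close>
                  have e: "s3(adr 0 16 := ?y) = s3(adr 0 16 := ?y, adr 8 (nx + ?g) := ?x)"
                    using r3(3)[of "nx + ?g"] by (simp add: fun_eq_iff adr_eq_iff)
                  have ev: "s3 (adr 0 6) = a" "s3 (adr 0 4) = nx" using frame[OF ag3] by simp_all
                  show ?thesis using e ev g r3 x0 by (auto simp: table_min_def adr_eq_iff)
                qed
                show "?Q ?r"
                proof (rule fin)
                  show "agree ?W s ?r" unfolding rr using ag3 inW nx0 gr by (simp add: agree_upd)
                  show "?r (adr 0 15) = int k" unfolding rr using r3 by (simp add: adr_eq_iff)
                  show "?r (adr 8 x) = s (adr 8 x)" if "x < nx \<or> nx + int ?N \<le> x" for x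
                    unfolding rr using that gr low r3(3)[of x] by (auto simp: adr_eq_iff)
                  show "minval (?r (adr 8 (nx + g))) (S g \<union> merge_costs ?xp ?Tp a lab (Suc k) g)"
                    if "0 \<le> g" "g < int ?N" for g
                  proof (cases "g = ?g")
                    case True
                    have "minval (if ?x = 0 \<or> ?y < ?x then ?y else ?x) (insert ?y (S ?g \<union> merge_costs ?xp ?Tp a lab k ?g))"
                      using minval_insert[OF mvx ypos] .
                    then show ?thesis unfolding eq rr True by (simp add: insert_absorb2)
                  next
                    case False
                    then show ?thesis unfolding eq rr using mv that r3(3) by (simp add: adr_eq_iff)
                  qed
                qed
              qed (simp_all add: table_min_def)
            qed
          qed simp_all
        qed simp_all
      next
        assume "eval (R 16) ?s1 \<le> 0"
        then have "\<not> 0 < ?b" using pre(2) by simp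
        then have eq: "merge_costs ?xp ?Tp a lab (Suc k) g = merge_costs ?xp ?Tp a lab k g" for g
          by (simp add: merge_costs_Suc)
        show "halts Skip ((B + 1) * 2000 + ((B + 1) * 6000 + (cost (R 18) + 1 + 2500))) ?Q ?s1"
        proof (rule halts_straight)
          show "?Q (result Skip ?s1)" unfolding result.simps(1)
          proof (rule fin[OF ag1 pre(1)])
            show "?s1 (adr 8 x) = s (adr 8 x)" if "x < nx \<or> nx + int ?N \<le> x" for x
              unfolding pre(3) using low that by blast
            show "minval (?s1 (adr 8 (nx + g))) (S g \<union> merge_costs ?xp ?Tp a lab (Suc k) g)"
              if "0 \<le> g" "g < int ?N" for g
              unfolding pre(3) eq using mv that by blast
          qed
        qed simp_all
      qed
      show "wcost (Set 16 (M 8 (Add (M 9 (R 3)) (R 15)))) \<le> 1000" by simp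
      show "1000 + (cost (R 16) + 1 + ((B + 1) * 2000 + ((B + 1) * 6000 + (cost (R 18) + 1 + 2500)))) \<le> (B + 1) * 14000"
        by simp
    qed simp_all
  qed
  then show ?thesis
  proof (rule halts_mono)
    have "?N \<le> 5 ^ B" using B[OF p(1)] by (intro power_increasing) auto
    then have "?N + 1 \<le> 2 * 5 ^ B" using one_le_power[of "5::nat" B] by linarith
    then have "(?N + 1) * ((B + 1) * 14000 + for_cost (M 4 (R 3))) \<le> 2 * 5 ^ B * ((B + 1) * 14000 + for_cost (M 4 (R 3)))"
      by (intro mult_le_mono1)
    also have "\<dots> \<le> 2 * 5 ^ B * ((B + 1) * 15000)" by (intro mult_le_mono2) simp
    also have "\<dots> = 5 ^ B * ((B + 1) * 30000)" by (simp add: algebra_simps)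
    finally show "(?N + 1) * ((B + 1) * 14000 + for_cost (M 4 (R 3))) \<le> 5 ^ B * ((B + 1) * 30000)" .
  qed (simp add: I_def)
qed

end

lemma merge_costs_cong:
  "(\<And>cb. cb < k \<Longrightarrow> Tp (int cb) = Tp' (int cb)) \<Longrightarrow> merge_costs xp Tp a lab k g = merge_costs xp Tp' a lab k g"
proof (induction k)
  case (Suc k)
  then have "merge_costs xp Tp a lab k g = merge_costs xp Tp' a lab k g" "Tp (int k) = Tp' (int k)" by simp_all
  then show ?case by (simp only: merge_costs_Suc)
qed simp

context instance_memory
begin

text \<open>A stamp may stem from another node, but it is never wrong; hence stamps need not be
  cleared between nodes.\<close>

definition Stamp :: "memory \<Rightarrow> bool" where
  "Stamp s \<longleftrightarrow> (\<forall>v q. q < m \<longrightarrow> s (adr 10 (int v)) = int q + 1 \<longrightarrow> v \<in> set (bags ! q))"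

definition push_costs :: "nat \<Rightarrow> nat \<Rightarrow> (int \<Rightarrow> int) \<Rightarrow> (int \<Rightarrow> int) \<Rightarrow> nat \<Rightarrow> int \<Rightarrow> int set" where
  "push_costs t p Tt Tp k g = {x. \<exists>ca ce lab. ca < k \<and> 0 < Tt (int ca) \<and>
     elim_seq (set (bags ! t)) (filter (\<lambda>v. v \<notin> set (bags ! p)) (bags ! t)) (digit_label (bags ! t) ca) = (lab, ce, True) \<and>
     x \<in> merge_costs (bags ! p) Tp (Tt (int ca) + int ce) lab (5 ^ length (bags ! p)) g}"

lemma push_costs_0 [simp]: "push_costs t p Tt Tp 0 g = {}"
  by (simp add: push_costs_def)

lemma push_costs_Suc:
  assumes "elim_seq (set (bags ! t)) (filter (\<lambda>v. v \<notin> set (bags ! p)) (bags ! t)) (digit_label (bags ! t) k) = (lab, ce, f)"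
  shows "push_costs t p Tt Tp (Suc k) g = push_costs t p Tt Tp k g \<union>
    (if f \<and> 0 < Tt (int k) then merge_costs (bags ! p) Tp (Tt (int k) + int ce) lab (5 ^ length (bags ! p)) g else {})"
  unfolding push_costs_def less_Suc_eq using assms by auto

lemma push_costs_full: "push_costs t p Tt Tp (5 ^ length (bags ! t)) g = all_push_costs (bags ! t) (bags ! p) Tt Tp g"
  unfolding push_costs_def all_push_costs_def merge_costs_def by blast

text \<open>The eliminations cost about \<open>5 ^ B * (B + 1)^2\<close> and the pairs of labellings
  about \<open>25 ^ B * (B + 1)\<close>; the stated product bounds both.\<close>

lemma halts_child_loop:
  assumes env: "Env s" and t: "t < m" "s (adr 0 2) = int t" and p: "p < m" "s (adr 0 3) = int p"
    and stamp: "Stamp s"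
    and nx: "s (adr 0 4) = nx" and cp: "s (adr 9 (int p)) = cp" and ct: "s (adr 9 (int t)) = ct"
    and cp0: "0 \<le> cp" "cp + 5 ^ length (bags ! p) \<le> nx"
    and ct0: "0 \<le> ct" "ct + 5 ^ length (bags ! t) \<le> nx"
    and z: "\<And>x. nx \<le> x \<Longrightarrow> s (adr 8 x) = 0"
  shows "halts (For 5 (M 4 (R 2)) child_body) (25 ^ B * ((B + 1) * ((B + 1) * 120000))) (\<lambda>s'.
    agree (W ({5..18} \<union> {20}) {8, 10, 11, 12}) s s' \<and> Stamp s' \<and>
    (\<forall>x. x < nx \<or> nx + 5 ^ length (bags ! p) \<le> x \<longrightarrow> s' (adr 8 x) = s (adr 8 x)) \<and>
    (\<forall>g. 0 \<le> g \<and> g < 5 ^ length (bags ! p) \<longrightarrow> minval (s' (adr 8 (nx + g)))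
      (all_push_costs (bags ! t) (bags ! p) (\<lambda>c. s (adr 8 (ct + c))) (\<lambda>c. s (adr 8 (cp + c))) g))) s"
proof -
  let ?xp = "bags ! p" and ?xt = "bags ! t" and ?W = "W ({5..18} \<union> {20}) {8, 10, 11, 12}"
  let ?zs = "filter (\<lambda>v. v \<notin> set ?xp) ?xt"
  let ?N = "5 ^ length ?xp :: nat" and ?Nt = "5 ^ length ?xt :: nat"
  let ?Tp = "\<lambda>c. s (adr 8 (cp + c))" and ?Tt = "\<lambda>c. s (adr 8 (ct + c))"
  have NI: "5 ^ length ?xp = int ?N" "5 ^ length ?xt = int ?Nt" by simp_all
  define I where "I = (\<lambda>k s'. agree ?W s s' \<and> s' (adr 0 5) = int k \<and> Stamp s' \<and>
    (\<forall>x. x < nx \<or> nx + int ?N \<le> x \<longrightarrow> s' (adr 8 x) = s (adr 8 x)) \<and>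
    (\<forall>g. 0 \<le> g \<and> g < int ?N \<longrightarrow> minval (s' (adr 8 (nx + g))) (push_costs t p ?Tt ?Tp k g)))"
  have frame: "Env s'" "s' (adr 0 2) = int t" "s' (adr 0 3) = int p" "s' (adr 0 4) = nx" "s' (adr 9 x) = s (adr 9 x)"
    if ag: "agree ?W s s'" for s' x
  proof -
    show "Env s'" by (intro Env_agree[OF env ag]) auto
    show "s' (adr 0 2) = int t" using agree_adr[OF ag, of 0 2] t by simp
    show "s' (adr 0 3) = int p" using agree_adr[OF ag, of 0 3] p by simp
    show "s' (adr 0 4) = nx" using agree_adr[OF ag, of 0 4] nx by simp
    show "s' (adr 9 x) = s (adr 9 x)" using agree_adr[OF ag, of 9 x] by simp
  qed
  have inW: "adr 0 5 \<in> ?W" "adr 0 6 \<in> ?W" "adr 0 7 \<in> ?W"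
    by (simp_all add: adr_in_W)
  have "halts (For 5 (M 4 (R 2)) child_body) ((?Nt + 1) * (5 ^ B * ((B + 1) * ((B + 1) * 59000)) + for_cost (M 4 (R 2)))) (I ?Nt) s"
  proof (rule halts_For[where I = I])
    show "I 0 (s(adr 0 5 := 0))" using inW z stamp
      by (simp add: I_def agree_upd adr_eq_iff minval_empty Stamp_def)
    show "eval (M 4 (R 2)) s' = int ?Nt \<and> s' (adr 0 5) = int k" if "I k s'" for k s'
    proof -
      have ag: "agree ?W s s'" using that by (simp add: I_def)
      show ?thesis using frame[OF ag] t(1) that by (simp add: I_def Env_def)
    qed
    fix k s' assume k: "k < ?Nt" and I: "I k s'"
    have ag: "agree ?W s s'" and r5: "s' (adr 0 5) = int k" and st: "Stamp s'"
      and low: "\<forall>x. x < nx \<or> nx + int ?N \<le> x \<longrightarrow> s' (adr 8 x) = s (adr 8 x)"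
      and mv: "\<forall>g. 0 \<le> g \<and> g < int ?N \<longrightarrow> minval (s' (adr 8 (nx + g))) (push_costs t p ?Tt ?Tp k g)"
      using I unfolding I_def by blast+
    let ?Q = "\<lambda>s'. s' (adr 0 5) = int k \<and> I (Suc k) (s'(adr 0 5 := int (Suc k)))"
    have fin: "?Q s2" if ag2: "agree ?W s s2" and r: "s2 (adr 0 5) = int k" and st2: "Stamp s2"
      and low2: "\<And>x. x < nx \<or> nx + int ?N \<le> x \<Longrightarrow> s2 (adr 8 x) = s (adr 8 x)"
      and mv2: "\<And>g. 0 \<le> g \<Longrightarrow> g < int ?N \<Longrightarrow> minval (s2 (adr 8 (nx + g))) (push_costs t p ?Tt ?Tp (Suc k) g)" for s2
      unfolding I_def using ag2 r low2 mv2 inW st2 by (simp add: agree_upd adr_eq_iff Stamp_def)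
    obtain labk cek fk where sk: "elim_seq (set ?xt) ?zs (digit_label ?xt k) = (labk, cek, fk)"
      by (cases "elim_seq (set ?xt) ?zs (digit_label ?xt k)")
    note pS = push_costs_Suc[OF sk, of ?Tt ?Tp]
    let ?a = "?Tt (int k)"
    let ?P1 = "Seq (Set 6 (M 8 (Add (M 9 (R 2)) (R 5)))) (Set 7 (Const 0))"
    let ?s1 = "result ?P1 s'"
    have "int k < int ?Nt" using k by (rule of_nat_less_iff[THEN iffD2])
    then have "ct + int k < nx" using ct0(2) unfolding NI by linarith
    then have "s' (adr 8 (ct + int k)) = ?a" using low by blast
    then have s1: "?s1 = s'(adr 0 6 := ?a, adr 0 7 := 0)"
      using frame(2)[OF ag] frame(5)[OF ag] ct r5 by simp
    have ag1: "agree ?W s ?s1" unfolding s1 using ag inW by (simp add: agree_upd)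
    have pre: "?s1 (adr 0 5) = int k" "?s1 (adr 0 6) = ?a" "?s1 (adr 0 7) = 0" "?s1 (adr 8 x) = s' (adr 8 x)"
      "?s1 (adr 10 x) = s' (adr 10 x)" for x
      unfolding s1 using r5 by (simp_all add: adr_eq_iff)
    have st1: "Stamp ?s1" using st unfolding Stamp_def pre(5) .
    have kF: "k < F" using k F[OF t(1)] by simp
    \<comment> \<open>Covers the two ways in which labelling \<open>k\<close> contributes nothing:
      an empty child entry and a failed elimination.\<close>
    have skip: "?Q s2" if "agree ?W s s2" "s2 (adr 0 5) = int k" "Stamp s2" "\<And>x. s2 (adr 8 x) = s' (adr 8 x)"
      "\<not> (fk \<and> 0 < ?a)" for s2
    proof (rule fin[OF that(1-3)])
      show "s2 (adr 8 x) = s (adr 8 x)" if "x < nx \<or> nx + int ?N \<le> x" for x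
        unfolding \<open>\<And>x. s2 (adr 8 x) = s' (adr 8 x)\<close> using low that by blast
      have "push_costs t p ?Tt ?Tp (Suc k) g = push_costs t p ?Tt ?Tp k g" for g
        unfolding pS if_not_P[OF that(5)] by simp
      then show "minval (s2 (adr 8 (nx + g))) (push_costs t p ?Tt ?Tp (Suc k) g)"
        if "0 \<le> g" "g < int ?N" for g
        unfolding \<open>\<And>x. s2 (adr 8 x) = s' (adr 8 x)\<close> using mv that by simp
    qed
    let ?Pcb = "For 15 (M 4 (R 3)) parent_body"
    let ?tcb = "5 ^ B * ((B + 1) * 30000)" and ?tel = "(B + 1) * ((B + 1) * 14000)"
    let ?t4 = "cost (R 7) + 1 + ?tcb"
    show "halts child_body (5 ^ B * ((B + 1) * ((B + 1) * 59000))) ?Q s'"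
      unfolding child_body_def
    proof (rule halts_mono[OF halts_Seq[OF halts_straight]])
      let ?P = "Seq set_pass (Seq (decode 11 2 5) (Seq elim_all (IfPos (R 7) Skip ?Pcb)))"
      let ?t = "(B + 1) * 3000 + ((B + 1) * 2000 + (?tel + ?t4))"
      show "halts (IfPos (R 6) ?P Skip) (cost (R 6) + 1 + ?t) ?Q ?s1"
      proof (rule halts_IfPos)
        assume "0 < eval (R 6) ?s1"
        then have apos: "0 < ?a" using pre(2) by simp
        show "halts ?P ?t ?Q ?s1"
        proof (rule halts_Seq'[OF halts_set_pass[OF frame(1)[OF ag1] p(1) frame(3)[OF ag1]]])
          fix s2 assume s2: "agree (W {9} {10, 11}) ?s1 s2 \<and>
            (\<forall>v. s2 (adr 11 (int v)) = (if v \<in> set ?xp then 5 else ?s1 (adr 11 (int v)))) \<and>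
            (\<forall>v. s2 (adr 10 (int v)) = (if v \<in> set ?xp then int p + 1 else ?s1 (adr 10 (int v))))"
          then have a2: "agree (W {9} {10, 11}) ?s1 s2" by blast
          have "agree ?W ?s1 s2" by (rule agree_mono[OF a2 W_mono]) auto
          then have ag2: "agree ?W s s2" using ag1 agree_trans by blast
          have r2: "s2 (adr 0 5) = int k" "s2 (adr 0 6) = ?a" "s2 (adr 0 7) = 0" "s2 (adr 8 x) = s' (adr 8 x)" for x
            using agree_adr[OF a2, of 0 5] agree_adr[OF a2, of 0 6] agree_adr[OF a2, of 0 7]
              agree_adr[OF a2, of 8 x] pre by (simp_all add: adr_eq_iff)
          have st2: "Stamp s2" unfolding Stamp_def
          proof (intro allI impI)
            fix v q assume q: "q < m" "s2 (adr 10 (int v)) = int q + 1"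
            show "v \<in> set (bags ! q)"
            proof (cases "v \<in> set ?xp")
              case True
              then have "q = p" using s2 q(2) by simp
              then show ?thesis using True by simp
            next
              case False
              then have "?s1 (adr 10 (int v)) = int q + 1" using s2 q(2) by metis
              then show ?thesis using st1 q(1) unfolding Stamp_def by blast
            qed
          qed
          have stamp2: "s2 (adr 10 (int v)) = int p + 1 \<longleftrightarrow> v \<in> set ?xp" for v
            using s2 st2 p(1) unfolding Stamp_def by metis
          show "halts (Seq (decode 11 2 5) (Seq elim_all (IfPos (R 7) Skip ?Pcb))) ((B + 1) * 2000 + (?tel + ?t4)) ?Q s2"
          proof (rule halts_Seq'[OF halts_decode[OF frame(1)[OF ag2] t(1) frame(2)[OF ag2] r2(1) kF]])
            fix s3 assume s3: "agree (W {8, 9} {11}) s2 s3 \<and>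
              (\<forall>v. s3 (adr 11 (int v)) = (if v \<in> set ?xt then digit_label ?xt k v else s2 (adr 11 (int v))))"
            then have a3: "agree (W {8, 9} {11}) s2 s3" by blast
            have "agree ?W s2 s3" by (rule agree_mono[OF a3 W_mono]) auto
            then have ag3: "agree ?W s s3" using ag2 agree_trans by blast
            have r3: "s3 (adr 0 5) = int k" "s3 (adr 0 6) = ?a" "s3 (adr 0 7) = 0" "s3 (adr 8 x) = s' (adr 8 x)"
              "s3 (adr 10 x) = s2 (adr 10 x)" for x
              using agree_adr[OF a3, of 0 5] agree_adr[OF a3, of 0 6] agree_adr[OF a3, of 0 7]
                agree_adr[OF a3, of 8 x] agree_adr[OF a3, of 10 x] r2 by simp_all
            have stamp3: "s3 (adr 10 (int v)) = int p + 1 \<longleftrightarrow> v \<in> set ?xp" for v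
              unfolding r3(5) by (rule stamp2)
            have lab3: "s3 (adr 11 (int u)) = digit_label ?xt k u" if "u \<in> set ?xt \<union> set ?xp" for u
              using s3 s2 that digit_label_notin[of u ?xt k] by auto
            show "halts (Seq elim_all (IfPos (R 7) Skip ?Pcb)) (?tel + ?t4) ?Q s3"
            proof (rule halts_Seq'[OF halts_elim_all[OF frame(1)[OF ag3] t(1) frame(2)[OF ag3] p(1) frame(3)[OF ag3] stamp3,
                  where lab = "\<lambda>w. s3 (adr 11 (int w))"]])
              fix s4 assume "agree (W {6, 7, 9, 10, 11, 12, 13, 14, 20} {11}) s3 s4 \<and> 0 \<le> s4 (adr 0 7) \<and>
                (\<exists>lab' c f. elim_seq (set ?xt) ?zs (\<lambda>w. s3 (adr 11 (int w))) = (lab', c, f) \<and>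
                  (\<forall>w. s4 (adr 11 (int w)) = lab' w) \<and> s4 (adr 0 6) = s3 (adr 0 6) + int c \<and>
                  (s4 (adr 0 7) = 0 \<longleftrightarrow> f))"
              then obtain lab' c f where a4: "agree (W {6, 7, 9, 10, 11, 12, 13, 14, 20} {11}) s3 s4"
                and s47: "0 \<le> s4 (adr 0 7)"
                and es: "elim_seq (set ?xt) ?zs (\<lambda>w. s3 (adr 11 (int w))) = (lab', c, f)"
                and l4: "\<forall>w. s4 (adr 11 (int w)) = lab' w" and s46: "s4 (adr 0 6) = s3 (adr 0 6) + int c"
                and f4: "s4 (adr 0 7) = 0 \<longleftrightarrow> f" by (elim exE conjE)
              have "agree ?W s3 s4" by (rule agree_mono[OF a4 W_mono]) auto
              then have ag4: "agree ?W s s4" using ag3 agree_trans by blast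
              \<comment> \<open>The machine worked on its label array, which is known to agree with
                \<open>digit_label\<close> only on the two bags.\<close>
              have cong: "c = cek \<and> f = fk \<and> (\<forall>u\<in>set ?xt \<union> set ?xp. lab' u = labk u)"
                by (rule elim_seq_cong[OF lab3 _ es sk]) auto
              have r4: "s4 (adr 0 5) = int k" "s4 (adr 8 x) = s' (adr 8 x)" "s4 (adr 10 x) = s2 (adr 10 x)" for x
                using agree_adr[OF a4, of 0 5] agree_adr[OF a4, of 8 x] agree_adr[OF a4, of 10 x] r3 by simp_all
              have st4: "Stamp s4" using st2 unfolding Stamp_def r4(3) .
              show "halts (IfPos (R 7) Skip ?Pcb) ?t4 ?Q s4"
              proof (rule halts_IfPos)
                assume "0 < eval (R 7) s4"
                then have "\<not> fk" using f4 cong by simp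
                then show "halts Skip ?tcb ?Q s4"
                  by (intro halts_straight) (use skip[OF ag4 r4(1) st4 r4(2)] in simp_all)
              next
                assume "eval (R 7) s4 \<le> 0"
                then have fk: fk using f4 cong s47 by simp
                have a6: "s4 (adr 0 6) = ?a + int cek" using s46 r3(2) cong by simp
                have la4: "s4 (adr 11 (int u)) = labk u" if "u \<in> set ?xp" for u
                  using l4 cong that by simp
                have cp4: "s4 (adr 9 (int p)) = cp" using frame(5)[OF ag4] cp by simp
                have mv4: "minval (s4 (adr 8 (nx + g))) (push_costs t p ?Tt ?Tp k g)" if "0 \<le> g" "g < 5 ^ length ?xp" for g
                  unfolding r4(2) using mv that unfolding NI by blast
                have Tp4: "merge_costs ?xp (\<lambda>c. s4 (adr 8 (cp + c))) (?a + int cek) labk ?N g =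
                  merge_costs ?xp ?Tp (?a + int cek) labk ?N g" for g
                proof -
                  have "s4 (adr 8 (cp + int cb)) = ?Tp (int cb)" if "cb < ?N" for cb
                  proof -
                    have "int cb < int ?N" using that by (rule of_nat_less_iff[THEN iffD2])
                    then have "cp + int cb < nx" using cp0(2) unfolding NI by linarith
                    then show ?thesis unfolding r4(2) using low by blast
                  qed
                  then show ?thesis by (rule merge_costs_cong)
                qed
                have pos: "0 < ?a + int cek" using apos by simp
                show "halts ?Pcb ?tcb ?Q s4"
                proof (rule halts_mono[OF halts_parent_loop[OF frame(1)[OF ag4] p(1) frame(3)[OF ag4] la4 a6 pos
                      frame(4)[OF ag4] cp4 cp0 mv4]])
                  fix s5 assume s5: "agree (W {8, 9, 10, 15, 16, 17, 18} {8, 12}) s4 s5 \<and>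
                    (\<forall>x. x < nx \<or> nx + 5 ^ length ?xp \<le> x \<longrightarrow> s5 (adr 8 x) = s4 (adr 8 x)) \<and>
                    (\<forall>g. 0 \<le> g \<and> g < 5 ^ length ?xp \<longrightarrow> minval (s5 (adr 8 (nx + g)))
                      (push_costs t p ?Tt ?Tp k g \<union> merge_costs ?xp (\<lambda>c. s4 (adr 8 (cp + c))) (?a + int cek) labk (5 ^ length ?xp) g))"
                  then have a5: "agree (W {8, 9, 10, 15, 16, 17, 18} {8, 12}) s4 s5" by blast
                  have "agree ?W s4 s5" by (rule agree_mono[OF a5 W_mono]) auto
                  then have ag5: "agree ?W s s5" using ag4 agree_trans by blast
                  have r5': "s5 (adr 0 5) = int k" "s5 (adr 10 x) = s4 (adr 10 x)" for x
                    using agree_adr[OF a5, of 0 5] agree_adr[OF a5, of 10 x] r4 by simp_all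
                  have st5: "Stamp s5" using st4 unfolding Stamp_def r5'(2) .
                  show "?Q s5"
                  proof (rule fin[OF ag5 r5'(1) st5])
                    show "s5 (adr 8 x) = s (adr 8 x)" if "x < nx \<or> nx + int ?N \<le> x" for x
                      using s5 low that unfolding NI r4(2) by metis
                    show "minval (s5 (adr 8 (nx + g))) (push_costs t p ?Tt ?Tp (Suc k) g)" if "0 \<le> g" "g < int ?N" for g
                    proof -
                      have "minval (s5 (adr 8 (nx + g)))
                        (push_costs t p ?Tt ?Tp k g \<union> merge_costs ?xp (\<lambda>c. s4 (adr 8 (cp + c))) (?a + int cek) labk ?N g)"
                        using s5 that unfolding NI by blast
                      then show ?thesis unfolding pS Tp4 using fk apos by simp
                    qed
                  qed
                qed simp_all
              qed
            qed (use r3(3) in simp_all)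
          qed simp_all
        qed
      next
        assume "eval (R 6) ?s1 \<le> 0"
        then have na: "\<not> (fk \<and> 0 < ?a)" using pre(2) by simp
        show "halts Skip ?t ?Q ?s1"
        proof (rule halts_straight)
          show "?Q (result Skip ?s1)" unfolding result.simps(1)
            by (rule skip[OF ag1 pre(1) st1 pre(4) na])
        qed simp_all
      qed
      show "wcost ?P1 \<le> 1000" by simp
      define b where "b = B + 1"
      define P where "P = (5::nat) ^ B"
      have bP: "1 \<le> b" "1 \<le> P" by (simp_all add: b_def P_def)
      \<comment> \<open>Each summand of the running time is at most a multiple of this one product,
        so the rest is linear arithmetic.\<close>
      define z where "z = P * (b * b)"
      have "1 * (b * 1) \<le> z" "1 * (b * b) \<le> z" "P * (b * 1) \<le> z" "1 * (1 * 1) \<le> z"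
        unfolding z_def by (intro mult_le_mono order.refl bP)+
      then have z: "b \<le> z" "b * b \<le> z" "P * b \<le> z" "1 \<le> z" by (simp_all only: mult_1 mult_1_right)
      have "1000 + (cost (R 6) + 1 + (b * 3000 + (b * 2000 + (b * (b * 14000) + (cost (R 7) + 1 + P * (b * 30000)))))) =
          1006 + 5000 * b + 14000 * (b * b) + 30000 * (P * b)" by simp
      also have "\<dots> \<le> 59000 * z" using z by linarith
      also have "\<dots> = P * (b * (b * 59000))" by (simp add: z_def)
      finally have "1000 + (cost (R 6) + 1 + (b * 3000 + (b * 2000 + (b * (b * 14000) + (cost (R 7) + 1 + P * (b * 30000)))))) \<le>
          P * (b * (b * 59000))" .
      then show "1000 + (cost (R 6) + 1 + ?t) \<le> 5 ^ B * ((B + 1) * ((B + 1) * 59000))"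
        unfolding b_def P_def .
    qed simp_all
  qed
  then show ?thesis
  proof (rule halts_mono)
    have "?Nt \<le> 5 ^ B" using B[OF t(1)] by (intro power_increasing) auto
    then have "?Nt + 1 \<le> 2 * 5 ^ B" using one_le_power[of "5::nat" B] by linarith
    then have "(?Nt + 1) * (5 ^ B * ((B + 1) * ((B + 1) * 59000)) + for_cost (M 4 (R 2))) \<le>
      2 * 5 ^ B * (5 ^ B * ((B + 1) * ((B + 1) * 59000)) + 63)"
      by (intro mult_le_mono) simp_all
    also have "\<dots> \<le> 2 * 5 ^ B * (5 ^ B * ((B + 1) * ((B + 1) * 60000)))"
    proof (intro mult_le_mono2)
      have "1 * (1 * 1) \<le> 5 ^ B * ((B + 1) * (B + 1))" by (intro mult_le_mono) simp_all
      then have "59000 * (5 ^ B * ((B + 1) * (B + 1))) + 63 \<le> 60000 * (5 ^ B * ((B + 1) * (B + 1)))" by linarith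
      then show "5 ^ B * ((B + 1) * ((B + 1) * 59000)) + 63 \<le> 5 ^ B * ((B + 1) * ((B + 1) * 60000))"
        by (simp only: mult_ac)
    qed
    also have "\<dots> = 25 ^ B * ((B + 1) * ((B + 1) * 120000))"
    proof -
      have "(25::nat) ^ B = 5 ^ B * 5 ^ B" by (simp add: power_mult_distrib[symmetric])
      then show ?thesis by (simp only: mult_ac)
    qed
    finally show "(?Nt + 1) * (5 ^ B * ((B + 1) * ((B + 1) * 59000)) + for_cost (M 4 (R 2))) \<le> 25 ^ B * ((B + 1) * ((B + 1) * 120000))" .
  qed (simp add: I_def push_costs_full)
qed

end

section \<open>The bottom-up traversal\<close>

text \<open>A scan as in linear-time Pruefer coding: after a push, control passes to the parent,
  which is pushed in turn if this was its last pending child; otherwise the index advances. A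
  finished node gets count 1 and so never looks ready again.\<close>

definition main_step :: prog where
  "main_step = IfPos (M 5 (R 2)) (Seq (Set 19 (Add (R 19) (Const 1))) (Set 2 (R 19)))
     (Seq push (Seq (Store (A 5 (R 2)) (Const 1))
       (Seq (Set 2 (R 3)) (Store (A 5 (R 3)) (Sub (M 5 (R 3)) (Const 1))))))"

definition main_loop :: prog where
  "main_loop = WhilePos (Sub (Load (Const 3)) (R 19)) main_step"

context instance_memory
begin

lemma halts_push:
  assumes env: "Env s" and t: "t < m" "s (adr 0 2) = int t" and p: "p = par ! t"
    and stamp: "Stamp s"
    and nx: "s (adr 0 4) = nx" and cp: "s (adr 9 (int p)) = cp" and ct: "s (adr 9 (int t)) = ct"
    and cp0: "0 \<le> cp" "cp + 5 ^ length (bags ! p) \<le> nx"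
    and ct0: "0 \<le> ct" "ct + 5 ^ length (bags ! t) \<le> nx"
    and z: "\<And>x. nx \<le> x \<Longrightarrow> s (adr 8 x) = 0"
  shows "halts push (25 ^ B * ((B + 1) * ((B + 1) * 130000))) (\<lambda>s'.
    agree (W ({3..18} \<union> {20}) {8, 9, 10, 11, 12}) s s' \<and> Env s' \<and> Stamp s' \<and>
    s' (adr 0 3) = int p \<and> s' (adr 0 4) = nx + 5 ^ length (bags ! p) \<and>
    (\<forall>x. s' (adr 9 x) = (if x = int p then nx else s (adr 9 x))) \<and>
    (\<forall>x. x < nx \<or> nx + 5 ^ length (bags ! p) \<le> x \<longrightarrow> s' (adr 8 x) = s (adr 8 x)) \<and>
    (\<forall>g. 0 \<le> g \<and> g < 5 ^ length (bags ! p) \<longrightarrow> minval (s' (adr 8 (nx + g)))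
      (all_push_costs (bags ! t) (bags ! p) (\<lambda>c. s (adr 8 (ct + c))) (\<lambda>c. s (adr 8 (cp + c))) g))) s"
    (is "halts _ _ ?Q s")
proof -
  let ?W = "W ({3..18} \<union> {20}) {8, 9, 10, 11, 12}"
  have pm: "p < m" using par[OF t(1)] p by simp
  let ?P1 = "Set 3 (Load (Add (R 1) (R 2)))"
  let ?P3 = "Seq (Store (A 9 (R 3)) (R 4)) (Set 4 (Add (R 4) (M 4 (R 3))))"
  let ?s1 = "result ?P1 s"
  have s1: "?s1 = s(adr 0 3 := int p)"
    using env t inp_par[OF t(1)] pb p by (simp add: Env_def)
  have inW: "adr 0 3 \<in> ?W" "adr 0 4 \<in> ?W" "adr 9 (int p) \<in> ?W" by (simp_all add: adr_in_W)
  have ag1: "agree ?W s ?s1" unfolding s1 using inW by (simp add: agree_upd)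
  have env1: "Env ?s1" by (intro Env_agree[OF env ag1]) auto
  have pre: "?s1 (adr 0 2) = int t" "?s1 (adr 0 3) = int p" "Stamp ?s1" "?s1 (adr 0 4) = nx"
    "?s1 (adr 9 (int p)) = cp" "?s1 (adr 9 (int t)) = ct" "\<And>x. nx \<le> x \<Longrightarrow> ?s1 (adr 8 x) = 0"
    unfolding s1 using t stamp nx cp ct z by (simp_all add: adr_eq_iff Stamp_def)
  have s1_8: "?s1 (adr 8 x) = s (adr 8 x)" "?s1 (adr 9 x) = s (adr 9 x)" for x unfolding s1 by (simp_all add: adr_eq_iff)
  have "halts push (100 + (25 ^ B * ((B + 1) * ((B + 1) * 120000)) + 400)) ?Q s"
    unfolding push_def
  proof (rule halts_Seq[OF halts_straight])
    show "halts (Seq (For 5 (M 4 (R 2)) child_body) ?P3) (25 ^ B * ((B + 1) * ((B + 1) * 120000)) + 400) ?Q ?s1"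
    proof (rule halts_Seq'[OF halts_child_loop[OF env1 t(1) pre(1) pm pre(2-6) cp0 ct0 pre(7)]])
      fix s2 assume s2: "agree (W ({5..18} \<union> {20}) {8, 10, 11, 12}) ?s1 s2 \<and> Stamp s2 \<and>
        (\<forall>x. x < nx \<or> nx + 5 ^ length (bags ! p) \<le> x \<longrightarrow> s2 (adr 8 x) = ?s1 (adr 8 x)) \<and>
        (\<forall>g. 0 \<le> g \<and> g < 5 ^ length (bags ! p) \<longrightarrow> minval (s2 (adr 8 (nx + g)))
          (all_push_costs (bags ! t) (bags ! p) (\<lambda>c. ?s1 (adr 8 (ct + c))) (\<lambda>c. ?s1 (adr 8 (cp + c))) g))"
      then have a2: "agree (W ({5..18} \<union> {20}) {8, 10, 11, 12}) ?s1 s2" and st2: "Stamp s2" by blast+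
      have "agree ?W ?s1 s2" by (rule agree_mono[OF a2 W_mono]) auto
      then have ag2: "agree ?W s s2" using ag1 agree_trans by blast
      have env2: "Env s2" by (intro Env_agree[OF env ag2]) auto
      have r2: "s2 (adr 0 3) = int p" "s2 (adr 0 4) = nx" "s2 (adr 9 x) = s (adr 9 x)" for x
        using agree_adr[OF a2, of 0 3] agree_adr[OF a2, of 0 4] agree_adr[OF a2, of 9 x] pre
        unfolding s1_8 by (simp_all add: s1_8)
      have cnt: "s2 (adr 4 (int p)) = 5 ^ length (bags ! p)" using env2 pm by (simp add: Env_def)
      show "halts ?P3 400 ?Q s2"
      proof (rule halts_straight)
        let ?r = "result ?P3 s2"
        have r: "?r = s2(adr 9 (int p) := nx, adr 0 4 := nx + 5 ^ length (bags ! p))"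
          using r2 cnt by (simp add: adr_eq_iff)
        have "agree ?W s ?r" unfolding r using ag2 inW by (simp add: agree_upd)
        moreover from this have "Env ?r" by (intro Env_agree[OF env]) auto
        moreover have "Stamp ?r" unfolding r using st2 by (simp add: Stamp_def adr_eq_iff)
        moreover have "?r (adr 0 3) = int p" "?r (adr 0 4) = nx + 5 ^ length (bags ! p)"
          unfolding r using r2 by (simp_all add: adr_eq_iff)
        moreover have "\<forall>x. ?r (adr 9 x) = (if x = int p then nx else s (adr 9 x))"
          unfolding r using r2(3) by (simp add: adr_eq_iff)
        moreover have r8: "?r (adr 8 x) = s2 (adr 8 x)" for x unfolding r by (simp add: adr_eq_iff)
        moreover have "\<forall>x. x < nx \<or> nx + 5 ^ length (bags ! p) \<le> x \<longrightarrow> ?r (adr 8 x) = s (adr 8 x)"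
          unfolding r8 using s2 unfolding s1_8 by blast
        moreover have "\<forall>g. 0 \<le> g \<and> g < 5 ^ length (bags ! p) \<longrightarrow> minval (?r (adr 8 (nx + g)))
          (all_push_costs (bags ! t) (bags ! p) (\<lambda>c. s (adr 8 (ct + c))) (\<lambda>c. s (adr 8 (cp + c))) g)"
          unfolding r8 using s2 unfolding s1_8 by blast
        ultimately show "?Q ?r" by blast
      qed simp_all
    qed
  qed simp_all
  then show ?thesis
  proof (rule halts_mono)
    have "1 * (1 * 1) \<le> 25 ^ B * ((B + 1) * (B + 1))" by (intro mult_le_mono) simp_all
    then have "100 + (120000 * (25 ^ B * ((B + 1) * (B + 1))) + 400) \<le> 130000 * (25 ^ B * ((B + 1) * (B + 1)))" by linarith
    then show "100 + (25 ^ B * ((B + 1) * ((B + 1) * 120000)) + 400) \<le> 25 ^ B * ((B + 1) * ((B + 1) * 130000))"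
      by (simp only: mult_ac)
  qed
qed

text \<open>Lets a table survive writes to bank 8 outside its own range of codes.\<close>

lemma represents_cong:
  assumes "represents xs FF T" "\<And>c. 0 \<le> c \<Longrightarrow> c < 5 ^ length xs \<Longrightarrow> T c = T' c"
  shows "represents xs FF T'"
  unfolding represents_def
proof (intro allI impI)
  fix lab :: "nat \<Rightarrow> int" assume l: "\<forall>u\<in>set xs. lab u \<in> {0..4}"
  have "T (code (map lab xs)) = T' (code (map lab xs))"
    using code_map_range[of xs lab] l by (intro assms(2)) auto
  then show "minval (T' (code (map lab xs))) ((\<lambda>c. int c + 1) ` {c. realizable FF (set xs) lab c})"
    using assms(1) l unfolding represents_def by metis
qed

end

locale solver = treedec G "{0..<m}" r "\<lambda>t. par ! t" "\<lambda>t. set (bags ! t)" +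
  instance_memory n "treedec.adj G" m par bags pb off F B inp
  for G :: "nat pair_pre_digraph" and r :: nat and n m :: nat and par bags pb off F B inp +
  assumes V: "pverts G = {0..<n}"
begin

text \<open>The root is counted as its own child, so it never becomes ready.\<close>

definition Inv :: "nat \<Rightarrow> nat set \<Rightarrow> memory \<Rightarrow> bool" where
  "Inv x D s \<longleftrightarrow> Env s \<and> Stamp s \<and> D \<subseteq> {0..<m} - {r} \<and> (\<forall>q\<in>D. ch q \<subseteq> D) \<and>
    (\<forall>y\<ge>s (adr 0 4). s (adr 8 y) = 0) \<and>
    (\<forall>q<m. q \<notin> D \<longrightarrow> 0 \<le> s (adr 9 (int q)) \<and> s (adr 9 (int q)) + 5 ^ length (bags ! q) \<le> s (adr 0 4) \<and>
       represents (bags ! q) (forgotten q (ch q \<inter> D)) (\<lambda>c. s (adr 8 (s (adr 9 (int q)) + c)))) \<and>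
    (\<forall>q<m. s (adr 5 (int q)) = (if q \<in> D then 1 else int (card (ch q - D)) + (if q = r then 1 else 0))) \<and>
    (\<exists>t0 t. s (adr 0 19) = int t0 \<and> s (adr 0 2) = int t \<and> t0 \<le> m \<and> (t0 < m \<longrightarrow> t < m) \<and> (t0 = m \<longrightarrow> t = m) \<and>
       x = (m - card D) + (m - t0) \<and>
       (\<forall>q<m. q \<le> t0 \<and> q \<notin> D \<and> s (adr 5 (int q)) = 0 \<longrightarrow> q = t))"

lemma InvI:
  assumes "Env s" "Stamp s" "D \<subseteq> {0..<m} - {r}" "\<forall>q\<in>D. ch q \<subseteq> D"
    "\<forall>y\<ge>s (adr 0 4). s (adr 8 y) = 0"
    "\<forall>q<m. q \<notin> D \<longrightarrow> 0 \<le> s (adr 9 (int q)) \<and> s (adr 9 (int q)) + 5 ^ length (bags ! q) \<le> s (adr 0 4) \<and>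
       represents (bags ! q) (forgotten q (ch q \<inter> D)) (\<lambda>c. s (adr 8 (s (adr 9 (int q)) + c)))"
    "\<forall>q<m. s (adr 5 (int q)) = (if q \<in> D then 1 else int (card (ch q - D)) + (if q = r then 1 else 0))"
    "s (adr 0 19) = int i" "s (adr 0 2) = int j"
    "i \<le> m \<and> (i < m \<longrightarrow> j < m) \<and> (i = m \<longrightarrow> j = m)" "x = (m - card D) + (m - i)"
    "\<forall>q<m. q \<le> i \<and> q \<notin> D \<and> s (adr 5 (int q)) = 0 \<longrightarrow> q = j"
  shows "Inv x D s"
  unfolding Inv_def using assms(10) by (intro conjI exI[of _ i] exI[of _ j] assms(1-9,11,12)) blast+

lemma finite_ch [simp]: "finite (ch q)"
  by (simp add: children_def)

text \<open>An unfinished node other than the root would have an unfinished child, whose subtree is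
  strictly smaller; this descent cannot continue forever.\<close>

lemma all_done:
  assumes D: "\<forall>q<m. q \<notin> D \<longrightarrow> q \<noteq> r \<longrightarrow> ch q - D \<noteq> {}"
  shows "q < m \<Longrightarrow> q \<noteq> r \<Longrightarrow> q \<in> D"
proof (induction "card (desc q)" arbitrary: q rule: less_induct)
  case less
  show ?case
  proof (rule ccontr)
    assume "q \<notin> D"
    then obtain c where c: "c \<in> ch q" "c \<notin> D" using D less.prems by blast
    have cp: "c \<in> {0..<m}" "c \<noteq> r" "par ! c = q" using ch_props[OF c(1)] less.prems by auto
    have "desc c \<subseteq> desc q" using desc_rec[of q] c(1) less.prems(1) by auto
    moreover have "q \<notin> desc c" using p_not_desc[OF cp(1,2)] cp(3) by simp
    moreover have "q \<in> desc q" using desc_refl less.prems(1) by simp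
    ultimately have "desc c \<subset> desc q" by blast
    moreover have "finite (desc q)" using rooted(1) by (simp add: desc_def)
    ultimately have "card (desc c) < card (desc q)" by (rule psubset_card_mono[rotated])
    then show False using less.hyps[of c] cp c(2) by simp
  qed
qed

text \<open>Every step advances the index or finishes a node, and \<open>x\<close> is the sum of
  what is left of both. One scan suffices because, among the nodes up to the index, only the current
  one can be ready.\<close>

lemma halts_main_step:
  assumes I: "Inv x D s" and run: "0 < int m - s (adr 0 19)"
  shows "halts main_step (25 ^ B * ((B + 1) * ((B + 1) * 140000))) (\<lambda>s'. \<exists>y<x. \<exists>D'. Inv y D' s') s"
proof -
  let ?Q = "\<lambda>s'. \<exists>y<x. \<exists>D'. Inv y D' s'"
  obtain t0 t where t0: "s (adr 0 19) = int t0" and t: "s (adr 0 2) = int t" and t0m: "t0 \<le> m" and tm: "t0 < m \<longrightarrow> t < m"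
    and x: "x = (m - card D) + (m - t0)"
    and zero: "\<forall>q<m. q \<le> t0 \<and> q \<notin> D \<and> s (adr 5 (int q)) = 0 \<longrightarrow> q = t"
    using I unfolding Inv_def by (elim conjE exE)
  have env: "Env s" and st: "Stamp s" and D: "D \<subseteq> {0..<m} - {r}" "\<forall>q\<in>D. ch q \<subseteq> D"
    and z: "\<forall>y\<ge>s (adr 0 4). s (adr 8 y) = 0"
    and tab: "\<forall>q<m. q \<notin> D \<longrightarrow> 0 \<le> s (adr 9 (int q)) \<and> s (adr 9 (int q)) + 5 ^ length (bags ! q) \<le> s (adr 0 4) \<and>
       represents (bags ! q) (forgotten q (ch q \<inter> D)) (\<lambda>c. s (adr 8 (s (adr 9 (int q)) + c)))"
    and pend: "\<forall>q<m. s (adr 5 (int q)) = (if q \<in> D then 1 else int (card (ch q - D)) + (if q = r then 1 else 0))"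
    using I unfolding Inv_def by blast+
  have t0m': "t0 < m" and tm': "t < m" using run t0 tm by auto
  have finD: "finite D" using D(1) finite_subset by blast
  have cD: "card D \<le> m" using card_mono[of "{0..<m}" D] D(1) by auto
  let ?P1 = "Seq (Set 19 (Add (R 19) (Const 1))) (Set 2 (R 19))"
  let ?P3 = "Seq (Store (A 5 (R 2)) (Const 1))
       (Seq (Set 2 (R 3)) (Store (A 5 (R 3)) (Sub (M 5 (R 3)) (Const 1))))"
  let ?tp = "25 ^ B * ((B + 1) * ((B + 1) * 130000))"
  have adv: "halts ?P1 (?tp + 2000) ?Q s" if pos: "0 < s (adr 5 (int t))"
  proof (rule halts_straight)
    let ?r = "result ?P1 s"
    have r: "?r = s(adr 0 19 := int (Suc t0), adr 0 2 := int (Suc t0))"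
      using t0 by (simp add: adr_eq_iff add.commute)
    have rr: "?r (adr c y) = s (adr c y)" if "c \<in> {5, 8, 9, 10}" for c y
      unfolding r using that by (auto simp: adr_eq_iff)
    have "agree (W {2, 19} {}) s ?r" unfolding r by (simp add: agree_upd adr_in_W)
    then have c1: "Env ?r" by (intro Env_agree[OF env]) auto
    have c2: "Stamp ?r" using st unfolding Stamp_def by (simp only: rr insert_iff simp_thms)
    have c3: "?r (adr 0 4) = s (adr 0 4)" "?r (adr 0 19) = int (Suc t0)" "?r (adr 0 2) = int (Suc t0)"
      unfolding r by (simp_all add: adr_eq_iff)
    \<comment> \<open>\<open>t\<close> was the only candidate up to \<open>t0\<close> and turned out
      not to be ready, so only the node reached by the index remains.\<close>
    have c4: "\<forall>q<m. q \<le> Suc t0 \<and> q \<notin> D \<and> s (adr 5 (int q)) = 0 \<longrightarrow> q = Suc t0"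
      using zero pos by (auto simp: le_Suc_eq)
    have c5: "?r (adr 5 y) = s (adr 5 y)" "?r (adr 8 y) = s (adr 8 y)" "?r (adr 9 y) = s (adr 9 y)" for y
      using rr by simp_all
    define w where "w = ?r"
    note cs = c1[folded w_def] c2[folded w_def] c3[folded w_def] c4 c5[folded w_def]
    have "Inv ((m - card D) + (m - Suc t0)) D w"
    proof (rule InvI[where i = "Suc t0" and j = "Suc t0"])
      show "Suc t0 \<le> m \<and> (Suc t0 < m \<longrightarrow> Suc t0 < m) \<and> (Suc t0 = m \<longrightarrow> Suc t0 = m)" using t0m' by simp
      show "\<forall>y\<ge>w (adr 0 4). w (adr 8 y) = 0" unfolding cs(3,8) by (rule z)
      show "\<forall>q<m. q \<notin> D \<longrightarrow> 0 \<le> w (adr 9 (int q)) \<and> w (adr 9 (int q)) + 5 ^ length (bags ! q) \<le> w (adr 0 4) \<and>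
         represents (bags ! q) (forgotten q (ch q \<inter> D)) (\<lambda>c. w (adr 8 (w (adr 9 (int q)) + c)))"
        unfolding cs(3,8,9) by (rule tab)
      show "\<forall>q<m. w (adr 5 (int q)) = (if q \<in> D then 1 else int (card (ch q - D)) + (if q = r then 1 else 0))"
        unfolding cs(7) by (rule pend)
      show "\<forall>q<m. q \<le> Suc t0 \<and> q \<notin> D \<and> w (adr 5 (int q)) = 0 \<longrightarrow> q = Suc t0"
        unfolding cs(7) by (rule c4)
    qed (fact cs D refl)+
    moreover have "(m - card D) + (m - Suc t0) < x" using x t0m' by simp
    ultimately show "?Q ?r" unfolding w_def by blast
  qed simp_all
  have work: "halts (Seq push ?P3) (?tp + 2000) ?Q s" if np: "\<not> 0 < s (adr 5 (int t))"
  proof -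
    have pt: "s (adr 5 (int t)) = (if t \<in> D then 1 else int (card (ch t - D)) + (if t = r then 1 else 0))"
      using pend tm' by blast
    then have tD: "t \<notin> D" and tr: "t \<noteq> r" and c0: "card (ch t - D) = 0" using np by (auto split: if_splits)
    have chD: "ch t \<subseteq> D" using c0 by auto
    define p where "p = par ! t"
    have tT: "t \<in> {0..<m}" using tm' by simp
    have pm: "p < m" using par[OF tm'] by (simp add: p_def)
    have ptne: "p \<noteq> t" using p_not_desc[OF tT tr] desc_refl[OF tT] by (auto simp: p_def)
    have tch: "t \<in> ch p" using tm' ptne by (simp add: children_def p_def)
    have pD: "p \<notin> D" using D(2) tch tD by blast
    let ?nx = "s (adr 0 4)" and ?cp = "s (adr 9 (int p))" and ?ct = "s (adr 9 (int t))"
    have tabp: "0 \<le> ?cp" "?cp + 5 ^ length (bags ! p) \<le> ?nx"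
      "represents (bags ! p) (forgotten p (ch p \<inter> D)) (\<lambda>c. s (adr 8 (?cp + c)))" using tab pm pD by blast+
    have "ch t \<inter> D = ch t" using chD by blast
    then have tabt: "0 \<le> ?ct" "?ct + 5 ^ length (bags ! t) \<le> ?nx"
      "represents (bags ! t) (forgotten t (ch t)) (\<lambda>c. s (adr 8 (?ct + c)))" using tab tm' tD by metis+
    show ?thesis
    proof (rule halts_Seq'[OF halts_push[OF env tm' t p_def st refl refl refl tabp(1,2) tabt(1,2)]])
      show "s (adr 8 y) = 0" if "?nx \<le> y" for y using z that by blast
      fix s1 assume s1: "agree (W ({3..18} \<union> {20}) {8, 9, 10, 11, 12}) s s1 \<and> Env s1 \<and> Stamp s1 \<and>
        s1 (adr 0 3) = int p \<and> s1 (adr 0 4) = ?nx + 5 ^ length (bags ! p) \<and>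
        (\<forall>x. s1 (adr 9 x) = (if x = int p then ?nx else s (adr 9 x))) \<and>
        (\<forall>x. x < ?nx \<or> ?nx + 5 ^ length (bags ! p) \<le> x \<longrightarrow> s1 (adr 8 x) = s (adr 8 x)) \<and>
        (\<forall>g. 0 \<le> g \<and> g < 5 ^ length (bags ! p) \<longrightarrow> minval (s1 (adr 8 (?nx + g)))
          (all_push_costs (bags ! t) (bags ! p) (\<lambda>c. s (adr 8 (?ct + c))) (\<lambda>c. s (adr 8 (?cp + c))) g))"
      then have a1: "agree (W ({3..18} \<union> {20}) {8, 9, 10, 11, 12}) s s1" and env1: "Env s1" and st1: "Stamp s1"
        and r3: "s1 (adr 0 3) = int p" and r4: "s1 (adr 0 4) = ?nx + 5 ^ length (bags ! p)"
        and r9: "\<And>x. s1 (adr 9 x) = (if x = int p then ?nx else s (adr 9 x))"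
        and r8: "\<And>x. x < ?nx \<or> ?nx + 5 ^ length (bags ! p) \<le> x \<Longrightarrow> s1 (adr 8 x) = s (adr 8 x)"
        and mv: "\<And>g. 0 \<le> g \<Longrightarrow> g < 5 ^ length (bags ! p) \<Longrightarrow> minval (s1 (adr 8 (?nx + g)))
          (all_push_costs (bags ! t) (bags ! p) (\<lambda>c. s (adr 8 (?ct + c))) (\<lambda>c. s (adr 8 (?cp + c))) g)" by blast+
      have r2: "s1 (adr 0 2) = int t" "s1 (adr 0 19) = int t0" "s1 (adr 5 y) = s (adr 5 y)" for y
        using agree_adr[OF a1, of 0 2] agree_adr[OF a1, of 0 19] agree_adr[OF a1, of 5 y] t t0 by simp_all
      \<comment> \<open>All children of \<open>t\<close> are finished, so its table covers its whole
        subtree, and the push adds exactly \<open>t\<close> to the children absorbed by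
        \<open>p\<close>.\<close>
      have newtab: "represents (bags ! p) (forgotten p (ch p \<inter> insert t D)) (\<lambda>c. s1 (adr 8 (?nx + c)))"
      proof -
        have Q: "ch p \<inter> D \<subseteq> ch (par ! t)" "t \<notin> ch p \<inter> D" using tD by (auto simp: p_def)
        note pf = push_forgotten[OF tT tr Q] push_nb[OF tT tr Q] push_disj[OF tT tr Q] forgotten_nb[OF tT tr Q]
        have "represents (bags ! p) (forgotten p (ch p \<inter> D) \<union> (forgotten t (ch t) \<union> (set (bags ! t) - set (bags ! p))))
          (\<lambda>c. s1 (adr 8 (?nx + c)))"
        proof (rule push_correct[OF bag_distinct[OF tm'] bag_distinct[OF pm] tabt(3) tabp(3) finite_forgotten(1) finite_forgotten(1)])
          show "forgotten t (ch t) \<inter> set (bags ! t) = {}" "forgotten p (ch p \<inter> D) \<inter> set (bags ! p) = {}"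
            by (auto simp: forgotten_def)
        qed (use pf mv in \<open>auto simp: p_def\<close>)
        moreover have "ch p \<inter> insert t D = insert t (ch p \<inter> D)" using tch by blast
        ultimately show ?thesis using pf(1) by (simp add: p_def)
      qed
      show "halts ?P3 2000 ?Q s1"
      proof (rule halts_straight)
        let ?r = "result ?P3 s1"
        let ?D = "insert t D"
        have r: "?r = s1(adr 5 (int t) := 1, adr 0 2 := int p, adr 5 (int p) := s (adr 5 (int p)) - 1)"
          using r2 r3 ptne by (simp add: adr_eq_iff)
        have rr: "?r (adr c y) = s1 (adr c y)" if "c \<in> {8, 9, 10}" for c y
          unfolding r using that by (auto simp: adr_eq_iff)
        have "agree (W {2} {5}) s1 ?r" unfolding r by (simp add: agree_upd adr_in_W)
        then have c1: "Env ?r" by (intro Env_agree[OF env1]) auto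
        have c2: "Stamp ?r" using st1 unfolding Stamp_def by (simp only: rr insert_iff simp_thms)
        have c3: "?r (adr 0 4) = ?nx + 5 ^ length (bags ! p)" "?r (adr 0 19) = int t0" "?r (adr 0 2) = int p"
          unfolding r using r2 r4 by (simp_all add: adr_eq_iff)
        have c4: "?D \<subseteq> {0..<m} - {r}" "\<forall>q\<in>?D. ch q \<subseteq> ?D" using D chD tr tm' by auto
        have c5: "\<forall>y\<ge>?r (adr 0 4). ?r (adr 8 y) = 0"
        proof (intro allI impI)
          fix y assume "?r (adr 0 4) \<le> y"
          then have y: "?nx + 5 ^ length (bags ! p) \<le> y" using c3(1) by simp
          moreover have "(0::int) \<le> 5 ^ length (bags ! p)" by simp
          ultimately have "?nx \<le> y" by linarith
          then show "?r (adr 8 y) = 0" using r8[of y] y z rr[of 8 y] by simp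
        qed
        have c6: "\<forall>q<m. q \<notin> ?D \<longrightarrow> 0 \<le> ?r (adr 9 (int q)) \<and> ?r (adr 9 (int q)) + 5 ^ length (bags ! q) \<le> ?r (adr 0 4) \<and>
          represents (bags ! q) (forgotten q (ch q \<inter> ?D)) (\<lambda>c. ?r (adr 8 (?r (adr 9 (int q)) + c)))"
        proof (intro allI impI)
          fix q assume q: "q < m" "q \<notin> ?D"
          have R: "?r (adr 9 (int q)) = (if q = p then ?nx else s (adr 9 (int q)))" "?r (adr 8 y) = s1 (adr 8 y)" for y
            using rr[of 9 "int q"] rr[of 8 y] r9[of "int q"] by simp_all
          show "0 \<le> ?r (adr 9 (int q)) \<and> ?r (adr 9 (int q)) + 5 ^ length (bags ! q) \<le> ?r (adr 0 4) \<and>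
            represents (bags ! q) (forgotten q (ch q \<inter> ?D)) (\<lambda>c. ?r (adr 8 (?r (adr 9 (int q)) + c)))"
          proof (cases "q = p")
            case True
            have "0 \<le> ?nx" using tabp(1,2) zero_le_power[of "5::int" "length (bags ! p)"] by linarith
            then show ?thesis unfolding R c3(1) using True newtab by simp
          next
            case False
            have tq: "0 \<le> s (adr 9 (int q))" "s (adr 9 (int q)) + 5 ^ length (bags ! q) \<le> ?nx"
              "represents (bags ! q) (forgotten q (ch q \<inter> D)) (\<lambda>c. s (adr 8 (s (adr 9 (int q)) + c)))"
              using tab q by blast+
            have "t \<notin> ch q" using False by (auto simp: children_def p_def)
            then have chq: "ch q \<inter> ?D = ch q \<inter> D" by blast
            have "represents (bags ! q) (forgotten q (ch q \<inter> D)) (\<lambda>c. s1 (adr 8 (s (adr 9 (int q)) + c)))"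
            proof (rule represents_cong[OF tq(3)])
              fix c :: int assume "0 \<le> c" "c < 5 ^ length (bags ! q)"
              then have "s (adr 9 (int q)) + c < ?nx" using tq(2) by linarith
              then show "s (adr 8 (s (adr 9 (int q)) + c)) = s1 (adr 8 (s (adr 9 (int q)) + c))" using r8 by simp
            qed
            moreover have "s (adr 9 (int q)) + 5 ^ length (bags ! q) \<le> ?nx + 5 ^ length (bags ! p)"
              using tq(2) zero_le_power[of "5::int" "length (bags ! p)"] by linarith
            ultimately show ?thesis unfolding R c3(1) chq using False tq(1) by simp
          qed
        qed
        have r5: "?r (adr 5 (int q)) = (if q = p then s (adr 5 (int p)) - 1 else if q = t then 1 else s (adr 5 (int q)))" for q
          unfolding r using r2(3) by (simp add: adr_eq_iff)
        have c7: "\<forall>q<m. ?r (adr 5 (int q)) = (if q \<in> ?D then 1 else int (card (ch q - ?D)) + (if q = r then 1 else 0))"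
        proof (intro allI impI)
          fix q assume q: "q < m"
          show "?r (adr 5 (int q)) = (if q \<in> ?D then 1 else int (card (ch q - ?D)) + (if q = r then 1 else 0))"
          proof (cases "q = p")
            case True
            have "ch p - ?D = (ch p - D) - {t}" by blast
            moreover have "t \<in> ch p - D" using tch tD by blast
            ultimately have "card (ch p - D) = Suc (card (ch p - ?D))"
              using card.remove[of "ch p - D" t] by simp
            moreover have "s (adr 5 (int p)) = int (card (ch p - D)) + (if p = r then 1 else 0)" using pend pm pD by simp
            ultimately show ?thesis unfolding r5 using True pD ptne by simp
          next
            case False
            then have "t \<notin> ch q" by (auto simp: children_def p_def)
            then have "ch q - ?D = ch q - D" by blast
            then show ?thesis unfolding r5 using False pend q by simp
          qed
        qed
        \<comment> \<open>Among the unfinished nodes only \<open>p\<close> had its count lowered, so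
          no other node can have become ready.\<close>
        have c8: "\<forall>q<m. q \<le> t0 \<and> q \<notin> ?D \<and> ?r (adr 5 (int q)) = 0 \<longrightarrow> q = p"
        proof (intro allI impI)
          fix q assume q: "q < m" "q \<le> t0 \<and> q \<notin> ?D \<and> ?r (adr 5 (int q)) = 0"
          show "q = p"
          proof (rule ccontr)
            assume "q \<noteq> p"
            moreover have "q \<noteq> t" using q(2) by blast
            ultimately have "?r (adr 5 (int q)) = s (adr 5 (int q))" unfolding r5 by simp
            then have "s (adr 5 (int q)) = 0" using q(2) by metis
            then show False using zero q by blast
          qed
        qed
        have cd: "card ?D = Suc (card D)" using finD tD by simp
        have "card ?D \<le> m" using card_mono[of "{0..<m}" ?D] c4(1) by auto
        then have lt: "(m - card ?D) + (m - t0) < x" unfolding x cd by simp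
        have c9: "t0 \<le> m \<and> (t0 < m \<longrightarrow> p < m) \<and> (t0 = m \<longrightarrow> p = m)" using t0m' pm by simp
        define w where "w = ?r"
        have "Inv ((m - card ?D) + (m - t0)) ?D w"
          by (rule InvI[where i = t0 and j = p])
            (fact c1[folded w_def] c2[folded w_def] c3(2,3)[folded w_def] c4 c5[folded w_def] c6[folded w_def]
              c7[folded w_def] c8[folded w_def] c9 refl)+
        then show "?Q ?r" using lt unfolding w_def by blast
      qed simp_all
    qed
  qed
  have "halts main_step (cost (M 5 (R 2)) + 1 + (?tp + 2000)) ?Q s"
    unfolding main_step_def by (rule halts_IfPos) (use adv work t in simp_all)
  then show ?thesis
  proof (rule halts_mono)
    have "1 * (1 * 1) \<le> 25 ^ B * ((B + 1) * (B + 1))" by (intro mult_le_mono) simp_all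
    then have "51 + (130000 * (25 ^ B * ((B + 1) * (B + 1))) + 2000) \<le> 140000 * (25 ^ B * ((B + 1) * (B + 1)))" by linarith
    then have "51 + (?tp + 2000) \<le> 25 ^ B * ((B + 1) * ((B + 1) * 140000))"
      by (simp only: mult_ac)
    then show "cost (M 5 (R 2)) + 1 + (?tp + 2000) \<le> 25 ^ B * ((B + 1) * ((B + 1) * 140000))" by simp
  qed
qed

lemma halts_main_loop:
  assumes I: "Inv (2 * m) {} s"
  shows "halts main_loop ((2 * m + 1) * (25 ^ B * ((B + 1) * ((B + 1) * 150000)))) (\<lambda>s'. Env s' \<and>
    0 \<le> s' (adr 9 (int r)) \<and> represents (bags ! r) (forgotten r (ch r)) (\<lambda>c. s' (adr 8 (s' (adr 9 (int r)) + c)))) s"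
proof -
  let ?t = "25 ^ B * ((B + 1) * ((B + 1) * 140000))"
  let ?c = "Sub (Load (Const 3)) (R 19)"
  have "halts main_loop ((2 * m + 1) * (?t + cost ?c + 1)) (\<lambda>s'. Env s' \<and>
    0 \<le> s' (adr 9 (int r)) \<and> represents (bags ! r) (forgotten r (ch r)) (\<lambda>c. s' (adr 8 (s' (adr 9 (int r)) + c)))) s"
    unfolding main_loop_def
  proof (rule halts_While[where I = "\<lambda>x s. \<exists>D. Inv x D s"])
    show "\<exists>D. Inv (2 * m) D s" using I by blast
    have ev: "eval ?c s = int m - s (adr 0 19)" if "Inv x D s" for x D s
      using that inp_m by (simp add: Inv_def Env_def)
    show "halts main_step ?t (\<lambda>s'. \<exists>y<x. \<exists>D. Inv y D s') s" if J: "\<exists>D. Inv x D s" and pos: "0 < eval ?c s" for x s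
    proof -
      obtain D where D: "Inv x D s" using J by blast
      then show ?thesis using halts_main_step[OF D] ev[OF D] pos by simp
    qed
    fix x s assume J: "\<exists>D. Inv x D s" and neg: "eval ?c s \<le> 0"
    obtain D where D: "Inv x D s" using J by blast
    obtain t0 t where t0: "s (adr 0 19) = int t0" and t: "s (adr 0 2) = int t" and t0m: "t0 \<le> m" and tm: "t0 = m \<longrightarrow> t = m"
      and zero: "\<forall>q<m. q \<le> t0 \<and> q \<notin> D \<and> s (adr 5 (int q)) = 0 \<longrightarrow> q = t"
      using D unfolding Inv_def by (elim conjE exE)
    \<comment> \<open>At the end of the scan the only admissible ready node is \<open>m\<close>,
      which is not a node; hence every unfinished node has a positive count.\<close>
    have t0': "t0 = m" "t = m" using ev[OF D] neg t0 t0m tm by auto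
    have pend: "\<forall>q<m. s (adr 5 (int q)) = (if q \<in> D then 1 else int (card (ch q - D)) + (if q = r then 1 else 0))"
      using D unfolding Inv_def by blast
    have "\<forall>q<m. q \<notin> D \<longrightarrow> q \<noteq> r \<longrightarrow> ch q - D \<noteq> {}"
    proof (intro allI impI)
      fix q assume q: "q < m" "q \<notin> D" "q \<noteq> r"
      then have "s (adr 5 (int q)) \<noteq> 0" using zero t0' by auto
      then have "card (ch q - D) \<noteq> 0" using pend q by simp
      then show "ch q - D \<noteq> {}" by auto
    qed
    then have all: "\<And>q. q < m \<Longrightarrow> q \<noteq> r \<Longrightarrow> q \<in> D" by (rule all_done)
    have rm: "r < m" using rooted(2) by simp
    have "c \<in> D" if "c \<in> ch r" for c using all ch_props[OF that] rm by auto
    then have "ch r \<inter> D = ch r" by blast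
    moreover have "r \<notin> D" using D unfolding Inv_def by blast
    ultimately show "Env s \<and> 0 \<le> s (adr 9 (int r)) \<and>
      represents (bags ! r) (forgotten r (ch r)) (\<lambda>c. s (adr 8 (s (adr 9 (int r)) + c)))"
      using D rm unfolding Inv_def by metis
  qed
  then show ?thesis
  proof (rule halts_mono)
    have "1 * (1 * 1) \<le> 25 ^ B * ((B + 1) * (B + 1))" by (intro mult_le_mono) simp_all
    then have "140000 * (25 ^ B * ((B + 1) * (B + 1))) + 6 \<le> 150000 * (25 ^ B * ((B + 1) * (B + 1)))" by linarith
    then have "?t + 6 \<le> 25 ^ B * ((B + 1) * ((B + 1) * 150000))"
      by (simp only: mult_ac)
    then show "(2 * m + 1) * (?t + cost ?c + 1) \<le> (2 * m + 1) * (25 ^ B * ((B + 1) * ((B + 1) * 150000)))"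
      by (intro mult_le_mono2) simp
  qed
qed

end

section \<open>Reading the input\<close>

text \<open>Row offsets are multiples of \<open>n\<close>, obtained by repeated addition. The matrix
  itself is not cleared: its cells are zero from the start, and visiting all \<open>n * n\<close> of
  them would exceed the time bound.\<close>

definition init_rows :: prog where
  "init_rows = For 5 (Load (Const 0)) (Seq (Store (A 1 (R 5)) (R 6)) (Set 6 (Add (R 6) (Load (Const 0)))))"

text \<open>The header occupies addresses 0 to 3. After the last edge, register 1 points to the list
  of parents, where it stays.\<close>

definition init_edges :: prog where
  "init_edges = Seq (Set 1 (Const 4)) (For 5 (Load (Const 2))
     (Seq (Set 9 (Load (R 1))) (Seq (Set 10 (Load (Add (R 1) (Const 1))))
       (Seq (Store (A 2 (Add (M 1 (R 9)) (R 10))) (Const 1))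
         (Seq (Store (A 2 (Add (M 1 (R 10)) (R 9))) (Const 1)) (Set 1 (Add (R 1) (Const 2))))))))"

text \<open>Register 2 walks over the bag records of varying length. The powers of 5 are summed in
  register 4; the sum serves as the range of the digit tables and as the first free index of bank
  8.\<close>

definition init_nodes :: prog where
  "init_nodes = Seq (Seq (Set 2 (Add (R 1) (Load (Const 3)))) (Set 4 (Const 0))) (For 5 (Load (Const 3))
     (Seq (Seq (Store (A 3 (R 5)) (R 2)) (Set 6 (Const 1)))
       (Seq (For 7 (Load (R 2)) (Set 6 (Add (R 6) (dbl (dbl (R 6))))))
         (Seq (Store (A 4 (R 5)) (R 6)) (Seq (Set 4 (Add (R 4) (R 6)))
           (Seq (Set 2 (Add (Add (R 2) (Const 1)) (Load (R 2))))
             (Seq (Set 3 (Load (Add (R 1) (R 5)))) (Store (A 5 (R 3)) (Add (M 5 (R 3)) (Const 1))))))))))"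

text \<open>
  Table entries are 1 plus the number of deletions, with 0 for impossible labellings. The table at
  index 0, where all entries with digits at most 2 are 1, is the initial table of every node: whether
  a code has only such digits does not depend on the length of the bag.
\<close>

definition init_digits :: prog where
  "init_digits = Seq (Seq (Set 6 (Const 0)) (Seq (Set 7 (Const 0)) (Store (A 8 (Const 0)) (Const 1))))
     (For 5 (R 4)
       (Seq (Store (A 6 (R 5)) (R 6)) (Seq (Store (A 7 (R 5)) (R 7))
         (Seq (IfPos (Sub (R 7) (Const 2)) Skip (Store (A 8 (R 5)) (M 8 (R 6))))
           (Seq (Set 7 (Add (R 7) (Const 1)))
             (IfPos (Sub (R 7) (Const 4)) (Seq (Set 7 (Const 0)) (Set 6 (Add (R 6) (Const 1)))) Skip))))))"

definition find_root :: prog where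
  "find_root = For 5 (Load (Const 3)) (Seq (Set 3 (Load (Add (R 1) (R 5))))
     (IfPos (Sub (R 3) (R 5)) Skip (IfPos (Sub (R 5) (R 3)) Skip (Set 21 (R 5)))))"

text \<open>The empty root bag has the single code 0, so its table is one cell. The entry exceeds
  the number of deletions by one, hence the comparison with \<open>k + 2\<close>; entry 0 would mean
  that there is no solution.\<close>

definition answer :: prog where
  "answer = IfPos (M 8 (M 9 (R 21)))
     (IfPos (Sub (Add (Load (Const 1)) (Const 2)) (M 8 (M 9 (R 21))))
       (Store (Const 0) (Const 1)) (Store (Const 0) (Const 0)))
     (Store (Const 0) (Const 0))"

fun unit_code :: "nat \<Rightarrow> bool" where
  "unit_code c \<longleftrightarrow> (if c = 0 then True else c mod 5 \<le> 2 \<and> unit_code (c div 5))"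

declare unit_code.simps [simp del]

lemma unit_code_iff: "set ds \<subseteq> {0..4} \<Longrightarrow> unit_code (nat (code ds)) \<longleftrightarrow> (\<forall>d\<in>set ds. d \<le> 2)"
proof (induction ds)
  case Nil
  then show ?case by (simp add: unit_code.simps)
next
  case (Cons d ds)
  have d: "0 \<le> d" "d \<le> 4" and ds: "set ds \<subseteq> {0..4}" using Cons.prems by auto
  have c: "0 \<le> code ds" using code_range[OF ds] by simp
  define c' where "c' = nat (code ds)"
  have eq: "nat (code (d # ds)) = nat d + 5 * c'"
    using d c by (simp add: c'_def nat_add_distrib nat_mult_distrib)
  have dm: "(nat d + 5 * c') mod 5 = nat d" "(nat d + 5 * c') div 5 = c'" using d by auto
  have IH: "unit_code c' \<longleftrightarrow> (\<forall>d\<in>set ds. d \<le> 2)" using Cons.IH[OF ds] by (simp add: c'_def)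
  have z: "unit_code 0" by (simp add: unit_code.simps)
  have "unit_code (nat d + 5 * c') \<longleftrightarrow> nat d \<le> 2 \<and> unit_code c'"
  proof (cases "nat d + 5 * c' = 0")
    case True
    then have "nat d = 0" "c' = 0" by simp_all
    then show ?thesis using z by simp
  next
    case False
    show ?thesis using unit_code.simps[of "nat d + 5 * c'"] unfolding if_not_P[OF False] dm .
  qed
  then show ?case unfolding eq using IH d by auto
qed

lemma row_index_inj:
  assumes "v < n" "v' < (n::nat)" "int u * int n + int v = int u' * int n + int v'"
  shows "u = u' \<and> v = v'"
proof -
  have eq: "u * n + v = u' * n + v'" using assms(3) by (metis of_nat_add of_nat_eq_iff of_nat_mult)
  have "(u * n + v) div n = u" "(u' * n + v') div n = u'" using assms(1,2) by auto
  then show ?thesis using eq by simp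
qed

text \<open>Adds the concrete layout of the input, which only the initialization and the final
  answer refer to.\<close>

locale encoded = solver G r n m par bags pb off F B inp
  for G r n m par bags pb off F B inp +
  fixes es :: "(nat \<times> nat) list" and k :: int
  assumes es: "edge_list_of G es"
    and inp_n: "inp 0 = int n" and inp_k: "inp 1 = k" and inp_E: "inp 2 = int (length es)"
    and inp_es: "j < length es \<Longrightarrow> inp (4 + 2 * int j) = int (fst (es ! j)) \<and> inp (5 + 2 * int j) = int (snd (es ! j))"
    and pb_eq: "pb = 4 + 2 * int (length es)"
    and off_0: "off 0 = pb + int m"
    and off_Suc: "t < m \<Longrightarrow> off (Suc t) = off t + 1 + int (length (bags ! t))"
    and F_eq: "F = (\<Sum>t<m. 5 ^ length (bags ! t))"
begin

definition input_ok :: "memory \<Rightarrow> bool" where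
  "input_ok s \<longleftrightarrow> (\<forall>a\<ge>0. s a = inp a)"

lemma input_ok_agree:
  "input_ok s \<Longrightarrow> agree (W rs bs) s s' \<Longrightarrow> bs \<subseteq> {1..15} \<Longrightarrow> \<forall>i\<in>rs. 0 \<le> i \<Longrightarrow> input_ok s'"
  unfolding input_ok_def using agree_input by metis

lemma halts_rows:
  assumes s: "input_ok s" "s (adr 0 6) = 0"
  shows "halts init_rows ((n + 1) * 200) (\<lambda>s'. agree (W {5, 6} {1}) s s' \<and>
    (\<forall>u<n. s' (adr 1 (int u)) = int u * int n)) s"
proof -
  let ?W = "W {5, 6} {1}"
  define I where "I = (\<lambda>i s'. agree ?W s s' \<and> s' (adr 0 5) = int i \<and> s' (adr 0 6) = int i * int n \<and>
    (\<forall>u<i. s' (adr 1 (int u)) = int u * int n))"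
  have inW: "adr 0 5 \<in> ?W" "adr 0 6 \<in> ?W" "adr 1 (int u) \<in> ?W" for u by (simp_all add: adr_in_W)
  have n: "s' 0 = int n" if "agree ?W s s'" for s'
    using input_ok_agree[OF s(1) that] inp_n by (simp add: input_ok_def)
  have "halts init_rows ((n + 1) * (100 + for_cost (Load (Const 0)))) (I n) s"
    unfolding init_rows_def
  proof (rule halts_For[where I = I])
    show "I 0 (s(adr 0 5 := 0))" using inW s by (simp add: I_def agree_upd adr_eq_iff)
    show "eval (Load (Const 0)) s' = int n \<and> s' (adr 0 5) = int i" if "I i s'" for i s'
      using that n by (simp add: I_def)
    fix i s' assume i: "i < n" and I: "I i s'"
    have ag: "agree ?W s s'" and r: "s' (adr 0 5) = int i" "s' (adr 0 6) = int i * int n"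
      and row: "\<forall>u<i. s' (adr 1 (int u)) = int u * int n" using I by (auto simp: I_def)
    show "halts (Seq (Store (A 1 (R 5)) (R 6)) (Set 6 (Add (R 6) (Load (Const 0))))) 100
      (\<lambda>s'. s' (adr 0 5) = int i \<and> I (Suc i) (s'(adr 0 5 := int (Suc i)))) s'"
    proof (rule halts_straight)
      let ?r = "result (Seq (Store (A 1 (R 5)) (R 6)) (Set 6 (Add (R 6) (Load (Const 0))))) s'"
      have "adr 1 (int i) < 0" by (rule adr_neg) simp_all
      then have r': "?r = s'(adr 1 (int i) := int i * int n, adr 0 6 := int i * int n + int n)"
        using r n[OF ag] by (simp add: adr_eq_iff)
      show "?r (adr 0 5) = int i \<and> I (Suc i) (?r(adr 0 5 := int (Suc i)))"
        unfolding I_def r' using ag inW r row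
        by (auto simp: agree_upd adr_eq_iff less_Suc_eq algebra_simps)
    qed simp_all
  qed
  then show ?thesis by (rule halts_mono) (simp_all add: for_cost_def I_def)
qed

lemma es_V: "(u, v) \<in> set es \<Longrightarrow> u < n \<and> v < n"
proof -
  interpret GG: pair_graph G by (rule G)
  assume "(u, v) \<in> set es"
  then have "(u, v) \<in> parcs G" using es by (auto simp: edge_list_of_def)
  then show "u < n \<and> v < n" using GG.in_arcsD1 GG.in_arcsD2 V by fastforce
qed

lemma halts_edges:
  assumes s: "input_ok s" and row: "\<forall>u<n. s (adr 1 (int u)) = int u * int n"
    and z: "\<And>x. 0 \<le> x \<Longrightarrow> s (adr 2 x) = 0"
  shows "halts init_edges ((length es + 1) * 2500) (\<lambda>s'. agree (W {1, 5, 9, 10} {2}) s s' \<and>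
    s' (adr 0 1) = pb \<and>
    (\<forall>u<n. \<forall>v<n. s' (adr 2 (int u * int n + int v)) = (if treedec.adj G u v then 1 else 0))) s"
proof -
  let ?W = "W {1, 5, 9, 10} {2}"
  define I where "I = (\<lambda>i s'. agree ?W s s' \<and> s' (adr 0 5) = int i \<and> s' (adr 0 1) = 4 + 2 * int i \<and>
    (\<forall>u<n. \<forall>v<n. s' (adr 2 (int u * int n + int v)) =
      (if (u, v) \<in> set (take i es) \<or> (v, u) \<in> set (take i es) then 1 else 0)))"
  have inW: "adr 0 1 \<in> ?W" "adr 0 5 \<in> ?W" "adr 0 9 \<in> ?W" "adr 0 10 \<in> ?W" "adr 2 (int u * int n + int v) \<in> ?W" for u v
    by (simp_all add: adr_in_W)
  have ok: "input_ok s'" if "agree ?W s s'" for s' using input_ok_agree[OF s(1) that] by simp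
  have rw: "s' (adr 1 (int u)) = int u * int n" if "agree ?W s s'" "u < n" for s' u
    using agree_adr[OF that(1), of 1 "int u"] row that(2) by simp
  let ?P = "Seq (Set 9 (Load (R 1))) (Seq (Set 10 (Load (Add (R 1) (Const 1))))
       (Seq (Store (A 2 (Add (M 1 (R 9)) (R 10))) (Const 1))
         (Seq (Store (A 2 (Add (M 1 (R 10)) (R 9))) (Const 1)) (Set 1 (Add (R 1) (Const 2))))))"
  have loop: "halts (For 5 (Load (Const 2)) ?P) ((length es + 1) * (2200 + for_cost (Load (Const 2)))) (I (length es)) (s(adr 0 1 := 4))"
  proof (rule halts_For[where I = I])
    show "I 0 (s(adr 0 1 := 4, adr 0 5 := 0))" using inW z by (simp add: I_def agree_upd adr_eq_iff)
    show "eval (Load (Const 2)) s' = int (length es) \<and> s' (adr 0 5) = int i" if "I i s'" for i s'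
    proof -
      have "input_ok s'" using ok that by (simp add: I_def)
      then show ?thesis using that inp_E by (simp add: I_def input_ok_def)
    qed
    fix i s' assume i: "i < length es" and I: "I i s'"
    have ag: "agree ?W s s'" and r: "s' (adr 0 5) = int i" "s' (adr 0 1) = 4 + 2 * int i"
      and mat: "\<forall>u<n. \<forall>v<n. s' (adr 2 (int u * int n + int v)) =
        (if (u, v) \<in> set (take i es) \<or> (v, u) \<in> set (take i es) then 1 else 0)" using I by (auto simp: I_def)
    obtain a b where ab: "es ! i = (a, b)" by (cases "es ! i")
    have abn: "a < n" "b < n" using es_V[of a b] nth_mem[OF i] ab by auto
    have inp: "s' (4 + 2 * int i) = int a" "s' (5 + 2 * int i) = int b"
      using inp_es[OF i] ok[OF ag] ab by (simp_all add: input_ok_def)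
    have tk: "set (take (Suc i) es) = insert (a, b) (set (take i es))"
      using take_Suc_conv_app_nth[OF i] ab by simp
    show "halts ?P 2200 (\<lambda>s'. s' (adr 0 5) = int i \<and> I (Suc i) (s'(adr 0 5 := int (Suc i)))) s'"
    proof (rule halts_straight)
      let ?r = "result ?P s'"
      have e5: "4 + 2 * int i + 1 = 5 + 2 * int i" by simp
      \<comment> \<open>Input addresses are nonnegative and work cells negative, so the preceding
        register writes do not affect the reads.\<close>
      have neg: "adr 0 9 < 0" "adr 0 1 < 0" by (simp_all add: adr_neg)
      have r': "?r = s'(adr 0 9 := int a, adr 0 10 := int b, adr 2 (int a * int n + int b) := 1,
          adr 2 (int b * int n + int a) := 1, adr 0 1 := 4 + 2 * int (Suc i))"
        using r inp rw[OF ag abn(1)] rw[OF ag abn(2)] neg by (simp add: adr_eq_iff e5)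
      have "\<forall>u<n. \<forall>v<n. ?r (adr 2 (int u * int n + int v)) =
        (if (u, v) \<in> set (take (Suc i) es) \<or> (v, u) \<in> set (take (Suc i) es) then 1 else 0)"
      proof (intro allI impI)
        fix u v assume uv: "u < n" "v < n"
        have R: "?r (adr 2 X) = (if X = int b * int n + int a then 1 else
            if X = int a * int n + int b then 1 else s' (adr 2 X))" for X
          unfolding r' by (simp add: adr_eq_iff)
        have iffs: "int u * int n + int v = int a * int n + int b \<longleftrightarrow> u = a \<and> v = b"
          "int u * int n + int v = int b * int n + int a \<longleftrightarrow> u = b \<and> v = a"
          using row_index_inj[OF uv(2) abn(2), of u a] row_index_inj[OF uv(2) abn(1), of u b] by auto
        have old: "s' (adr 2 (int u * int n + int v)) =
          (if (u, v) \<in> set (take i es) \<or> (v, u) \<in> set (take i es) then 1 else 0)" using mat uv by blast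
        show "?r (adr 2 (int u * int n + int v)) =
          (if (u, v) \<in> set (take (Suc i) es) \<or> (v, u) \<in> set (take (Suc i) es) then 1 else 0)"
        proof -
          have "(u, v) \<in> set (take (Suc i) es) \<or> (v, u) \<in> set (take (Suc i) es) \<longleftrightarrow>
            (u = b \<and> v = a) \<or> (u = a \<and> v = b) \<or> (u, v) \<in> set (take i es) \<or> (v, u) \<in> set (take i es)"
            unfolding tk insert_iff prod.inject by metis
          moreover have "(if P then 1 else if Q then 1 else if S then 1 else 0) = (if P \<or> Q \<or> S then 1 else (0::int))"
            for P Q S by simp
          ultimately show ?thesis by (simp only: R iffs old)
        qed
      qed
      moreover have "agree ?W s ?r" "?r (adr 0 5) = int i" "?r (adr 0 1) = 4 + 2 * int (Suc i)"
        unfolding r' using ag inW r by (simp_all add: agree_upd adr_eq_iff)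
      ultimately show "?r (adr 0 5) = int i \<and> I (Suc i) (?r(adr 0 5 := int (Suc i)))"
        unfolding I_def using inW by (simp add: agree_upd adr_eq_iff del: result.simps)
    qed simp_all
  qed
  have "halts init_edges (wcost (Set 1 (Const 4)) + (length es + 1) * (2200 + for_cost (Load (Const 2)))) (I (length es)) s"
    unfolding init_edges_def by (intro halts_Seq halts_loopfree) (use loop in simp_all)
  then show ?thesis
  proof (rule halts_mono)
    fix s' assume I: "I (length es) s'"
    have "treedec.adj G u v \<longleftrightarrow> (u, v) \<in> set es \<or> (v, u) \<in> set es" for u v
      using es by (auto simp: adj_def edge_list_of_def)
    then show "agree ?W s s' \<and> s' (adr 0 1) = pb \<and>
      (\<forall>u<n. \<forall>v<n. s' (adr 2 (int u * int n + int v)) = (if treedec.adj G u v then 1 else 0))"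
      using I by (simp add: I_def pb_eq)
  qed (simp add: for_cost_def)
qed

text \<open>Counting nodes by their parent includes the root among its own children; this is the
  surplus 1 in the invariant of the traversal.\<close>

lemma halts_nodes:
  assumes s: "input_ok s" "s (adr 0 1) = pb" and z: "\<And>x. 0 \<le> x \<Longrightarrow> s (adr 5 x) = 0"
  shows "halts init_nodes ((m + 1) * ((B + 1) * 2000)) (\<lambda>s'. agree (W {2..7} {3, 4, 5}) s s' \<and>
    s' (adr 0 4) = int F \<and>
    (\<forall>t<m. s' (adr 3 (int t)) = off t \<and> s' (adr 4 (int t)) = 5 ^ length (bags ! t)) \<and>
    (\<forall>q<m. s' (adr 5 (int q)) = int (card {t. t < m \<and> par ! t = q}))) s"
proof -
  let ?W = "W {2..7} {3, 4, 5}"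
  define I where "I = (\<lambda>i s'. agree ?W s s' \<and> s' (adr 0 5) = int i \<and> s' (adr 0 2) = off i \<and>
    s' (adr 0 4) = int (\<Sum>t<i. 5 ^ length (bags ! t)) \<and>
    (\<forall>t<i. s' (adr 3 (int t)) = off t \<and> s' (adr 4 (int t)) = 5 ^ length (bags ! t)) \<and>
    (\<forall>q<m. s' (adr 5 (int q)) = int (card {t. t < i \<and> par ! t = q})))"
  have inW: "2 \<le> j \<Longrightarrow> j \<le> 7 \<Longrightarrow> adr 0 j \<in> ?W" "adr 3 (int u) \<in> ?W" "adr 4 (int u) \<in> ?W" "adr 5 (int u) \<in> ?W" for u j
    by (simp_all add: adr_in_W)
  have ok: "input_ok s'" "s' (adr 0 1) = pb" if "agree ?W s s'" for s'
    using input_ok_agree[OF s(1) that] agree_adr[OF that, of 0 1] s(2) by simp_all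
  let ?P1 = "Seq (Store (A 3 (R 5)) (R 2)) (Set 6 (Const 1))"
  let ?B2 = "Set 6 (Add (R 6) (dbl (dbl (R 6))))"
  let ?P2 = "For 7 (Load (R 2)) ?B2"
  let ?P3 = "Seq (Store (A 4 (R 5)) (R 6)) (Seq (Set 4 (Add (R 4) (R 6)))
           (Seq (Set 2 (Add (Add (R 2) (Const 1)) (Load (R 2))))
             (Seq (Set 3 (Load (Add (R 1) (R 5)))) (Store (A 5 (R 3)) (Add (M 5 (R 3)) (Const 1))))))"
  let ?s0 = "s(adr 0 2 := pb + int m, adr 0 4 := 0)"
  have loop: "halts (For 5 (Load (Const 3)) (Seq ?P1 (Seq ?P2 ?P3))) ((m + 1) * (100 + ((B + 1) * 200 + 1000) + for_cost (Load (Const 3)))) (I m) ?s0"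
  proof (rule halts_For[where I = I])
    show "I 0 (?s0(adr 0 5 := 0))" using inW z off_0 by (simp add: I_def agree_upd adr_eq_iff)
    show "eval (Load (Const 3)) s' = int m \<and> s' (adr 0 5) = int i" if "I i s'" for i s'
    proof -
      have "input_ok s'" using ok(1) that by (simp add: I_def)
      then show ?thesis using that inp_m by (simp add: I_def input_ok_def)
    qed
    fix i s' assume i: "i < m" and I: "I i s'"
    have ag: "agree ?W s s'" and r: "s' (adr 0 5) = int i" "s' (adr 0 2) = off i"
      "s' (adr 0 4) = int (\<Sum>t<i. 5 ^ length (bags ! t))"
      and nodes: "\<forall>t<i. s' (adr 3 (int t)) = off t \<and> s' (adr 4 (int t)) = 5 ^ length (bags ! t)"
      and pend: "\<forall>q<m. s' (adr 5 (int q)) = int (card {t. t < i \<and> par ! t = q})" using I by (auto simp: I_def)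
    let ?Q = "\<lambda>s'. s' (adr 0 5) = int i \<and> I (Suc i) (s'(adr 0 5 := int (Suc i)))"
    let ?l = "length (bags ! i)"
    let ?s1 = "s'(adr 3 (int i) := off i, adr 0 6 := 1)"
    have ag1: "agree ?W s ?s1" using ag inW by (simp add: agree_upd)
    have offi: "0 \<le> off i" using off i by simp
    show "halts (Seq ?P1 (Seq ?P2 ?P3)) (100 + ((B + 1) * 200 + 1000)) ?Q s'"
    proof (rule halts_Seq[OF halts_straight])
      have s1: "result ?P1 s' = ?s1" using r by (simp add: adr_eq_iff)
      define J where "J = (\<lambda>j s''. agree (W {6, 7} {}) ?s1 s'' \<and> s'' (adr 0 7) = int j \<and> s'' (adr 0 6) = 5 ^ j)"
      have J1: "agree ?W s s''" "s'' (adr 0 2) = off i" "s'' (off i) = int ?l" if "J j s''" for j s''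
      proof -
        have a: "agree (W {6, 7} {}) ?s1 s''" using that by (simp add: J_def)
        have "agree ?W ?s1 s''" by (rule agree_mono[OF a W_mono]) auto
        then show ag2: "agree ?W s s''" using ag1 agree_trans by blast
        show "s'' (adr 0 2) = off i" using agree_adr[OF a, of 0 2] r by (simp add: adr_eq_iff)
        show "s'' (off i) = int ?l" using ok(1)[OF ag2] offi inp_len[OF i] by (simp add: input_ok_def)
      qed
      have pow: "halts ?P2 ((?l + 1) * (50 + for_cost (Load (R 2)))) (J ?l) ?s1"
      proof (rule halts_For[where I = J])
        show "J 0 (?s1(adr 0 7 := 0))" by (simp add: J_def agree_upd adr_in_W adr_eq_iff)
        show "eval (Load (R 2)) s'' = int ?l \<and> s'' (adr 0 7) = int j" if "J j s''" for j s''
          using J1[OF that] that by (simp add: J_def)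
        fix j s'' assume J: "J j s''"
        show "halts ?B2 50 (\<lambda>s'. s' (adr 0 7) = int j \<and> J (Suc j) (s'(adr 0 7 := int (Suc j)))) s''"
          by (rule halts_straight)
            (use J in \<open>simp_all add: J_def agree_upd adr_in_W adr_eq_iff dbl_def\<close>)
      qed
      show "halts (Seq ?P2 ?P3) ((B + 1) * 200 + 1000) ?Q (result ?P1 s')"
        unfolding s1
      proof (rule halts_Seq'[OF halts_mono[OF pow]])
        have "(?l + 1) * (50 + for_cost (Load (R 2))) \<le> (B + 1) * (50 + for_cost (Load (R 2)))"
          using B[OF i] by (intro mult_le_mono1) simp
        then show "(?l + 1) * (50 + for_cost (Load (R 2))) \<le> (B + 1) * 200" by (simp add: for_cost_def)
        show "J ?l s2 \<Longrightarrow> J ?l s2" for s2 .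
        fix s2 assume J: "J ?l s2"
        have a2: "agree (W {6, 7} {}) ?s1 s2" and r6: "s2 (adr 0 6) = 5 ^ ?l" using J by (auto simp: J_def)
        note ag2 = J1(1)[OF J] and r2 = J1(2)[OF J] and l2 = J1(3)[OF J]
        have r2': "s2 (adr 0 5) = int i" "s2 (adr 0 4) = int (\<Sum>t<i. 5 ^ length (bags ! t))"
          "s2 (adr 3 x) = ?s1 (adr 3 x)" "s2 (adr 4 x) = s' (adr 4 x)" "s2 (adr 5 x) = s' (adr 5 x)" for x
          using agree_adr[OF a2, of 0 5] agree_adr[OF a2, of 0 4] agree_adr[OF a2, of 3 x]
            agree_adr[OF a2, of 4 x] agree_adr[OF a2, of 5 x] r by (simp_all add: adr_eq_iff)
        have par_i: "s2 (pb + int i) = int (par ! i)" using ok(1)[OF ag2] pb inp_par[OF i] by (simp add: input_ok_def)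
        have negs: "adr c x < 0" if "0 \<le> c" "0 \<le> x" for c x using adr_neg that .
        have offne: "off i \<noteq> adr 4 (int i)" "off i \<noteq> adr 0 4"
          using negs[of 4 "int i"] negs[of 0 4] offi by auto
        have pbne: "pb + int i \<noteq> adr 4 (int i)" "pb + int i \<noteq> adr 0 4" "pb + int i \<noteq> adr 0 2"
          using negs[of 4 "int i"] negs[of 0 4] negs[of 0 2] pb by auto
        show "halts ?P3 1000 ?Q s2"
        proof (rule halts_straight)
          let ?r = "result ?P3 s2"
          have cd: "card {t. t < Suc i \<and> par ! t = q} = card {t. t < i \<and> par ! t = q} + (if par ! i = q then 1 else 0)" for q
          proof -
            have "{t. t < Suc i \<and> par ! t = q} =
              (if par ! i = q then insert i {t. t < i \<and> par ! t = q} else {t. t < i \<and> par ! t = q})"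
              by (auto simp: less_Suc_eq)
            then show ?thesis by simp
          qed
          have rr: "?r = s2(adr 4 (int i) := 5 ^ ?l, adr 0 4 := int (\<Sum>t<Suc i. 5 ^ length (bags ! t)),
              adr 0 2 := off (Suc i), adr 0 3 := int (par ! i), adr 5 (int (par ! i)) := s' (adr 5 (int (par ! i))) + 1)"
            using r2 l2 r6 r2' par_i offne pbne ok(2)[OF ag2] off_Suc[OF i] by (simp add: adr_eq_iff)
          have "agree ?W s ?r" unfolding rr using ag2 inW by (simp add: agree_upd)
          moreover have "?r (adr 0 5) = int i" "?r (adr 0 2) = off (Suc i)"
            "?r (adr 0 4) = int (\<Sum>t<Suc i. 5 ^ length (bags ! t))"
            unfolding rr using r2' by (simp_all add: adr_eq_iff)
          moreover have "\<forall>t<Suc i. ?r (adr 3 (int t)) = off t \<and> ?r (adr 4 (int t)) = 5 ^ length (bags ! t)"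
            unfolding rr using r2' nodes by (auto simp: adr_eq_iff less_Suc_eq)
          moreover have "\<forall>q<m. ?r (adr 5 (int q)) = int (card {t. t < Suc i \<and> par ! t = q})"
            unfolding rr cd using r2' pend by (simp add: adr_eq_iff)
          ultimately show "?Q ?r" unfolding I_def using inW
            by (simp add: agree_upd adr_eq_iff del: result.simps sum.lessThan_Suc)
        qed simp_all
      qed
    qed simp_all
  qed
  have "halts init_nodes (wcost (Seq (Set 2 (Add (R 1) (Load (Const 3)))) (Set 4 (Const 0))) +
    (m + 1) * (100 + ((B + 1) * 200 + 1000) + for_cost (Load (Const 3)))) (I m) s"
    unfolding init_nodes_def
    by (intro halts_Seq halts_loopfree) (use loop s inp_m in \<open>simp_all add: input_ok_def\<close>)
  then show ?thesis
  proof (rule halts_mono)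
    have "wcost (Seq (Set 2 (Add (R 1) (Load (Const 3)))) (Set 4 (Const 0))) \<le> (m + 1) * 100" by simp
    moreover have "(m + 1) * (100 + ((B + 1) * 200 + 1000) + for_cost (Load (Const 3))) \<le> (m + 1) * ((B + 1) * 1900)"
      by (intro mult_le_mono2) (simp add: for_cost_def)
    moreover have "(m + 1) * 100 + (m + 1) * ((B + 1) * 1900) \<le> (m + 1) * ((B + 1) * 2000)"
      unfolding distrib_left[symmetric] by (intro mult_le_mono2) simp
    ultimately show "wcost (Seq (Set 2 (Add (R 1) (Load (Const 3)))) (Set 4 (Const 0))) +
      (m + 1) * (100 + ((B + 1) * 200 + 1000) + for_cost (Load (Const 3))) \<le> (m + 1) * ((B + 1) * 2000)" by linarith
  qed (simp add: I_def F_eq)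
qed

end

definition solve :: prog where
  "solve = Seq init_rows (Seq init_edges (Seq init_nodes (Seq init_digits
     (Seq (Seq (Set 19 (Const 0)) (Set 2 (Const 0))) (Seq main_loop (Seq find_root answer))))))"

lemma TM_deletion_path4_iff:
  assumes "pair_graph G"
  shows "TM_deletion {path_graph 4} G k \<longleftrightarrow>
    (\<exists>S\<subseteq>pverts G. int (card S) \<le> k \<and> sgraph.p4free (\<lambda>u v. (u, v) \<in> parcs G) (pverts G - S))"
proof -
  interpret pair_graph G by fact
  interpret sgraph "pverts G" "\<lambda>u v. (u, v) \<in> parcs G"
    by unfold_locales (use arcs_symmetric no_loops' in \<open>auto dest: in_arcsD1 in_arcsD2\<close>)
  show ?thesis
    unfolding TM_deletion_def p4free_def topological_minor_path4_iff[OF assms] ball_simps by simp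
qed

context encoded
begin

lemma halts_digits:
  assumes s: "s (adr 0 4) = int F" and z: "\<And>y. 0 \<le> y \<Longrightarrow> s (adr 8 y) = 0"
  shows "halts init_digits ((F + 1) * 500) (\<lambda>s'. agree (W {5, 6, 7} {6, 7, 8}) s s' \<and>
    (\<forall>c<F. s' (adr 6 (int c)) = int (c div 5) \<and> s' (adr 7 (int c)) = int (c mod 5)) \<and>
    (\<forall>y\<ge>0. s' (adr 8 y) = (if (y < int F \<or> y = 0) \<and> unit_code (nat y) then 1 else 0))) s"
proof -
  let ?W = "W {5, 6, 7} {6, 7, 8}"
  define I where "I = (\<lambda>i s'. agree ?W s s' \<and> s' (adr 0 5) = int i \<and> s' (adr 0 6) = int (i div 5) \<and>
    s' (adr 0 7) = int (i mod 5) \<and>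
    (\<forall>c<i. s' (adr 6 (int c)) = int (c div 5) \<and> s' (adr 7 (int c)) = int (c mod 5)) \<and>
    (\<forall>y\<ge>0. s' (adr 8 y) = (if (y < int i \<or> y = 0) \<and> unit_code (nat y) then 1 else 0)))"
  have inW: "adr 0 5 \<in> ?W" "adr 0 6 \<in> ?W" "adr 0 7 \<in> ?W" "adr 6 (int c) \<in> ?W" "adr 7 (int c) \<in> ?W" "adr 8 (int c) \<in> ?W"
    "adr 8 0 \<in> ?W" for c
    by (simp_all add: adr_in_W)
  let ?Init = "Seq (Set 6 (Const 0)) (Seq (Set 7 (Const 0)) (Store (A 8 (Const 0)) (Const 1)))"
  let ?P = "Seq (Store (A 6 (R 5)) (R 6)) (Seq (Store (A 7 (R 5)) (R 7))
         (Seq (IfPos (Sub (R 7) (Const 2)) Skip (Store (A 8 (R 5)) (M 8 (R 6))))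
           (Seq (Set 7 (Add (R 7) (Const 1)))
             (IfPos (Sub (R 7) (Const 4)) (Seq (Set 7 (Const 0)) (Set 6 (Add (R 6) (Const 1)))) Skip))))"
  let ?s0 = "s(adr 0 6 := 0, adr 0 7 := 0, adr 8 0 := 1)"
  have u0: "unit_code 0" by (simp add: unit_code.simps)
  have loop: "halts (For 5 (R 4) ?P) ((F + 1) * (400 + for_cost (R 4))) (I F) ?s0"
  proof (rule halts_For[where I = I])
    show "I 0 (?s0(adr 0 5 := 0))" using inW z u0 by (auto simp: I_def agree_upd adr_eq_iff)
    show "eval (R 4) s' = int F \<and> s' (adr 0 5) = int i" if "I i s'" for i s'
      using that s agree_adr[of "{5, 6, 7}" "{6, 7, 8}" s s' 0 4] by (simp add: I_def)
    fix i s' assume I: "I i s'"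
    have ag: "agree ?W s s'" and r: "s' (adr 0 5) = int i" "s' (adr 0 6) = int (i div 5)" "s' (adr 0 7) = int (i mod 5)"
      and dig: "\<forall>c<i. s' (adr 6 (int c)) = int (c div 5) \<and> s' (adr 7 (int c)) = int (c mod 5)"
      and tab: "\<And>y. 0 \<le> y \<Longrightarrow> s' (adr 8 y) = (if (y < int i \<or> y = 0) \<and> unit_code (nat y) then 1 else 0)"
      using I by (auto simp: I_def)
    show "halts ?P 400 (\<lambda>s'. s' (adr 0 5) = int i \<and> I (Suc i) (s'(adr 0 5 := int (Suc i)))) s'"
    proof (rule halts_straight)
      let ?r = "result ?P s'"
      let ?u = "if unit_code i then 1 else 0 :: int"
      \<comment> \<open>The entry for \<open>i\<close> is copied from the entry for
        \<open>i div 5\<close>, which is already written or is the preset entry 0.\<close>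
      have div_lt: "i div 5 < i \<or> i div 5 = 0" by (cases i) auto
      have new: "(if 2 < i mod 5 then s' (adr 8 (int i)) else s' (adr 8 (int (i div 5)))) = ?u"
      proof (cases "2 < i mod 5")
        case True
        then have "i \<noteq> 0" by auto
        then have "\<not> unit_code i" using True unit_code.simps[of i] by simp
        then show ?thesis using True tab[of "int i"] by simp
      next
        case False
        have "unit_code i \<longleftrightarrow> unit_code (i div 5)"
        proof (cases "i = 0")
          case False
          then show ?thesis using \<open>\<not> 2 < i mod 5\<close> unit_code.simps[of i] by simp
        qed simp
        then show ?thesis using False div_lt tab[of "int (i div 5)"] by (auto simp del: of_nat_div)
      qed
      have r': "?r = s'(adr 6 (int i) := int (i div 5), adr 7 (int i) := int (i mod 5), adr 8 (int i) := ?u,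
          adr 0 7 := int (Suc i mod 5), adr 0 6 := int (Suc i div 5))"
      proof -
        \<comment> \<open>A redundant write to the table cell unifies the branches that store and
          that do not store.\<close>
        have e: "s'(adr 6 (int i) := int (i div 5), adr 7 (int i) := int (i mod 5)) =
          s'(adr 6 (int i) := int (i div 5), adr 7 (int i) := int (i mod 5), adr 8 (int i) := s' (adr 8 (int i)))"
          by (auto simp: fun_eq_iff adr_eq_iff)
        define q where "q = i div 5"
        define d where "d = i mod 5"
        have d5: "d < 5" by (simp add: d_def)
        have sm: "Suc i mod 5 = (if d = 4 then 0 else Suc d)" "Suc i div 5 = (if d = 4 then Suc q else q)"
          unfolding d_def q_def by (auto simp: mod_Suc div_Suc)
        show ?thesis
          unfolding sm new[symmetric] using r e d5 unfolding q_def[symmetric] d_def[symmetric]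
          by (auto simp: adr_eq_iff fun_eq_iff)
      qed
      have t8: "?r (adr 8 y) = (if (y < int (Suc i) \<or> y = 0) \<and> unit_code (nat y) then 1 else 0)" if "0 \<le> y" for y
      proof (cases "y = int i")
        case True
        then show ?thesis unfolding r' by (simp add: adr_eq_iff)
      next
        case False
        then have "?r (adr 8 y) = s' (adr 8 y)" unfolding r' by (simp add: adr_eq_iff)
        moreover have "y < int (Suc i) \<longleftrightarrow> y < int i" using False by auto
        ultimately show ?thesis using tab[OF that] by simp
      qed
      have t67: "\<forall>c<Suc i. ?r (adr 6 (int c)) = int (c div 5) \<and> ?r (adr 7 (int c)) = int (c mod 5)"
        unfolding r' using dig by (auto simp: adr_eq_iff less_Suc_eq)
      have t0: "agree ?W s ?r" "?r (adr 0 5) = int i" "?r (adr 0 6) = int (Suc i div 5)" "?r (adr 0 7) = int (Suc i mod 5)"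
        unfolding r' using ag inW r by (simp_all add: agree_upd adr_eq_iff)
      define w where "w = ?r"
      have "w (adr 0 5) = int i \<and> I (Suc i) (w(adr 0 5 := int (Suc i)))"
        unfolding I_def using t8[folded w_def] t67[folded w_def] t0[folded w_def] inW
        by (simp add: agree_upd adr_eq_iff)
      then show "?r (adr 0 5) = int i \<and> I (Suc i) (?r(adr 0 5 := int (Suc i)))" by (simp only: w_def)
    qed simp_all
  qed
  have "halts init_digits (wcost ?Init + (F + 1) * (400 + for_cost (R 4))) (I F) s"
    unfolding init_digits_def by (rule halts_Seq, rule halts_loopfree) (use loop in simp_all)
  then show ?thesis by (rule halts_mono) (simp_all add: for_cost_def I_def)
qed

lemma root_unique: "t < m \<Longrightarrow> par ! t = t \<longleftrightarrow> t = r"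
  using p_not_desc[of t] desc_refl[of t] rooted(3) by (cases "t = r") auto

lemma halts_find_root:
  assumes env: "Env s"
  shows "halts find_root ((m + 1) * 300) (\<lambda>s'. agree (W {3, 5, 21} {}) s s' \<and> s' (adr 0 21) = int r) s"
proof -
  let ?W = "W {3, 5, 21} {}"
  define I where "I = (\<lambda>i s'. agree ?W s s' \<and> s' (adr 0 5) = int i \<and> (r < i \<longrightarrow> s' (adr 0 21) = int r))"
  have inW: "adr 0 3 \<in> ?W" "adr 0 5 \<in> ?W" "adr 0 21 \<in> ?W" by (simp_all add: adr_in_W)
  have envI: "Env s'" if "agree ?W s s'" for s' by (intro Env_agree[OF env that]) auto
  let ?P = "Seq (Set 3 (Load (Add (R 1) (R 5))))
     (IfPos (Sub (R 3) (R 5)) Skip (IfPos (Sub (R 5) (R 3)) Skip (Set 21 (R 5))))"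
  have "halts find_root ((m + 1) * (200 + for_cost (Load (Const 3)))) (I m) s"
    unfolding find_root_def
  proof (rule halts_For[where I = I])
    show "I 0 (s(adr 0 5 := 0))" using inW by (simp add: I_def agree_upd adr_eq_iff)
    show "eval (Load (Const 3)) s' = int m \<and> s' (adr 0 5) = int i" if "I i s'" for i s'
      using envI[of s'] that inp_m by (simp add: I_def Env_def)
    fix i s' assume i: "i < m" and I: "I i s'"
    have ag: "agree ?W s s'" and r5: "s' (adr 0 5) = int i" and r21: "r < i \<longrightarrow> s' (adr 0 21) = int r"
      using I by (auto simp: I_def)
    have pi: "s' (s' (adr 0 1) + int i) = int (par ! i)" using envI[OF ag] inp_par[OF i] pb by (simp add: Env_def)
    show "halts ?P 200 (\<lambda>s'. s' (adr 0 5) = int i \<and> I (Suc i) (s'(adr 0 5 := int (Suc i)))) s'"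
    proof (rule halts_straight)
      let ?r = "result ?P s'"
      have r': "?r = (if i = r then s'(adr 0 3 := int (par ! i), adr 0 21 := int i) else s'(adr 0 3 := int (par ! i)))"
        using root_unique[OF i] pi r5 by (auto simp: adr_eq_iff)
      show "?r (adr 0 5) = int i \<and> I (Suc i) (?r(adr 0 5 := int (Suc i)))"
        unfolding I_def r' using ag inW r5 r21 by (simp add: agree_upd adr_eq_iff less_Suc_eq)
    qed simp_all
  qed
  then show ?thesis using rooted(2) by (elim halts_mono) (simp_all add: for_cost_def I_def)
qed

lemma F_int: "q < m \<Longrightarrow> 5 ^ length (bags ! q) \<le> int F"
  using of_nat_le_iff[where 'a = int, THEN iffD2, OF F[of q]] unfolding of_nat_power of_nat_numeral .

lemma represents_unit_code:
  assumes "q < m" "\<And>y. 0 \<le> y \<Longrightarrow> T y = (if (y < int F \<or> y = 0) \<and> unit_code (nat y) then 1 else 0)"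
  shows "represents (bags ! q) {} T"
proof (rule represents_unit)
  fix lab :: "nat \<Rightarrow> int" assume l: "\<forall>u\<in>set (bags ! q). lab u \<in> {0..4}"
  let ?c = "code (map lab (bags ! q))"
  have c: "0 \<le> ?c" "?c < 5 ^ length (bags ! q)" using code_map_range[of "bags ! q" lab] l by blast+
  have cF: "?c < int F" using c(2) F_int[OF assms(1)] by (rule less_le_trans)
  have "set (map lab (bags ! q)) \<subseteq> {0..4}" using l by (simp add: image_subset_iff)
  then have "unit_code (nat ?c) \<longleftrightarrow> (\<forall>u\<in>set (bags ! q). lab u \<le> 2)" using unit_code_iff[of "map lab (bags ! q)"] by simp
  then show "T ?c = (if \<forall>u\<in>set (bags ! q). lab u \<le> 2 then 1 else 0)" using assms(2) c(1) cF by simp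
qed

theorem halts_solve:
  assumes neg: "\<And>a. a < 0 \<Longrightarrow> inp a = 0" and root_bag: "bags ! r = []"
  shows "halts solve ((n + 1) * 200 + ((length es + 1) * 2500 + ((m + 1) * ((B + 1) * 2000) + ((F + 1) * 500 + (100 +
      ((2 * m + 1) * (25 ^ B * ((B + 1) * ((B + 1) * 150000))) + ((m + 1) * 300 + 5000)))))))
    (\<lambda>s. s 0 = (if TM_deletion {path_graph 4} G k then 1 else 0)) inp"
    (is "halts _ _ ?Q _")
  unfolding solve_def
proof (rule halts_Seq'[OF halts_rows])
  have z: "inp (adr c x) = 0" if "0 \<le> c" "0 \<le> x" for c x using neg adr_neg[OF that] .
  show ok: "input_ok inp" by (simp add: input_ok_def)
  show "inp (adr 0 6) = 0" using z by simp
  fix s1 assume s1: "agree (W {5, 6} {1}) inp s1 \<and> (\<forall>u<n. s1 (adr 1 (int u)) = int u * int n)"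
  then have a1: "agree (W {5, 6} {1}) inp s1" and row1: "\<forall>u<n. s1 (adr 1 (int u)) = int u * int n" by blast+
  show "halts (Seq init_edges (Seq init_nodes (Seq init_digits
     (Seq (Seq (Set 19 (Const 0)) (Set 2 (Const 0))) (Seq main_loop (Seq find_root answer))))))
     ((length es + 1) * 2500 + ((m + 1) * ((B + 1) * 2000) + ((F + 1) * 500 + (100 +
      ((2 * m + 1) * (25 ^ B * ((B + 1) * ((B + 1) * 150000))) + ((m + 1) * 300 + 5000)))))) ?Q s1"
  proof (rule halts_Seq'[OF halts_edges])
    show "input_ok s1" using input_ok_agree[OF ok a1] by simp
    then have ok1: "input_ok s1" .
    show "\<forall>u<n. s1 (adr 1 (int u)) = int u * int n" by (rule row1)
    show "s1 (adr 2 x) = 0" if "0 \<le> x" for x using agree_adr[OF a1, of 2 x] z that by simp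
    fix s2 assume s2: "agree (W {1, 5, 9, 10} {2}) s1 s2 \<and> s2 (adr 0 1) = pb \<and>
      (\<forall>u<n. \<forall>v<n. s2 (adr 2 (int u * int n + int v)) = (if adj u v then 1 else 0))"
    then have a2: "agree (W {1, 5, 9, 10} {2}) s1 s2" and pb2: "s2 (adr 0 1) = pb"
      and adj2: "\<forall>u<n. \<forall>v<n. s2 (adr 2 (int u * int n + int v)) = (if adj u v then 1 else 0)" by blast+
    have row2: "s2 (adr 1 x) = s1 (adr 1 x)" for x using agree_adr[OF a2, of 1 x] by simp
    show "halts (Seq init_nodes (Seq init_digits
       (Seq (Seq (Set 19 (Const 0)) (Set 2 (Const 0))) (Seq main_loop (Seq find_root answer)))))
       ((m + 1) * ((B + 1) * 2000) + ((F + 1) * 500 + (100 +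
        ((2 * m + 1) * (25 ^ B * ((B + 1) * ((B + 1) * 150000))) + ((m + 1) * 300 + 5000))))) ?Q s2"
    proof (rule halts_Seq'[OF halts_nodes])
      show ok2: "input_ok s2" using input_ok_agree[OF ok1 a2] by simp
      show "s2 (adr 0 1) = pb" by (rule pb2)
      show "s2 (adr 5 x) = 0" if "0 \<le> x" for x
        using agree_adr[OF a1, of 5 x] agree_adr[OF a2, of 5 x] z that by simp
      fix s3 assume s3: "agree (W {2..7} {3, 4, 5}) s2 s3 \<and> s3 (adr 0 4) = int F \<and>
        (\<forall>t<m. s3 (adr 3 (int t)) = off t \<and> s3 (adr 4 (int t)) = 5 ^ length (bags ! t)) \<and>
        (\<forall>q<m. s3 (adr 5 (int q)) = int (card {t. t < m \<and> par ! t = q}))"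
      then have a3: "agree (W {2..7} {3, 4, 5}) s2 s3" and F3: "s3 (adr 0 4) = int F"
        and node3: "\<forall>t<m. s3 (adr 3 (int t)) = off t \<and> s3 (adr 4 (int t)) = 5 ^ length (bags ! t)"
        and pend3: "\<forall>q<m. s3 (adr 5 (int q)) = int (card {t. t < m \<and> par ! t = q})" by blast+
      have ok3: "input_ok s3" using input_ok_agree[OF ok2 a3] by simp
      show "halts (Seq init_digits
         (Seq (Seq (Set 19 (Const 0)) (Set 2 (Const 0))) (Seq main_loop (Seq find_root answer))))
         ((F + 1) * 500 + (100 +
          ((2 * m + 1) * (25 ^ B * ((B + 1) * ((B + 1) * 150000))) + ((m + 1) * 300 + 5000)))) ?Q s3"
      proof (rule halts_Seq'[OF halts_digits[where s = s3, OF F3]])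
        show "s3 (adr 8 y) = 0" if "0 \<le> y" for y
          using agree_adr[OF a1, of 8 y] agree_adr[OF a2, of 8 y] agree_adr[OF a3, of 8 y] z that by simp
        fix s4 assume s4: "agree (W {5, 6, 7} {6, 7, 8}) s3 s4 \<and>
          (\<forall>c<F. s4 (adr 6 (int c)) = int (c div 5) \<and> s4 (adr 7 (int c)) = int (c mod 5)) \<and>
          (\<forall>y\<ge>0. s4 (adr 8 y) = (if (y < int F \<or> y = 0) \<and> unit_code (nat y) then 1 else 0))"
        then have a4: "agree (W {5, 6, 7} {6, 7, 8}) s3 s4"
          and dig4: "\<forall>c<F. s4 (adr 6 (int c)) = int (c div 5) \<and> s4 (adr 7 (int c)) = int (c mod 5)"
          and tab4: "\<And>y. 0 \<le> y \<Longrightarrow> s4 (adr 8 y) = (if (y < int F \<or> y = 0) \<and> unit_code (nat y) then 1 else 0)" by blast+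
        let ?P5 = "Seq (Set 19 (Const 0)) (Set 2 (Const 0))"
        let ?s5 = "result ?P5 s4"
        have s5: "?s5 = s4(adr 0 19 := 0, adr 0 2 := 0)" by simp
        have a5: "agree (W {2, 19} {}) s4 ?s5" unfolding s5 by (simp add: agree_upd adr_in_W)
        have "5 ^ length (bags ! r) \<le> F" using F rooted(2) by simp
        moreover have "(0::nat) < 5 ^ length (bags ! r)" by simp
        ultimately have Fpos: "0 < F" by linarith
        \<comment> \<open>Bank 9 is still zero, so all nodes share the initial table at index 0.
          That is harmless, as a push never writes into an existing table.\<close>
        have inv: "Inv (2 * m) {} ?s5"
        proof (rule InvI[where i = 0 and j = 0])
          have ok4: "input_ok s4" using input_ok_agree[OF ok3 a4] by simp
          have ok5: "input_ok ?s5" using input_ok_agree[OF ok4 a5] by simp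
          have t: "?s5 (adr 0 1) = pb" "?s5 (adr 0 4) = int F" "?s5 (adr 1 x) = s1 (adr 1 x)" "?s5 (adr 2 x) = s2 (adr 2 x)"
            "?s5 (adr 3 x) = s3 (adr 3 x)" "?s5 (adr 4 x) = s3 (adr 4 x)" "?s5 (adr 5 x) = s3 (adr 5 x)"
            "?s5 (adr 6 x) = s4 (adr 6 x)" "?s5 (adr 7 x) = s4 (adr 7 x)" "?s5 (adr 8 x) = s4 (adr 8 x)"
            "?s5 (adr 9 x) = inp (adr 9 x)" "?s5 (adr 10 x) = inp (adr 10 x)" for x
            using agree_adr[OF a5, of 0 1] agree_adr[OF a4, of 0 1] agree_adr[OF a3, of 0 1]
              agree_adr[OF a5, of 0 4] agree_adr[OF a4, of 0 4] pb2 F3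
              agree_adr[OF a5, of 1 x] agree_adr[OF a4, of 1 x] agree_adr[OF a3, of 1 x] agree_adr[OF a2, of 1 x]
              agree_adr[OF a5, of 2 x] agree_adr[OF a4, of 2 x] agree_adr[OF a3, of 2 x]
              agree_adr[OF a5, of 3 x] agree_adr[OF a4, of 3 x] agree_adr[OF a5, of 4 x] agree_adr[OF a4, of 4 x]
              agree_adr[OF a5, of 5 x] agree_adr[OF a4, of 5 x] agree_adr[OF a5, of 6 x]
              agree_adr[OF a5, of 7 x] agree_adr[OF a5, of 8 x]
              agree_adr[OF a5, of 9 x] agree_adr[OF a4, of 9 x] agree_adr[OF a3, of 9 x] agree_adr[OF a2, of 9 x] agree_adr[OF a1, of 9 x]
              agree_adr[OF a5, of 10 x] agree_adr[OF a4, of 10 x] agree_adr[OF a3, of 10 x] agree_adr[OF a2, of 10 x] agree_adr[OF a1, of 10 x]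
            by (simp_all del: result.simps)
          have c9: "inp (adr 9 (int q)) = 0" for q by (rule z) simp_all
          show "Env ?s5" unfolding Env_def t using ok5 row1 adj2 node3 dig4 unfolding input_ok_def by blast
          show "Stamp ?s5" unfolding Stamp_def t using z[of 10 "int _"] by simp
          show "\<forall>y\<ge>?s5 (adr 0 4). ?s5 (adr 8 y) = 0"
          proof (intro allI impI)
            fix y assume "?s5 (adr 0 4) \<le> y"
            then have "int F \<le> y" unfolding t .
            then show "?s5 (adr 8 y) = 0" unfolding t using tab4[of y] Fpos by simp
          qed
          show "\<forall>q<m. q \<notin> {} \<longrightarrow> 0 \<le> ?s5 (adr 9 (int q)) \<and>
            ?s5 (adr 9 (int q)) + 5 ^ length (bags ! q) \<le> ?s5 (adr 0 4) \<and>
            represents (bags ! q) (forgotten q (ch q \<inter> {})) (\<lambda>c. ?s5 (adr 8 (?s5 (adr 9 (int q)) + c)))"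
          proof (intro allI impI conjI)
            fix q assume q: "q < m"
            show "0 \<le> ?s5 (adr 9 (int q))" unfolding t c9 by simp
            show "?s5 (adr 9 (int q)) + 5 ^ length (bags ! q) \<le> ?s5 (adr 0 4)"
              unfolding t c9 add_0 by (rule F_int[OF q])
            have "forgotten q (ch q \<inter> {}) = {}" by (simp add: forgotten_def)
            moreover have "represents (bags ! q) {} (\<lambda>c. s4 (adr 8 c))" by (rule represents_unit_code[OF q tab4])
            ultimately show "represents (bags ! q) (forgotten q (ch q \<inter> {})) (\<lambda>c. ?s5 (adr 8 (?s5 (adr 9 (int q)) + c)))"
              unfolding t c9 by simp
          qed
          show "\<forall>q<m. ?s5 (adr 5 (int q)) = (if q \<in> {} then 1 else int (card (ch q - {})) + (if q = r then 1 else 0))"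
          proof (intro allI impI)
            fix q assume q: "q < m"
            have "{t. t < m \<and> par ! t = q} = (if q = r then insert r (ch q) else ch q)"
            proof -
              have "{t. t < m \<and> par ! t = q} = (if par ! q = q then insert q (ch q) else ch q)"
                using q by (auto simp: children_def)
              then show ?thesis using root_unique[OF q] by simp
            qed
            moreover have "r \<notin> ch r" by (simp add: children_def)
            ultimately show "?s5 (adr 5 (int q)) = (if q \<in> {} then 1 else int (card (ch q - {})) + (if q = r then 1 else 0))"
              unfolding t using pend3 q by simp
          qed
          show "\<forall>q<m. q \<le> 0 \<and> q \<notin> {} \<and> ?s5 (adr 5 (int q)) = 0 \<longrightarrow> q = 0" by simp
          show "?s5 (adr 0 19) = int 0" "?s5 (adr 0 2) = int 0" unfolding s5 by (simp_all add: adr_eq_iff)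
          show "0 \<le> m \<and> (0 < m \<longrightarrow> 0 < m) \<and> (0 = m \<longrightarrow> 0 = m)" by simp
          show "2 * m = (m - card ({} :: nat set)) + (m - 0)" by simp
        qed simp_all
        show "halts (Seq ?P5 (Seq main_loop (Seq find_root answer))) (100 +
          ((2 * m + 1) * (25 ^ B * ((B + 1) * ((B + 1) * 150000))) + ((m + 1) * 300 + 5000))) ?Q s4"
        proof (rule halts_Seq[OF halts_straight])
          show "halts (Seq main_loop (Seq find_root answer))
            ((2 * m + 1) * (25 ^ B * ((B + 1) * ((B + 1) * 150000))) + ((m + 1) * 300 + 5000)) ?Q ?s5"
          proof (rule halts_Seq'[OF halts_main_loop[OF inv]])
            fix s6 assume s6: "Env s6 \<and> 0 \<le> s6 (adr 9 (int r)) \<and>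
              represents (bags ! r) (forgotten r (ch r)) (\<lambda>c. s6 (adr 8 (s6 (adr 9 (int r)) + c)))"
            then have env6: "Env s6" by blast
            let ?a = "s6 (adr 8 (s6 (adr 9 (int r))))"
            \<comment> \<open>At the root every vertex has been forgotten, and the labelling of the
              empty bag is immaterial.\<close>
            have "represents [] (pverts G) (\<lambda>c. s6 (adr 8 (s6 (adr 9 (int r)) + c)))"
              using s6 forgotten_root root_bag by simp
            then have mv: "minval ?a ((\<lambda>c. int c + 1) ` {c. realizable (pverts G) {} (\<lambda>_. 0) c})"
              unfolding represents_def by simp
            have "0 < ?a \<and> ?a < k + 2 \<longleftrightarrow> (\<exists>c. realizable (pverts G) {} (\<lambda>_. 0) c \<and> int c \<le> k)"
            proof
              assume l: "0 < ?a \<and> ?a < k + 2"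
              then have "?a \<in> (\<lambda>c. int c + 1) ` {c. realizable (pverts G) {} (\<lambda>_. 0) c}" using minval_pos[OF mv] by blast
              then obtain c where "?a = int c + 1" "realizable (pverts G) {} (\<lambda>_. 0) c" by blast
              then show "\<exists>c. realizable (pverts G) {} (\<lambda>_. 0) c \<and> int c \<le> k" using l by (intro exI[of _ c]) simp
            next
              assume "\<exists>c. realizable (pverts G) {} (\<lambda>_. 0) c \<and> int c \<le> k"
              then obtain c where c: "realizable (pverts G) {} (\<lambda>_. 0) c" "int c \<le> k" by blast
              then show "0 < ?a \<and> ?a < k + 2" using minval_le[OF mv, of "int c + 1"] by simp
            qed
            also have "\<dots> \<longleftrightarrow> (\<exists>S\<subseteq>pverts G. int (card S) \<le> k \<and> p4free (pverts G - S))"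
              using realizable_root V by simp
            also have "\<dots> \<longleftrightarrow> TM_deletion {path_graph 4} G k"
            proof -
              have "adj = (\<lambda>u v. (u, v) \<in> parcs G)" by (simp add: adj_def fun_eq_iff)
              then show ?thesis using TM_deletion_path4_iff[OF G, of k] by simp
            qed
            finally have ans: "0 < ?a \<and> ?a < k + 2 \<longleftrightarrow> TM_deletion {path_graph 4} G k" .
            show "halts (Seq find_root answer) ((m + 1) * 300 + 5000) ?Q s6"
            proof (rule halts_Seq'[OF halts_find_root[OF env6]])
              fix s7 assume s7: "agree (W {3, 5, 21} {}) s6 s7 \<and> s7 (adr 0 21) = int r"
              then have a7: "agree (W {3, 5, 21} {}) s6 s7" by blast
              have env7: "Env s7" by (intro Env_agree[OF env6 a7]) auto
              have k7: "s7 1 = k" using env7 inp_k by (simp add: Env_def)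
              have t7: "s7 (adr 8 (s7 (adr 9 (int r)))) = ?a"
                using agree_adr[OF a7, of 9 "int r"] agree_adr[OF a7, of 8 "s6 (adr 9 (int r))"] by simp
              show "halts answer 5000 ?Q s7"
              proof (rule halts_straight)
                have r7: "result answer s7 0 = (if 0 < ?a \<and> ?a < k + 2 then 1 else 0)"
                  using s7 k7 t7 by (simp add: answer_def)
                show "?Q (result answer s7)" unfolding r7 ans ..
              qed (simp_all add: answer_def)
            qed
          qed
        qed simp_all
      qed
    qed
  qed
qed

end

section \<open>The theorem\<close>

text \<open>From \<open>v = 4\<close> on, one step multiplies the left side by at most 36, because
  \<open>5 * (v + 2) \<le> 6 * (v + 1)\<close>; the factor 25 on the right covers the small
  values.\<close>

lemma square_exp_bound: "(v + 1)\<^sup>2 * 25 ^ v \<le> 25 * (36::nat) ^ v"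
proof (cases "v < 4")
  case True
  then consider "v = 0" | "v = 1" | "v = 2" | "v = 3" by linarith
  then show ?thesis by cases (simp_all add: power2_eq_square)
next
  case False
  then have "4 \<le> v" by simp
  then show ?thesis
  proof (induction v rule: nat_induct_at_least)
    case base
    show ?case by simp
  next
    case (Suc v)
    have "25 * (v + 2)\<^sup>2 \<le> 36 * (v + 1)\<^sup>2"
    proof -
      have "4 * 4 \<le> v * v" "4 * v \<le> v * v" using Suc.hyps by (intro mult_le_mono; simp)+
      then have "28 * v + 64 \<le> 11 * (v * v)" by linarith
      then show ?thesis by (simp add: power2_eq_square algebra_simps)
    qed
    then have "25 * (v + 2)\<^sup>2 * 25 ^ v \<le> 36 * (v + 1)\<^sup>2 * 25 ^ v" by (rule mult_le_mono1)
    also have "\<dots> = 36 * ((v + 1)\<^sup>2 * 25 ^ v)" by (simp only: mult.assoc)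
    also have "\<dots> \<le> 36 * (25 * 36 ^ v)" using Suc.IH by (rule mult_le_mono2)
    finally show ?case by (simp add: mult_ac)
  qed
qed

lemma concat_pairs:
  "length (concat (map (\<lambda>(u, v). [int u, int v]) es)) = 2 * length es"
  "j < length es \<Longrightarrow> concat (map (\<lambda>(u, v). [int u, int v]) es) ! (2 * j) = int (fst (es ! j)) \<and>
     concat (map (\<lambda>(u, v). [int u, int v]) es) ! (2 * j + 1) = int (snd (es ! j))"
proof (induction es arbitrary: j)
  case (Cons e es)
  {
    case 1
    then show ?case using Cons(1) by (auto split: prod.splits)
  next
    case 2
    then show ?case using Cons(2) by (cases j) (auto split: prod.splits)
  }
qed auto

lemma input_memory_nth: "i < length xs \<Longrightarrow> input_memory xs (int i) = xs ! i"
  by (simp add: input_memory_def)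

lemma concat_nth:
  assumes "t < length xss" "i < length (f (xss ! t))"
  shows "concat (map f xss) ! (length (concat (map f (take t xss))) + i) = f (xss ! t) ! i"
    "length (concat (map f (take t xss))) + i < length (concat (map f xss))"
proof -
  have "concat (map f xss) = concat (map f (take t xss)) @ f (xss ! t) @ concat (map f (drop (Suc t) xss))"
    by (subst id_take_nth_drop[OF assms(1)]) simp
  then show "concat (map f xss) ! (length (concat (map f (take t xss))) + i) = f (xss ! t) ! i"
    "length (concat (map f (take t xss))) + i < length (concat (map f xss))"
    using assms(2) by (simp_all add: nth_append)
qed

text \<open>Every edge lies in some bag, so reading the edge list is paid for by the nodes of the
  decomposition.\<close>

lemma card_edges:
  assumes "pair_graph G" "edge_list_of G es" "tree_decomposition G {0..<m} r p X"
    "\<And>t. t < m \<Longrightarrow> card (X t) \<le> B" "\<And>t. t < m \<Longrightarrow> finite (X t)"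
  shows "length es \<le> m * (B * B)"
proof -
  have "set es \<subseteq> (\<Union>t\<in>{0..<m}. X t \<times> X t)"
  proof
    fix e assume e: "e \<in> set es"
    obtain u v where uv: "e = (u, v)" by (cases e)
    then have "(u, v) \<in> parcs G" using e assms(2) by (auto simp: edge_list_of_def)
    then obtain t where "t \<in> {0..<m}" "u \<in> X t" "v \<in> X t"
      using assms(3) by (fastforce simp: tree_decomposition_def)
    then show "e \<in> (\<Union>t\<in>{0..<m}. X t \<times> X t)" using uv by blast
  qed
  moreover have "finite (\<Union>t\<in>{0..<m}. X t \<times> X t)" using assms(5) by auto
  ultimately have "card (set es) \<le> card (\<Union>t\<in>{0..<m}. X t \<times> X t)" by (rule card_mono[rotated])
  also have "\<dots> \<le> (\<Sum>t\<in>{0..<m}. card (X t \<times> X t))" by (rule card_UN_le) simp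
  also have "\<dots> \<le> (\<Sum>t\<in>{0..<m}. B * B)"
    using assms(4) by (intro sum_mono) (auto simp: card_cartesian_product intro!: mult_le_mono)
  finally show ?thesis using assms(2) by (simp add: edge_list_of_def distinct_card)
qed

text \<open>Apart from the part linear in \<open>n\<close>, every summand is at most a multiple of
  \<open>m * (25 ^ B * (B + 1)^2)\<close>; the multiples and the additive constants, absorbed by
  \<open>1 \<le> m\<close>, stay below 470000.\<close>

lemma time_bound:
  fixes n E m B F N :: nat
  assumes "1 \<le> m" "n + 1 \<le> 2 * N" "E \<le> m * (B * B)" "F \<le> m * 5 ^ B"
  shows "(n + 1) * 200 + ((E + 1) * 2500 + ((m + 1) * ((B + 1) * 2000) + ((F + 1) * 500 + (100 +
      ((2 * m + 1) * (25 ^ B * ((B + 1) * ((B + 1) * 150000))) + ((m + 1) * 300 + 5000)))))) \<le>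
    400 * N + 470000 * (m * (25 ^ B * (B + 1)\<^sup>2))"
proof -
  define b where "b = B + 1"
  define q where "q = (25::nat) ^ B"
  have b1: "1 \<le> b" and q1: "1 \<le> q" by (simp_all add: b_def q_def)
  define z where "z = q * (b * b)"
  have "1 * (1 * b) \<le> z" "1 * (b * b) \<le> z" "q * (1 * 1) \<le> z"
    unfolding z_def by (intro mult_le_mono order.refl b1 q1)+
  then have z: "b \<le> z" "b * b \<le> z" "q \<le> z" by (simp_all only: mult_1 mult_1_right)
  define y where "y = m * z"
  have my: "m * x \<le> y" if "x \<le> z" for x unfolding y_def using that by (rule mult_le_mono2)
  have z1: "1 \<le> z" using z(3) q1 by linarith
  have y1: "m \<le> y" "z \<le> y" using my[OF z1] mult_le_mono1[OF assms(1), of z] by (simp_all add: y_def)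
  have "B * B \<le> b * b" unfolding b_def by (intro mult_le_mono) simp_all
  then have Ey: "E \<le> y" using assms(3) my[of "B * B"] z(2) by linarith
  have "(5::nat) ^ B \<le> 25 ^ B" by (intro power_mono) simp_all
  then have Fy: "F \<le> y" using assms(4) my[of "5 ^ B"] z(3) unfolding q_def by linarith
  have "(m + 1) * b \<le> 2 * y" using my[OF z(1)] z(1) y1(2) by simp
  then have "2000 * ((m + 1) * b) \<le> 4000 * y" by linarith
  moreover have "2000 * ((m + 1) * b) = (m + 1) * (b * 2000)" by (simp only: mult_ac)
  ultimately have S1: "(m + 1) * (b * 2000) \<le> 4000 * y" by simp
  have "(2 * m + 1) * z \<le> 3 * y" using y1(2) by (simp add: y_def)
  then have "150000 * ((2 * m + 1) * z) \<le> 450000 * y" by linarith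
  moreover have "150000 * ((2 * m + 1) * z) = (2 * m + 1) * (q * (b * (b * 150000)))"
    unfolding z_def by (simp only: mult_ac)
  ultimately have S2: "(2 * m + 1) * (q * (b * (b * 150000))) \<le> 450000 * y" by simp
  have sum: "(n + 1) * 200 + ((E + 1) * 2500 + (x1 + ((F + 1) * 500 + (100 + (x2 + ((m + 1) * 300 + 5000)))))) \<le>
    400 * N + 470000 * y" if x: "x1 \<le> 4000 * y" "x2 \<le> 450000 * y" for x1 x2
  proof -
    have "(n + 1) * 200 \<le> 400 * N" "(E + 1) * 2500 \<le> 2500 * y + 2500" "(F + 1) * 500 \<le> 500 * y + 500"
      "(m + 1) * 300 \<le> 300 * y + 300" using assms(2) Ey Fy y1(1) by simp_all
    moreover have "1 \<le> y" using assms(1) y1(1) by (rule order_trans)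
    ultimately show ?thesis using x by linarith
  qed
  have "(n + 1) * 200 + ((E + 1) * 2500 + ((m + 1) * (b * 2000) + ((F + 1) * 500 + (100 +
      ((2 * m + 1) * (q * (b * (b * 150000))) + ((m + 1) * 300 + 5000)))))) \<le> 400 * N + 470000 * y"
    by (rule sum[OF S1 S2])
  then show ?thesis unfolding y_def z_def b_def q_def power2_eq_square .
qed

theorem theorem6:
  "\<exists>P :: prog. \<forall>d :: nat. \<exists>C :: nat.
     \<forall>(G :: nat pair_pre_digraph) (n :: nat) (es :: (nat \<times> nat) list) (k :: int)
        (par :: nat list) (bags :: nat list list) (r :: nat) (w :: int).
       pair_graph G \<and> pverts G = {0..<n} \<and> edge_list_of G es \<and>
       length par = length bags \<and> (\<forall>b \<in> set bags. distinct b) \<and>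
       nice_tree_decomposition G {0..<length bags} r (\<lambda>t. par ! t) (\<lambda>t. set (bags ! t)) \<and>
       w = width {0..<length bags} (\<lambda>t. set (bags ! t)) \<and>
       length bags \<le> d * (max 1 (nat w) * max 1 n) \<longrightarrow>
       (\<exists>\<tau> s. run P (input_memory (encode_instance n es k par bags)) \<tau> s \<and>
          s 0 = (if TM_deletion {path_graph 4} G k then 1 else 0) \<and>
          \<tau> \<le> C * (36 ^ nat w * max 1 (nat w) * max 1 n))"
proof (intro exI[of _ solve] allI)
  fix d :: nat
  show "\<exists>C :: nat.
     \<forall>(G :: nat pair_pre_digraph) (n :: nat) (es :: (nat \<times> nat) list) (k :: int)
        (par :: nat list) (bags :: nat list list) (r :: nat) (w :: int).
       pair_graph G \<and> pverts G = {0..<n} \<and> edge_list_of G es \<and>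
       length par = length bags \<and> (\<forall>b \<in> set bags. distinct b) \<and>
       nice_tree_decomposition G {0..<length bags} r (\<lambda>t. par ! t) (\<lambda>t. set (bags ! t)) \<and>
       w = width {0..<length bags} (\<lambda>t. set (bags ! t)) \<and>
       length bags \<le> d * (max 1 (nat w) * max 1 n) \<longrightarrow>
       (\<exists>\<tau> s. run solve (input_memory (encode_instance n es k par bags)) \<tau> s \<and>
          s 0 = (if TM_deletion {path_graph 4} G k then 1 else 0) \<and>
          \<tau> \<le> C * (36 ^ nat w * max 1 (nat w) * max 1 n))"
  \<comment> \<open>The factor of \<open>d\<close> is \<open>470000 * 2500\<close>, from
    \<open>time_bound\<close> and from replacing \<open>25 ^ B * (B + 1)^2\<close> by
    \<open>2500 * 36 ^ nat w\<close>; 400 pays for the part linear in \<open>n\<close>.\<close>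
  proof (rule exI[of _ "400 + 1175000000 * d"], intro allI impI, elim conjE)
    fix G :: "nat pair_pre_digraph" and n :: nat and es :: "(nat \<times> nat) list" and k :: int
      and par :: "nat list" and bags :: "nat list list" and r :: nat and w :: int
    assume G: "pair_graph G" and V: "pverts G = {0..<n}" and es: "edge_list_of G es"
      and lp: "length par = length bags" and db: "\<forall>b \<in> set bags. distinct b"
      and nice: "nice_tree_decomposition G {0..<length bags} r (\<lambda>t. par ! t) (\<lambda>t. set (bags ! t))"
      and w: "w = width {0..<length bags} (\<lambda>t. set (bags ! t))"
      and few: "length bags \<le> d * (max 1 (nat w) * max 1 n)"
    define m where "m = length bags"
    define E where "E = length es"
    define f :: "nat list \<Rightarrow> int list" where "f = (\<lambda>b. int (length b) # map int b)"
    define l where "l = (\<lambda>t. length (concat (map f (take t bags))))"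
    define pb where "pb = 4 + 2 * int E"
    define off where "off = (\<lambda>t. pb + int m + int (l t))"
    define F where "F = (\<Sum>t<m. 5 ^ length (bags ! t) :: nat)"
    \<comment> \<open>The largest bag size is \<open>w + 1\<close>; for width \<open>-1\<close> the
      value 1 is still an upper bound.\<close>
    define B where "B = nat w + 1"
    define xs where "xs = encode_instance n es k par bags"
    define inp where "inp = input_memory xs"
    have td: "tree_decomposition G {0..<m} r (\<lambda>t. par ! t) (\<lambda>t. set (bags ! t))"
      and root: "set (bags ! r) = {}" using nice by (auto simp: nice_tree_decomposition_def m_def)
    interpret treedec G "{0..<m}" r "\<lambda>t. par ! t" "\<lambda>t. set (bags ! t)"
      by (rule treedec.intro) (fact G td)+
    interpret sgraph "{0..<n}" "treedec.adj G" using sgraph unfolding V .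
    have rm: "r < m" using rooted(2) by simp
    have dist: "distinct (bags ! t)" if "t < m" for t using db that by (simp add: m_def)
    have len_B: "length (bags ! t) \<le> B" if "t < m" for t
    proof -
      have "card (set (bags ! t)) \<le> Max ((\<lambda>t. card (set (bags ! t))) ` {0..<m})"
        using that by (intro Max_ge) auto
      then have "int (length (bags ! t)) \<le> w + 1"
        unfolding w width_def m_def[symmetric] using distinct_card[OF dist[OF that]] by simp
      then show ?thesis unfolding B_def by linarith
    qed
    have xs: "xs = [int n, k, int E, int m] @ concat (map (\<lambda>(u, v). [int u, int v]) es) @ map int par @ concat (map f bags)"
      by (simp add: xs_def encode_instance_def f_def E_def m_def)
    have len_es: "length (concat (map (\<lambda>(u, v). [int u, int v]) es)) = 2 * E"
      by (simp add: concat_pairs(1) E_def)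
    have lenxs: "length xs = 4 + (2 * E + (m + length (concat (map f bags))))"
      unfolding xs using len_es by (simp add: lp m_def)
    have inp_nth: "inp (int i) = xs ! i" if "i < length xs" for i
      using input_memory_nth[OF that] by (simp add: inp_def)
    have h: "inp 0 = int n" "inp 1 = k" "inp 2 = int E" "inp 3 = int m"
      using inp_nth[of 0] inp_nth[of 1] inp_nth[of 2] inp_nth[of 3] lenxs by (simp_all add: xs)
    have x_es: "xs ! (4 + i) = concat (map (\<lambda>(u, v). [int u, int v]) es) ! i" if "i < 2 * E" for i
      using that len_es by (simp add: xs nth_append)
    have x_par: "xs ! (4 + (2 * E + i)) = int (par ! i)" if "i < m" for i
      using that len_es lp by (simp add: xs nth_append m_def)
    have x_bag: "xs ! (4 + (2 * E + (m + i))) = concat (map f bags) ! i" for i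
      using len_es lp by (simp add: xs nth_append m_def)
    have inp_es: "inp (4 + 2 * int j) = int (fst (es ! j)) \<and> inp (5 + 2 * int j) = int (snd (es ! j))" if "j < E" for j
    proof -
      have "inp (int (4 + 2 * j)) = xs ! (4 + 2 * j)" "inp (int (4 + (2 * j + 1))) = xs ! (4 + (2 * j + 1))"
        using that lenxs by (intro inp_nth; simp)+
      then have "inp (int (4 + 2 * j)) = int (fst (es ! j))" "inp (int (4 + (2 * j + 1))) = int (snd (es ! j))"
        using x_es[of "2 * j"] x_es[of "2 * j + 1"] concat_pairs(2)[of j es] that by (simp_all add: E_def)
      moreover have "int (4 + 2 * j) = 4 + 2 * int j" "int (4 + (2 * j + 1)) = 5 + 2 * int j" by simp_all
      ultimately show ?thesis by (simp only:)
    qed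
    have inp_par: "inp (pb + int t) = int (par ! t)" if "t < m" for t
    proof -
      have "inp (int (4 + (2 * E + t))) = int (par ! t)"
        using that lenxs inp_nth[of "4 + (2 * E + t)"] x_par[OF that] by simp
      moreover have "int (4 + (2 * E + t)) = pb + int t" by (simp add: pb_def)
      ultimately show ?thesis by (simp only:)
    qed
    have inp_bags: "inp (off t + int i) = f (bags ! t) ! i" if "t < m" "i < length (f (bags ! t))" for t i
    proof -
      have c: "concat (map f bags) ! (l t + i) = f (bags ! t) ! i" "l t + i < length (concat (map f bags))"
        using concat_nth[of t bags i f] that by (simp_all add: l_def m_def)
      have "inp (int (4 + (2 * E + (m + (l t + i))))) = f (bags ! t) ! i"
        using inp_nth[of "4 + (2 * E + (m + (l t + i)))"] lenxs x_bag[of "l t + i"] c by simp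
      moreover have "int (4 + (2 * E + (m + (l t + i)))) = off t + int i" by (simp add: off_def pb_def)
      ultimately show ?thesis by (simp only:)
    qed
    interpret encoded G r n m par bags pb off F B inp es k
    proof unfold_locales
      show "par ! t < m" if "t < m" for t using rooted(4)[of t] that by simp
      show "set (bags ! t) \<subseteq> {0..<n}" if "t < m" for t using bags_V that unfolding V by auto
      show "inp (off t) = int (length (bags ! t))" if "t < m" for t
        using inp_bags[OF that, of 0] by (simp add: f_def)
      show "inp (off t + 1 + int i) = int (bags ! t ! i)" if "t < m" "i < length (bags ! t)" for t i
        using inp_bags[OF that(1), of "Suc i"] that(2) by (simp add: f_def add.assoc)
      show "5 ^ length (bags ! t) \<le> F" if "t < m" for t
        unfolding F_def using that by (intro member_le_sum) auto
      show "off (Suc t) = off t + 1 + int (length (bags ! t))" if "t < m" for t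
        using that by (simp add: off_def l_def f_def m_def take_Suc_conv_app_nth)
    qed (use dist len_B h inp_es inp_par V es in \<open>simp_all add: pb_def off_def l_def E_def F_def\<close>)
    have "halts solve ((n + 1) * 200 + ((length es + 1) * 2500 + ((m + 1) * ((B + 1) * 2000) + ((F + 1) * 500 + (100 +
      ((2 * m + 1) * (25 ^ B * ((B + 1) * ((B + 1) * 150000))) + ((m + 1) * 300 + 5000)))))))
      (\<lambda>s. s 0 = (if TM_deletion {path_graph 4} G k then 1 else 0)) inp"
      by (rule halts_solve) (use root in \<open>simp_all add: inp_def input_memory_def\<close>)
    then obtain \<tau> s where run: "run solve inp \<tau> s" and ans: "s 0 = (if TM_deletion {path_graph 4} G k then 1 else 0)"
      and \<tau>: "\<tau> \<le> (n + 1) * 200 + ((length es + 1) * 2500 + ((m + 1) * ((B + 1) * 2000) + ((F + 1) * 500 + (100 +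
      ((2 * m + 1) * (25 ^ B * ((B + 1) * ((B + 1) * 150000))) + ((m + 1) * 300 + 5000))))))"
      unfolding halts_def by blast
    define v where "v = nat w"
    define W where "W = max 1 v"
    define N where "N = max 1 n"
    have pos: "1 \<le> W" "1 \<le> N" "n + 1 \<le> 2 * N" by (auto simp: W_def N_def)
    have "length es \<le> m * (B * B)"
    proof (rule card_edges[OF G es td])
      show "card (set (bags ! t)) \<le> B" if "t < m" for t using len_B[OF that] distinct_card[OF dist[OF that]] by simp
    qed simp
    moreover have "F \<le> m * 5 ^ B"
    proof -
      have "F \<le> (\<Sum>t<m. 5 ^ B)" unfolding F_def using len_B by (intro sum_mono power_increasing) auto
      then show ?thesis by simp
    qed
    ultimately have "\<tau> \<le> 400 * N + 470000 * (m * (25 ^ B * (B + 1)\<^sup>2))"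
      using order_trans[OF \<tau> time_bound[of m n N "length es" B F]] rm pos(3) by linarith
    also have "25 ^ B * (B + 1)\<^sup>2 \<le> 2500 * 36 ^ v"
    proof -
      \<comment> \<open>Passing from \<open>B = v + 1\<close> to \<open>v\<close> costs a factor 25
        in the power and at most 4 in the square; \<open>square_exp_bound\<close> contributes
        another 25.\<close>
      have "(v + 2)\<^sup>2 \<le> (2 * (v + 1))\<^sup>2" by (intro power_mono) simp_all
      then have "(v + 2)\<^sup>2 \<le> 4 * (v + 1)\<^sup>2" by (simp only: power_mult_distrib) simp
      then have "25 ^ B * (B + 1)\<^sup>2 \<le> 25 ^ B * (4 * (v + 1)\<^sup>2)"
        unfolding B_def v_def by (intro mult_le_mono2) (simp add: numeral_2_eq_2)
      also have "\<dots> = 100 * ((v + 1)\<^sup>2 * 25 ^ v)" by (simp add: B_def v_def)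
      also have "\<dots> \<le> 100 * (25 * 36 ^ v)" using square_exp_bound by (rule mult_le_mono2)
      finally show ?thesis by simp
    qed
    also have "m * (2500 * 36 ^ v) \<le> d * (W * N) * (2500 * 36 ^ v)"
      using few unfolding m_def[symmetric] W_def N_def v_def by (rule mult_le_mono1)
    finally have "\<tau> \<le> 400 * N + 470000 * (d * (W * N) * (2500 * 36 ^ v))" by simp
    also have "\<dots> \<le> (400 + 1175000000 * d) * (36 ^ v * W * N)"
    proof -
      have "1 * 1 * N \<le> 36 ^ v * W * N" using pos(1) by (intro mult_le_mono1 mult_le_mono) simp_all
      moreover have "470000 * (d * (W * N) * (2500 * 36 ^ v)) = 1175000000 * d * (36 ^ v * W * N)" by simp
      ultimately show ?thesis by (simp add: distrib_right)
    qed
    finally show "\<exists>\<tau> s. run solve (input_memory (encode_instance n es k par bags)) \<tau> s \<and>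
          s 0 = (if TM_deletion {path_graph 4} G k then 1 else 0) \<and>
          \<tau> \<le> (400 + 1175000000 * d) * (36 ^ nat w * max 1 (nat w) * max 1 n)"
      using run ans unfolding inp_def xs_def v_def W_def N_def by blast
  qed
qed

end
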